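(* Let $\mathbf d\in\mathbb Z^2_{>0}$, let $\mathbf f=(f_0,f_1,f_2)$ be polynomials in $R_{\mathbf d}$ spanning a three-dimensional space $W$, and assume $\sqrt{I_W}=B$. Let $H_1$ be the first Koszul homology module of $\mathbf f$ on $R$. Then there is an isomorphism of bigraded $R$-modules $$H_1\;\cong\;\ker\Big(H^2_B(R(-3\mathbf d))\xrightarrow{\ \delta\ }\big(H^2_B(R(-2\mathbf d))\big)^3\Big),$$ where $\delta$ is the map induced on local cohomology by the Koszul differential $\delta_3:R(-3\mathbf d)\to R(-2\mathbf d)^3$.
   Context: $\mathbb K$ is a field and $R=\mathbb K[s,t;u,v]$ is $\mathbb Z^2$-graded with $\deg s=\deg t=(1,0)$ and $\deg u=\deg v=(0,1)$. $R_{\mathbf d}$ is the graded piece of bidegree $\mathbf d$. $B=\langle s,t\rangle\cap\langle u,v\rangle$ and $I_W=\langle f_0,f_1,f_2\rangle$. $H^i_B$ denotes local cohomology with support in $B$. The Koszul complex of $\mathbf f$ is the bigraded complex $$0\to R(-3\mathbf d)\xrightarrow{\delta_3}R(-2\mathbf d)^3\xrightarrow{\delta_2}R(-\mathbf d)^3\xrightarrow{\delta_1}R\to 0,$$ with $\delta_j(e_{n_1}\wedge\cdots\wedge e_{n_j})=\sum_{i=1}^j(-1)^i f_{n_i}\,e_{n_1}\wedge\cdots\widehat{e_{n_i}}\cdots\wedge e_{n_j}$, and $H_1=\ker\delta_1/\operatorname{im}\delta_2$, graded so that all inclusions and differentials have degree $(0,0)$. *)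

theory Defs
  imports Complex_Main "HOL-Algebra.Ideal" "HOL-Algebra.Module" "HOL-Library.Poly_Mapping" "HOL-Library.Product_Plus"
begin

section \<open>Bigraded modules over a commutative ring\<close>

text \<open>
  A bigraded ring is represented by the same record as a bigraded module: it is a bigraded module
  over itself, and the ring operations are the ones inherited from the record type for rings.
  For other modules the fields for multiplication and unit are meaningless.
\<close>

record ('a, 'b) bigraded_module = "('a, 'b) module" +
  piece :: "int \<times> int \<Rightarrow> 'b set"

definition shift :: "('a, 'b, 'm) bigraded_module_scheme \<Rightarrow> int \<times> int \<Rightarrow> ('a, 'b, 'm) bigraded_module_scheme"
  where "shift M a = M\<lparr>piece := \<lambda>d. piece M (a + d)\<rparr>"

definition multiple :: "int \<Rightarrow> int \<times> int \<Rightarrow> int \<times> int"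
  where "multiple k d = (k * fst d, k * snd d)"

definition dsum :: "'i set \<Rightarrow> ('i \<Rightarrow> ('a, 'b) bigraded_module) \<Rightarrow> ('a, 'i \<Rightarrow> 'b) bigraded_module"
  where \<comment> \<open>only used for finite index sets, where it is both the direct sum and the product\<close>
    "dsum I M =
      \<lparr>carrier = (\<Pi>\<^sub>E i\<in>I. carrier (M i)),
       monoid.mult = undefined,
       one = undefined,
       ring.zero = (\<lambda>i\<in>I. \<zero>\<^bsub>M i\<^esub>),
       ring.add = (\<lambda>x y. \<lambda>i\<in>I. x i \<oplus>\<^bsub>M i\<^esub> y i),
       module.smult = (\<lambda>r x. \<lambda>i\<in>I. r \<odot>\<^bsub>M i\<^esub> x i),
       piece = (\<lambda>d. \<Pi>\<^sub>E i\<in>I. piece (M i) d)\<rparr>"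

definition kernel_module ::
  "('a, 'b) bigraded_module \<Rightarrow> ('b \<Rightarrow> 'c) \<Rightarrow> ('a, 'c) bigraded_module \<Rightarrow> ('a, 'b) bigraded_module"
  where "kernel_module M h N =
    M\<lparr>carrier := {x \<in> carrier M. h x = \<zero>\<^bsub>N\<^esub>},
      piece := \<lambda>d. {x \<in> piece M d. h x = \<zero>\<^bsub>N\<^esub>}\<rparr>"

definition quotient_module ::
  "('a, 'b) bigraded_module \<Rightarrow> 'b set \<Rightarrow> ('a, 'b set) bigraded_module"
  where "quotient_module M H =
    \<lparr>carrier = a_rcosets\<^bsub>M\<^esub> H,
     monoid.mult = undefined,
     one = undefined,
     ring.zero = H,
     ring.add = (\<lambda>X Y. X <+>\<^bsub>M\<^esub> Y),
     module.smult = (\<lambda>r X. \<Union>x\<in>X. H +>\<^bsub>M\<^esub> (r \<odot>\<^bsub>M\<^esub> x)),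
     piece = (\<lambda>d. (\<lambda>x. H +>\<^bsub>M\<^esub> x) ` piece M d)\<rparr>"

definition bigraded_iso ::
  "('a, 'r) ring_scheme \<Rightarrow> ('a, 'b) bigraded_module \<Rightarrow> ('a, 'c) bigraded_module \<Rightarrow> ('b \<Rightarrow> 'c) set"
  where "bigraded_iso R M N =
    {h \<in> iso (add_monoid M) (add_monoid N).
       (\<forall>r\<in>carrier R. \<forall>x\<in>carrier M. h (r \<odot>\<^bsub>M\<^esub> x) = r \<odot>\<^bsub>N\<^esub> h x) \<and>
       (\<forall>d. h ` piece M d = piece N d)}"

definition radical :: "('a, 'r) ring_scheme \<Rightarrow> 'a set \<Rightarrow> 'a set"
  where "radical R I = {a \<in> carrier R. \<exists>n::nat. a [^]\<^bsub>R\<^esub> n \<in> I}"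


section \<open>Localization\<close>

definition fraction ::
  "('a, 'r) ring_scheme \<Rightarrow> 'a set \<Rightarrow> ('a, 'b) bigraded_module \<Rightarrow> 'b \<Rightarrow> 'a \<Rightarrow> ('b \<times> 'a) set"
  where \<comment> \<open>the class of the fraction of numerator \<open>m\<close> and denominator \<open>s\<close>\<close>
    "fraction R S M m s =
      {(m', s'). m' \<in> carrier M \<and> s' \<in> S \<and>
         (\<exists>t\<in>S. (t \<otimes>\<^bsub>R\<^esub> s') \<odot>\<^bsub>M\<^esub> m = (t \<otimes>\<^bsub>R\<^esub> s) \<odot>\<^bsub>M\<^esub> m')}"

text \<open>
  Localization at a multiplicative set of homogeneous elements. Operations on classes are given by
  the union over all representatives; every representative contributes the same class.
\<close>

definition localization ::
  "('a, 'a) bigraded_module \<Rightarrow> 'a set \<Rightarrow> ('a, 'b) bigraded_module \<Rightarrow> ('a, ('b \<times> 'a) set) bigraded_module"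
  where "localization R S M =
    \<lparr>carrier = {fraction R S M m s | m s. m \<in> carrier M \<and> s \<in> S},
     monoid.mult = undefined,
     one = undefined,
     ring.zero = fraction R S M \<zero>\<^bsub>M\<^esub> \<one>\<^bsub>R\<^esub>,
     ring.add = (\<lambda>x y. \<Union>(m, s)\<in>x. \<Union>(n, t)\<in>y.
              fraction R S M (t \<odot>\<^bsub>M\<^esub> m \<oplus>\<^bsub>M\<^esub> s \<odot>\<^bsub>M\<^esub> n) (s \<otimes>\<^bsub>R\<^esub> t)),
     module.smult = (\<lambda>r x. \<Union>(m, s)\<in>x. fraction R S M (r \<odot>\<^bsub>M\<^esub> m) s),
     piece = (\<lambda>d. {fraction R S M m s | m s e.
                     s \<in> S \<and> s \<in> piece R e \<and> m \<in> piece M (d + e)})\<rparr>"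

definition localization_map ::
  "('a, 'r) ring_scheme \<Rightarrow> 'a set \<Rightarrow> ('a, 'c) bigraded_module \<Rightarrow> ('b \<Rightarrow> 'c)
    \<Rightarrow> ('b \<times> 'a) set \<Rightarrow> ('c \<times> 'a) set"
  where \<comment> \<open>maps \<open>m/s\<close> to \<open>h m/s\<close>, the latter a fraction with respect to \<open>S\<close>; the source may be a
      localization at any multiplicative subset of \<open>S\<close>\<close>
    "localization_map R S N h x = (\<Union>(m, s)\<in>x. fraction R S N (h m) s)"


section \<open>Local cohomology\<close>

text \<open>
  The local cohomology of \<open>M\<close> with support in the ideal generated by the homogeneous elements
  \<open>g\<^sub>0, \<dots>, g\<^sub>r\<^sub>-\<^sub>1\<close> is the cohomology of the (extended) Cech complex, whose
  term in degree \<open>p\<close> is the direct sum, over all sets \<open>I\<close> of \<open>p\<close> indices, of the localization of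
  \<open>M\<close> at the product of the \<open>g\<^sub>i\<close> with \<open>i \<in> I\<close>. Inverting that product is the same as
  inverting all monomials in the \<open>g\<^sub>i\<close> with \<open>i \<in> I\<close>; with the latter choice of denominators
  the restriction maps simply send \<open>m/s\<close> to \<open>m/s\<close>.
\<close>

definition subsets_of_size :: "nat \<Rightarrow> nat \<Rightarrow> nat set set"
  where "subsets_of_size n p = {I. I \<subseteq> {..<n} \<and> card I = p}"

definition denominators :: "('a, 'r) ring_scheme \<Rightarrow> 'a list \<Rightarrow> nat set \<Rightarrow> 'a set"
  where "denominators R gs I =
    {\<Otimes>\<^bsub>R\<^esub>i\<in>I. (gs ! i) [^]\<^bsub>R\<^esub> a i | a :: nat \<Rightarrow> nat. True}"

definition cech_module ::
  "('a, 'a) bigraded_module \<Rightarrow> 'a list \<Rightarrow> nat \<Rightarrow> ('a, 'b) bigraded_module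
    \<Rightarrow> ('a, nat set \<Rightarrow> ('b \<times> 'a) set) bigraded_module"
  where "cech_module R gs p M =
    dsum (subsets_of_size (length gs) p) (\<lambda>I. localization R (denominators R gs I) M)"

definition cech_differential ::
  "('a, 'a) bigraded_module \<Rightarrow> 'a list \<Rightarrow> nat \<Rightarrow> ('a, 'b) bigraded_module
    \<Rightarrow> (nat set \<Rightarrow> ('b \<times> 'a) set) \<Rightarrow> (nat set \<Rightarrow> ('b \<times> 'a) set)"
  where \<comment> \<open>from degree \<open>p\<close> to degree \<open>p + 1\<close>\<close>
    "cech_differential R gs p M c =
      (\<lambda>J\<in>subsets_of_size (length gs) (p + 1).
        let L = localization R (denominators R gs J) M in
        \<Oplus>\<^bsub>L\<^esub>j\<in>J. ((\<ominus>\<^bsub>R\<^esub> \<one>\<^bsub>R\<^esub>) [^]\<^bsub>R\<^esub> card {i \<in> J. i < j}) \<odot>\<^bsub>L\<^esub>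
          localization_map R (denominators R gs J) M (\<lambda>m. m) (c (J - {j})))"

definition cech_boundaries ::
  "('a, 'a) bigraded_module \<Rightarrow> 'a list \<Rightarrow> nat \<Rightarrow> ('a, 'b) bigraded_module
    \<Rightarrow> (nat set \<Rightarrow> ('b \<times> 'a) set) set"
  where "cech_boundaries R gs p M =
    (case p of 0 \<Rightarrow> {\<zero>\<^bsub>cech_module R gs 0 M\<^esub>}
     | Suc q \<Rightarrow> cech_differential R gs q M ` carrier (cech_module R gs q M))"

definition local_cohomology ::
  "('a, 'a) bigraded_module \<Rightarrow> 'a list \<Rightarrow> nat \<Rightarrow> ('a, 'b) bigraded_module
    \<Rightarrow> ('a, (nat set \<Rightarrow> ('b \<times> 'a) set) set) bigraded_module"
  where "local_cohomology R gs p M =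
    quotient_module
      (kernel_module (cech_module R gs p M) (cech_differential R gs p M) (cech_module R gs (p + 1) M))
      (cech_boundaries R gs p M)"

definition local_cohomology_map ::
  "('a, 'a) bigraded_module \<Rightarrow> 'a list \<Rightarrow> nat \<Rightarrow> ('a, 'c) bigraded_module \<Rightarrow> ('b \<Rightarrow> 'c)
    \<Rightarrow> (nat set \<Rightarrow> ('b \<times> 'a) set) set \<Rightarrow> (nat set \<Rightarrow> ('c \<times> 'a) set) set"
  where \<comment> \<open>the map into the local cohomology of \<open>N\<close> induced by a homomorphism \<open>h\<close> into \<open>N\<close>\<close>
    "local_cohomology_map R gs p N h X =
      (\<Union>c\<in>X. cech_boundaries R gs p N +>\<^bsub>cech_module R gs p N\<^esub>
        (\<lambda>I\<in>subsets_of_size (length gs) p. localization_map R (denominators R gs I) N h (c I)))"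


section \<open>The Koszul complex\<close>

text \<open>
  For \<open>n\<close> forms \<open>f\<^sub>0, \<dots>, f\<^sub>n\<^sub>-\<^sub>1\<close> of bidegree \<open>d\<close>. A subset
  \<open>J = {n\<^sub>1 < \<dots> < n\<^sub>p}\<close> stands for the basis element
  \<open>e\<^sub>n\<^sub>1 \<and> \<dots> \<and> e\<^sub>n\<^sub>p\<close>, and an element of the \<open>p\<close>-th term is
  its family of coefficients. In the differential, the coefficient at \<open>J\<close> collects the
  contributions of the basis elements indexed by \<open>J \<union> {k}\<close>; the sign of such a contribution is
  given by the position (counted from 1) of \<open>k\<close> in \<open>J \<union> {k}\<close>.
\<close>

definition koszul_module ::
  "('a, 'a) bigraded_module \<Rightarrow> int \<times> int \<Rightarrow> nat \<Rightarrow> nat \<Rightarrow> ('a, nat set \<Rightarrow> 'a) bigraded_module"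
  where "koszul_module R d n p =
    dsum (subsets_of_size n p) (\<lambda>_. shift R (multiple (- int p) d))"

definition koszul_differential ::
  "('a, 'a) bigraded_module \<Rightarrow> (nat \<Rightarrow> 'a) \<Rightarrow> nat \<Rightarrow> nat \<Rightarrow> (nat set \<Rightarrow> 'a) \<Rightarrow> (nat set \<Rightarrow> 'a)"
  where \<comment> \<open>from the \<open>p\<close>-th to the \<open>(p - 1)\<close>-st term, for \<open>p > 0\<close>\<close>
    "koszul_differential R f n p c =
      (\<lambda>J\<in>subsets_of_size n (p - 1).
        \<Oplus>\<^bsub>R\<^esub>k\<in>{..<n} - J.
          (\<ominus>\<^bsub>R\<^esub> \<one>\<^bsub>R\<^esub>) [^]\<^bsub>R\<^esub> card {i \<in> insert k J. i \<le> k} \<otimes>\<^bsub>R\<^esub> f k \<otimes>\<^bsub>R\<^esub> c (insert k J))"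

definition koszul_H1 ::
  "('a, 'a) bigraded_module \<Rightarrow> int \<times> int \<Rightarrow> (nat \<Rightarrow> 'a) \<Rightarrow> nat \<Rightarrow> ('a, (nat set \<Rightarrow> 'a) set) bigraded_module"
  where "koszul_H1 R d f n =
    quotient_module
      (kernel_module (koszul_module R d n 1) (koszul_differential R f n 1) (koszul_module R d n 0))
      (koszul_differential R f n 2 ` carrier (koszul_module R d n 2))"

definition koszul_top ::
  "('a, 'a) bigraded_module \<Rightarrow> (nat \<Rightarrow> 'a) \<Rightarrow> nat \<Rightarrow> 'a \<Rightarrow> (nat set \<Rightarrow> 'a)"
  where \<comment> \<open>the \<open>n\<close>-th differential on the free module of rank one generated by
      \<open>e\<^sub>0 \<and> \<dots> \<and> e\<^sub>n\<^sub>-\<^sub>1\<close>, this module being identified with (a shift of) the ring\<close>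
    "koszul_top R f n r = koszul_differential R f n n (\<lambda>I\<in>subsets_of_size n n. r)"

definition koszul_local_cohomology_map ::
  "('a, 'a) bigraded_module \<Rightarrow> 'a list \<Rightarrow> nat \<Rightarrow> int \<times> int \<Rightarrow> (nat \<Rightarrow> 'a) \<Rightarrow> nat
    \<Rightarrow> (nat set \<Rightarrow> ('a \<times> 'a) set) set \<Rightarrow> nat set \<Rightarrow> (nat set \<Rightarrow> ('a \<times> 'a) set) set"
  where \<comment> \<open>the map induced by \<open>koszul_top\<close> on local cohomology in degree \<open>p\<close>; its component at
      \<open>J\<close> is induced by the component at \<open>J\<close> of \<open>koszul_top\<close>\<close>
    "koszul_local_cohomology_map R gs p d f n X =
      (\<lambda>J\<in>subsets_of_size n (n - 1).
        local_cohomology_map R gs p (shift R (multiple (- int (n - 1)) d))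
          (\<lambda>r. koszul_top R f n r J) X)"


section \<open>The bigraded polynomial ring in two pairs of variables\<close>

datatype var = Var_s | Var_t | Var_u | Var_v

type_synonym 'k bipoly = "(var \<Rightarrow>\<^sub>0 nat) \<Rightarrow>\<^sub>0 'k"

definition indet :: "var \<Rightarrow> 'k::field bipoly"
  where "indet x = Poly_Mapping.single (Poly_Mapping.single x 1) 1"

definition bidegree :: "(var \<Rightarrow>\<^sub>0 nat) \<Rightarrow> int \<times> int"
  where "bidegree m = (int (Poly_Mapping.lookup m Var_s + Poly_Mapping.lookup m Var_t), int (Poly_Mapping.lookup m Var_u + Poly_Mapping.lookup m Var_v))"

definition bipoly_ring :: "('k::field bipoly, 'k bipoly) bigraded_module"
  where "bipoly_ring =
    \<lparr>carrier = UNIV, monoid.mult = (*), one = 1, ring.zero = 0, ring.add = (+), module.smult = (*),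
     piece = (\<lambda>d. {p. \<forall>m\<in>Poly_Mapping.keys p. bidegree m = d})\<rparr>"

definition const_scale :: "'k::field \<Rightarrow> 'k bipoly \<Rightarrow> 'k bipoly"
  where "const_scale c p = Poly_Mapping.single 0 c * p"

lemma vector_space_const_scale: "vector_space (const_scale :: 'k::field \<Rightarrow> _)"
  unfolding vector_space_def const_scale_def
  by (simp add: distrib_left distrib_right single_add mult_single flip: mult.assoc)

definition irrelevant_ideal :: "'k::field bipoly set"
  where "irrelevant_ideal =
    Idl\<^bsub>bipoly_ring\<^esub> {indet Var_s, indet Var_t} \<inter> Idl\<^bsub>bipoly_ring\<^esub> {indet Var_u, indet Var_v}"

end

theory Submission
  imports Defs
begin

text \<open>
  Let \<open>C\<^sup>p(K\<^sub>q)\<close> be the double complex of Cech cochains on the generators \<open>g\<^sub>i\<close> of the irrelevant ideal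
  \<open>B\<close> with values in the Koszul complex \<open>K\<close> of \<open>f\<^sub>0, f\<^sub>1, f\<^sub>2\<close>; write \<open>d\<close> for the Cech differential and
  \<open>\<delta>\<close> for the Koszul differential. Two facts drive the proof.

  \<^item> A power of every \<open>g\<^sub>i\<close> lies in the ideal of the \<open>f\<^sub>k\<close>. Hence the Koszul complex becomes exact after
    inverting any \<open>g\<^sub>i\<close>, so \<open>C\<^sup>p(K)\<close> is exact for \<open>p > 0\<close> (\<open>koszul_exact_1\<close>, \<open>koszul_exact_2\<close>,
    \<open>koszul_exact_3\<close>).

  \<^item> The ideal \<open>B\<close> contains the products \<open>su\<close> and \<open>tv\<close>, which have no variable in common and therefore form
    a regular sequence (\<open>monomial_regular_2\<close>). Hence the Cech complex of \<open>R\<close> has no cohomology in degrees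
    \<open>0\<close> and \<open>1\<close> (\<open>cech_0_exact\<close>, \<open>cech_1_exact\<close>).

  A cycle \<open>x \<in> K\<^sub>1\<close> becomes a boundary \<open>d x = \<delta> y\<close> with \<open>y \<in> C\<^sup>1(K\<^sub>2)\<close>. Since \<open>\<delta> d y = d d x = 0\<close>, exactness
  gives \<open>d y = \<delta> z\<close> with \<open>z \<in> C\<^sup>2(K\<^sub>3)\<close>, and \<open>\<delta> d z = 0\<close> makes \<open>z\<close> a cocycle. The isomorphism sends the class
  of \<open>x\<close> to the class of \<open>z\<close>, which \<open>\<delta>\<close> maps to the class of the boundary \<open>d y\<close>, that is to zero. The
  first fact shows that the class of \<open>z\<close> exists (\<open>zigzag_total\<close>) and depends only on that of \<open>x\<close>
  (\<open>zigzag_of_boundary\<close>); the second one lets the construction run backwards, which gives surjectivity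
  (\<open>zigzag_surjective\<close>) and injectivity (\<open>zigzag_to_boundary\<close>).

  Computations in localizations are reduced to computations in \<open>R\<close> as follows. A cochain is a finite family of fractions,
  so its components have the form \<open>m\<^sub>I / g\<^sub>I\<^sup>N\<close> with one exponent \<open>N\<close>, called its level, where
  \<open>g\<^sub>I\<close> is the product of the \<open>g\<^sub>i\<close> with \<open>i \<in> I\<close>. Two cochains of the same level agree if and only if their
  numerators agree after multiplication by some \<open>g\<^sub>I\<^sup>K\<close>, that is, at a higher level. So
  every relation between cochains becomes an identity between families of elements of \<open>R\<close> at a
  sufficiently high level, and the whole argument above takes place in \<open>R\<close>.

  The zigzag \<open>(x, y, z)\<close> involves choices, so it is treated as a relation between classes, and
  \<open>bigraded_iso_of_relation\<close> turns the relation into an isomorphism. As the \<open>f\<^sub>k\<close> and \<open>g\<^sub>i\<close> are homogeneous, the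
  homogeneous components of a zigzag form a zigzag again (\<open>zigzag_component\<close>), and this is what makes
  the isomorphism respect the bigrading.
\<close>

section \<open>Cech cochains with common denominators\<close>

(* Otherwise the index 1 of a basis element is rewritten to Suc 0. *)
declare One_nat_def [simp del]

text \<open>The denominator of the component at \<open>I\<close> of a cochain of level \<open>N\<close>.\<close>
definition prod_power :: "(nat \<Rightarrow> 'a::comm_ring_1) \<Rightarrow> nat \<Rightarrow> nat set \<Rightarrow> 'a"
  where "prod_power g N I = (\<Prod>i\<in>I. g i ^ N)"

lemma prod_power_add: "prod_power g (M + N) I = prod_power g M I * prod_power g N I"
  by (simp add: prod_power_def power_add prod.distrib)

lemma prod_power_zero [simp]: "prod_power g 0 I = 1"
  by (simp add: prod_power_def)

lemma prod_power_singleton [simp]: "prod_power g N {i} = g i ^ N"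
  by (simp add: prod_power_def)

lemma prod_power_remove:
  assumes "finite J" "j \<in> J"
  shows "prod_power g N J = g j ^ N * prod_power g N (J - {j})"
  using prod.remove[OF assms, of "\<lambda>i. g i ^ N"] by (simp add: prod_power_def)

text \<open>
  The Cech differential in terms of numerators: it maps the cochain with components \<open>m I / g\<^sub>I\<^sup>N\<close> to the
  one with components \<open>cech_level g N m J / g\<^sub>J\<^sup>N\<close>. The factor \<open>g\<^sub>j\<^sup>N\<close> extends the
  denominator from \<open>J - {j}\<close> to \<open>J\<close>.
\<close>
definition cech_level :: "(nat \<Rightarrow> 'a::comm_ring_1) \<Rightarrow> nat \<Rightarrow> (nat set \<Rightarrow> 'a) \<Rightarrow> nat set \<Rightarrow> 'a"
  where "cech_level g N m J = (\<Sum>j\<in>J. (- 1) ^ card {i \<in> J. i < j} * (g j ^ N * m (J - {j})))"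

lemma cech_level_cong:
  "(\<And>j. j \<in> J \<Longrightarrow> m (J - {j}) = m' (J - {j})) \<Longrightarrow> cech_level g N m J = cech_level g N m' J"
  by (simp add: cech_level_def)

lemma cech_level_add: "cech_level g N (\<lambda>I. m I + m' I) J = cech_level g N m J + cech_level g N m' J"
  by (simp add: cech_level_def algebra_simps sum.distrib)

lemma cech_level_scale: "cech_level g N (\<lambda>I. a * m I) J = a * cech_level g N m J"
  by (simp add: cech_level_def algebra_simps sum_distrib_left)

lemma cech_level_diff: "cech_level g N (\<lambda>I. m I - m' I) J = cech_level g N m J - cech_level g N m' J"
  by (simp add: cech_level_def algebra_simps sum_subtractf)

text \<open>
  Multiplying the numerators by \<open>g\<^sub>I\<^sup>M\<close> passes from level \<open>N\<close> to level \<open>N + M\<close> without changing the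
  fractions, and this is compatible with the differential.
\<close>
lemma cech_level_raise:
  assumes "finite J"
  shows "cech_level g (N + M) (\<lambda>I. prod_power g M I * m I) J = prod_power g M J * cech_level g N m J"
  unfolding cech_level_def sum_distrib_left
proof (rule sum.cong[OF refl])
  fix j assume "j \<in> J"
  then show "(- 1) ^ card {i \<in> J. i < j} * (g j ^ (N + M) * (prod_power g M (J - {j}) * m (J - {j}))) =
      prod_power g M J * ((- 1) ^ card {i \<in> J. i < j} * (g j ^ N * m (J - {j})))"
    using prod_power_remove[OF assms, of j g M] by (simp add: power_add algebra_simps)
qed

lemma cech_level_singleton [simp]: "cech_level g N m {i} = g i ^ N * m {}"
proof -
  have "{k \<in> {i}. k < i} = {}" by auto
  then have card: "card {k \<in> {i}. k < i} = 0" by (simp only: card.empty)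
  have "cech_level g N m {i} = (- 1) ^ card {k \<in> {i}. k < i} * (g i ^ N * m ({i} - {i}))"
    by (simp add: cech_level_def)
  then show ?thesis unfolding card by simp
qed

lemma cech_level_pair:
  assumes "i < j"
  shows "cech_level g N m {i, j} = g i ^ N * m {j} - g j ^ N * m {i}"
proof -
  have "{k \<in> {i, j}. k < i} = {}" "{k \<in> {i, j}. k < j} = {i}"
    using assms by auto
  then have card: "card {k \<in> {i, j}. k < i} = 0" "card {k \<in> {i, j}. k < j} = 1" by (simp_all only: card.empty) simp
  have minus: "{i, j} - {i} = {j}" "{i, j} - {j} = {i}"
    using assms by auto
  have "cech_level g N m {i, j} =
      (- 1) ^ card {k \<in> {i, j}. k < i} * (g i ^ N * m ({i, j} - {i}))
      + (- 1) ^ card {k \<in> {i, j}. k < j} * (g j ^ N * m ({i, j} - {j}))"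
    using assms by (simp add: cech_level_def)
  then show ?thesis unfolding card minus by simp
qed

text \<open>
  The two ways of removing a pair of indices from \<open>J\<close> carry opposite signs.
\<close>
lemma cech_level_cech_level:
  assumes "finite J"
  shows "cech_level g N (cech_level g N m) J = 0"
proof -
  define s where "s j = card {i \<in> J. i < j}" for j
  define h where "h j i = g j ^ N * g i ^ N * m (J - {i, j})" for i j
  have h_sym: "h j i = h i j" for i j
    by (simp add: h_def insert_commute mult.commute)
  have card_less: "card {k \<in> J - {j}. k < i} = (if j < i then s i - 1 else s i)" if "j \<in> J" for i j
  proof (cases "j < i")
    case True
    then have "{k \<in> J - {j}. k < i} = {k \<in> J. k < i} - {j}" by auto
    then show ?thesis using True that assms by (simp add: s_def card_Diff_singleton)
  next
    case False
    then have "{k \<in> J - {j}. k < i} = {k \<in> J. k < i}" by auto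
    then show ?thesis using False by (simp add: s_def)
  qed
  have s_pos: "s i > 0" if "j \<in> J" "j < i" for i j
    using that assms by (auto simp: s_def card_gt_0_iff)
  have "cech_level g N (cech_level g N m) J =
      (\<Sum>j\<in>J. \<Sum>i\<in>J - {j}. (- 1) ^ (s j + card {k \<in> J - {j}. k < i}) * h j i)"
    unfolding cech_level_def sum_distrib_left h_def s_def
  proof (intro sum.cong refl)
    fix j i
    have "J - {j} - {i} = J - {i, j}" by auto
    then show "(- 1) ^ card {i \<in> J. i < j} * (g j ^ N * ((- 1) ^ card {k \<in> J - {j}. k < i} *
        (g i ^ N * m (J - {j} - {i})))) = (- 1) ^ (card {i \<in> J. i < j} + card {k \<in> J - {j}. k < i}) *
        (g j ^ N * g i ^ N * m (J - {i, j}))"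
      by (simp only: power_add ac_simps)
  qed
  also have "\<dots> = (\<Sum>j\<in>J. (\<Sum>i\<in>{i \<in> J. i < j}. (- 1) ^ (s j + s i) * h j i)
      + (\<Sum>i\<in>{i \<in> J. j < i}. - ((- 1) ^ (s j + s i) * h j i)))"
  proof (rule sum.cong[OF refl])
    fix j assume j: "j \<in> J"
    have split: "J - {j} = {i \<in> J. i < j} \<union> {i \<in> J. j < i}" by auto
    have "(\<Sum>i\<in>J - {j}. (- 1) ^ (s j + card {k \<in> J - {j}. k < i}) * h j i) =
        (\<Sum>i\<in>{i \<in> J. i < j}. (- 1) ^ (s j + card {k \<in> J - {j}. k < i}) * h j i)
        + (\<Sum>i\<in>{i \<in> J. j < i}. (- 1) ^ (s j + card {k \<in> J - {j}. k < i}) * h j i)"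
      unfolding split using assms by (subst sum.union_disjoint) auto
    moreover have "(\<Sum>i\<in>{i \<in> J. i < j}. (- 1) ^ (s j + card {k \<in> J - {j}. k < i}) * h j i)
        = (\<Sum>i\<in>{i \<in> J. i < j}. (- 1) ^ (s j + s i) * h j i)"
      by (intro sum.cong refl) (simp only: card_less[OF j] mem_Collect_eq, simp)
    moreover have "(\<Sum>i\<in>{i \<in> J. j < i}. (- 1) ^ (s j + card {k \<in> J - {j}. k < i}) * h j i)
        = (\<Sum>i\<in>{i \<in> J. j < i}. - ((- 1) ^ (s j + s i) * h j i))"
    proof (rule sum.cong[OF refl])
      fix i assume i: "i \<in> {i \<in> J. j < i}"
      then obtain r where "s i = Suc r" using s_pos[OF j, of i] by (cases "s i") auto
      then show "(- 1) ^ (s j + card {k \<in> J - {j}. k < i}) * h j i = - ((- 1) ^ (s j + s i) * h j i)"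
        using i by (simp only: card_less[OF j]) simp
    qed
    ultimately show "(\<Sum>i\<in>J - {j}. (- 1) ^ (s j + card {k \<in> J - {j}. k < i}) * h j i) =
      (\<Sum>i\<in>{i \<in> J. i < j}. (- 1) ^ (s j + s i) * h j i)
      + (\<Sum>i\<in>{i \<in> J. j < i}. - ((- 1) ^ (s j + s i) * h j i))" by simp
  qed
  also have "\<dots> = (\<Sum>j\<in>J. \<Sum>i\<in>{i \<in> J. i < j}. (- 1) ^ (s j + s i) * h j i)
      - (\<Sum>j\<in>J. \<Sum>i\<in>{i \<in> J. j < i}. (- 1) ^ (s j + s i) * h j i)"
    by (simp only: sum.distrib sum_negf) simp
  also have "(\<Sum>j\<in>J. \<Sum>i\<in>{i \<in> J. j < i}. (- 1) ^ (s j + s i) * h j i)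
      = (\<Sum>i\<in>J. \<Sum>j\<in>{j \<in> J. j < i}. (- 1) ^ (s j + s i) * h j i)"
    by (rule sum.swap_restrict) (use assms in auto)
  also have "\<dots> = (\<Sum>j\<in>J. \<Sum>i\<in>{i \<in> J. i < j}. (- 1) ^ (s j + s i) * h j i)"
    by (simp add: h_sym add.commute)
  finally show ?thesis by simp
qed

lemma finite_subsets_of_size [simp]: "finite (subsets_of_size n p)"
  by (rule finite_subset[of _ "Pow {..<n}"]) (auto simp: subsets_of_size_def)

lemma subsets_of_size_finite: "I \<in> subsets_of_size n p \<Longrightarrow> finite I"
  by (auto simp: subsets_of_size_def intro: finite_subset)

lemma subsets_of_size_remove:
  "J \<in> subsets_of_size n (Suc p) \<Longrightarrow> j \<in> J \<Longrightarrow> J - {j} \<in> subsets_of_size n p"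
  by (auto simp: subsets_of_size_def card_Diff_singleton finite_subset)

lemma subsets_of_size_1: "subsets_of_size n 1 = (\<lambda>i. {i}) ` {..<n}"
  by (auto simp: subsets_of_size_def card_1_singleton_iff One_nat_def)

lemma singleton_in_subsets_of_size [simp]: "{i} \<in> subsets_of_size n 1 \<longleftrightarrow> i < n"
  by (auto simp: subsets_of_size_def)

lemma pair_in_subsets_of_size: "i < j \<Longrightarrow> j < n \<Longrightarrow> {i, j} \<in> subsets_of_size n 2"
  by (auto simp: subsets_of_size_def)

section \<open>The zigzag between the Koszul complex and the Cech complex\<close>

text \<open>
  The first assumption says that the \<open>f\<^sub>k\<close> generate the unit ideal after inverting any \<open>g\<^sub>i\<close>. The others say
  that \<open>p, q\<close> is a regular sequence in the radical of the ideal generated by the \<open>g\<^sub>i\<close>, so that this ideal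
  has depth at least two.
\<close>
locale koszul_cech =
  fixes g f :: "nat \<Rightarrow> 'a::comm_ring_1" and n :: nat and p q :: 'a
  assumes prod_power_in_ideal:
    "\<exists>M. \<forall>I. I \<subseteq> {..<n} \<longrightarrow> I \<noteq> {} \<longrightarrow>
      (\<exists>a\<^sub>0 a\<^sub>1 a\<^sub>2. prod_power g M I = a\<^sub>0 * f 0 + a\<^sub>1 * f 1 + a\<^sub>2 * f 2)"
    and powers_in_ideal:
    "\<exists>K b c. p ^ K = (\<Sum>i<n. b i * g i ^ N) \<and> q ^ K = (\<Sum>i<n. c i * g i ^ N)"
    and regular_1: "p ^ K * x = 0 \<Longrightarrow> x = 0"
    and regular_2: "q ^ K * x = p ^ K * y \<Longrightarrow> p ^ K dvd x"
begin

text \<open>An element killed by all \<open>g\<^sub>i\<^sup>N\<close> is killed by a power of \<open>p\<close>.\<close>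
lemma cech_0_exact:
  assumes "\<And>i. i < n \<Longrightarrow> g i ^ N * x = 0"
  shows "x = 0"
proof -
  obtain K b c where "p ^ K = (\<Sum>i<n. b i * g i ^ N)"
    using powers_in_ideal by blast
  then have "p ^ K * x = (\<Sum>i<n. b i * (g i ^ N * x))"
    by (simp add: sum_distrib_right mult.assoc)
  then have "p ^ K * x = 0" using assms by simp
  then show ?thesis by (rule regular_1)
qed

text \<open>
  With \<open>t\<^sub>i = g\<^sub>i\<^sup>N\<close>, a cocycle satisfies \<open>t\<^sub>i m\<^sub>j = t\<^sub>j m\<^sub>i\<close>: the fractions \<open>m\<^sub>i / t\<^sub>i\<close> agree.
  Writing a power of \<open>p\<close>, and one of \<open>q\<close>, as a combination of the \<open>t\<^sub>i\<close> presents their common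
  value as a fraction with denominator a power of \<open>p\<close>, and also with denominator a power of
  \<open>q\<close>. As \<open>p, q\<close> is a regular sequence, the denominators cancel.
\<close>
lemma cech_1_exact:
  assumes cocycle: "\<And>J. J \<in> subsets_of_size n 2 \<Longrightarrow> cech_level g N m J = 0"
  shows "\<exists>x. \<forall>i<n. m {i} = g i ^ N * x"
proof -
  have less: "g i ^ N * m {j} = g j ^ N * m {i}" if "i < j" "j < n" for i j
    using cocycle[OF pair_in_subsets_of_size[OF that]] that by (simp add: cech_level_pair)
  have comm: "g i ^ N * m {j} = g j ^ N * m {i}" if "i < n" "j < n" for i j
    using less[of i j] less[of j i] that by (cases i j rule: linorder_cases) auto
  obtain K b c where b: "p ^ K = (\<Sum>i<n. b i * g i ^ N)" and c: "q ^ K = (\<Sum>i<n. c i * g i ^ N)"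
    using powers_in_ideal by blast
  define A where "A = (\<Sum>i<n. b i * m {i})"
  define C where "C = (\<Sum>i<n. c i * m {i})"
  have comb: "g j ^ N * (a * m {i}) = a * g i ^ N * m {j}" if "i < n" "j < n" for i j a
  proof -
    have "g j ^ N * (a * m {i}) = a * (g j ^ N * m {i})" by (rule mult.left_commute)
    then show ?thesis by (simp only: comm[OF that(2,1)] mult.assoc)
  qed
  have A: "g j ^ N * A = p ^ K * m {j}" if "j < n" for j
    unfolding A_def b sum_distrib_left sum_distrib_right
    by (rule sum.cong[OF refl]) (simp only: lessThan_iff comb[OF _ that])
  have C: "g j ^ N * C = q ^ K * m {j}" if "j < n" for j
    unfolding C_def c sum_distrib_left sum_distrib_right
    by (rule sum.cong[OF refl]) (simp only: lessThan_iff comb[OF _ that])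
  have "q ^ K * A - p ^ K * C = 0"
  proof (rule cech_0_exact)
    fix i assume i: "i < n"
    have "g i ^ N * (q ^ K * A - p ^ K * C) = q ^ K * (g i ^ N * A) - p ^ K * (g i ^ N * C)"
      by (simp add: algebra_simps)
    then show "g i ^ N * (q ^ K * A - p ^ K * C) = 0"
      by (simp only: A[OF i] C[OF i] mult.left_commute[of "p ^ K"]) simp
  qed
  then have "p ^ K dvd A" using regular_2 by auto
  then obtain x where x: "A = p ^ K * x" by (elim dvdE)
  have "m {i} = g i ^ N * x" if "i < n" for i
  proof -
    have "p ^ K * (m {i} - g i ^ N * x) = 0"
      using A[OF that] x by (simp add: algebra_simps)
    then show ?thesis using regular_1 by fastforce
  qed
  then show ?thesis by blast
qed

definition exponent :: nat
  where "exponent = (SOME M. \<forall>I. I \<subseteq> {..<n} \<longrightarrow> I \<noteq> {} \<longrightarrow>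
    (\<exists>a\<^sub>0 a\<^sub>1 a\<^sub>2. prod_power g M I = a\<^sub>0 * f 0 + a\<^sub>1 * f 1 + a\<^sub>2 * f 2))"

lemma prod_power_exponent:
  assumes "I \<in> subsets_of_size n k" "0 < k"
  shows "\<exists>a\<^sub>0 a\<^sub>1 a\<^sub>2. prod_power g exponent I = a\<^sub>0 * f 0 + a\<^sub>1 * f 1 + a\<^sub>2 * f 2"
proof -
  have "I \<subseteq> {..<n}" "I \<noteq> {}" using assms by (auto simp: subsets_of_size_def)
  then show ?thesis using someI_ex[OF prod_power_in_ideal] unfolding exponent_def by blast
qed

text \<open>
  If \<open>s = a\<^sub>0 f\<^sub>0 + a\<^sub>1 f\<^sub>1 + a\<^sub>2 f\<^sub>2\<close>, then exterior multiplication by \<open>(a\<^sub>0, a\<^sub>1, a\<^sub>2)\<close> is, up to sign, a homotopy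
  between zero and multiplication by \<open>s\<close> on the Koszul complex. With \<open>s\<close> a power of \<open>g\<^sub>I\<close>, this gives
  exactness in each of the three positions after inverting \<open>g\<^sub>I\<close>.
\<close>
lemma koszul_exact_1:
  assumes "I \<in> subsets_of_size n k" "0 < k" "f 0 * x\<^sub>0 + f 1 * x\<^sub>1 + f 2 * x\<^sub>2 = 0"
  shows "\<exists>y\<^sub>0 y\<^sub>1 y\<^sub>2. prod_power g exponent I * x\<^sub>0 = f 1 * y\<^sub>2 + f 2 * y\<^sub>1 \<and>
    prod_power g exponent I * x\<^sub>1 = - (f 0 * y\<^sub>2) + f 2 * y\<^sub>0 \<and>
    prod_power g exponent I * x\<^sub>2 = - (f 0 * y\<^sub>1) - f 1 * y\<^sub>0"
proof -
  obtain a\<^sub>0 a\<^sub>1 a\<^sub>2 where a: "prod_power g exponent I = a\<^sub>0 * f 0 + a\<^sub>1 * f 1 + a\<^sub>2 * f 2"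
    using prod_power_exponent[OF assms(1,2)] by blast
  let ?E = "f 0 * x\<^sub>0 + f 1 * x\<^sub>1 + f 2 * x\<^sub>2"
  let ?y\<^sub>0 = "a\<^sub>2 * x\<^sub>1 - a\<^sub>1 * x\<^sub>2" and ?y\<^sub>1 = "a\<^sub>2 * x\<^sub>0 - a\<^sub>0 * x\<^sub>2" and ?y\<^sub>2 = "a\<^sub>1 * x\<^sub>0 - a\<^sub>0 * x\<^sub>1"
  have "prod_power g exponent I * x\<^sub>0 = f 1 * ?y\<^sub>2 + f 2 * ?y\<^sub>1 + a\<^sub>0 * ?E"
    "prod_power g exponent I * x\<^sub>1 = - (f 0 * ?y\<^sub>2) + f 2 * ?y\<^sub>0 + a\<^sub>1 * ?E"
    "prod_power g exponent I * x\<^sub>2 = - (f 0 * ?y\<^sub>1) - f 1 * ?y\<^sub>0 + a\<^sub>2 * ?E"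
    unfolding a by (simp_all add: algebra_simps)
  then show ?thesis unfolding assms(3) by auto
qed

lemma koszul_exact_2:
  assumes "I \<in> subsets_of_size n k" "0 < k" "f 1 * y\<^sub>2 + f 2 * y\<^sub>1 = 0" "- (f 0 * y\<^sub>2) + f 2 * y\<^sub>0 = 0"
    "- (f 0 * y\<^sub>1) - f 1 * y\<^sub>0 = 0"
  shows "\<exists>w. prod_power g exponent I * y\<^sub>0 = - (f 0 * w) \<and> prod_power g exponent I * y\<^sub>1 = f 1 * w \<and>
    prod_power g exponent I * y\<^sub>2 = - (f 2 * w)"
proof -
  obtain a\<^sub>0 a\<^sub>1 a\<^sub>2 where a: "prod_power g exponent I = a\<^sub>0 * f 0 + a\<^sub>1 * f 1 + a\<^sub>2 * f 2"
    using prod_power_exponent[OF assms(1,2)] by blast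
  let ?w = "- (a\<^sub>0 * y\<^sub>0) + a\<^sub>1 * y\<^sub>1 - a\<^sub>2 * y\<^sub>2"
  let ?E\<^sub>0 = "f 1 * y\<^sub>2 + f 2 * y\<^sub>1" and ?E\<^sub>1 = "- (f 0 * y\<^sub>2) + f 2 * y\<^sub>0" and ?E\<^sub>2 = "- (f 0 * y\<^sub>1) - f 1 * y\<^sub>0"
  have "prod_power g exponent I * y\<^sub>0 = - (f 0 * ?w) - a\<^sub>1 * ?E\<^sub>2 + a\<^sub>2 * ?E\<^sub>1"
    "prod_power g exponent I * y\<^sub>1 = f 1 * ?w - a\<^sub>0 * ?E\<^sub>2 + a\<^sub>2 * ?E\<^sub>0"
    "prod_power g exponent I * y\<^sub>2 = - (f 2 * ?w) - a\<^sub>0 * ?E\<^sub>1 + a\<^sub>1 * ?E\<^sub>0"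
    unfolding a by (simp_all add: algebra_simps)
  then show ?thesis unfolding assms(3-5) by auto
qed

lemma koszul_exact_3:
  assumes "I \<in> subsets_of_size n k" "0 < k" "f 0 * z = 0" "f 1 * z = 0" "f 2 * z = 0"
  shows "prod_power g exponent I * z = 0"
proof -
  obtain a\<^sub>0 a\<^sub>1 a\<^sub>2 where a: "prod_power g exponent I = a\<^sub>0 * f 0 + a\<^sub>1 * f 1 + a\<^sub>2 * f 2"
    using prod_power_exponent[OF assms(1,2)] by blast
  have "prod_power g exponent I * z = a\<^sub>0 * (f 0 * z) + a\<^sub>1 * (f 1 * z) + a\<^sub>2 * (f 2 * z)"
    unfolding a by (simp add: algebra_simps)
  then show ?thesis using assms(3-) by simp
qed

text \<open>
  At level \<open>N\<close>: \<open>x \<in> K\<^sub>1\<close>, \<open>y \<in> C\<^sup>1(K\<^sub>2)\<close> and \<open>z \<in> C\<^sup>2(K\<^sub>3)\<close> with \<open>d x = \<delta> y\<close> and \<open>d y = \<delta> z\<close>. Here \<open>y k\<close> is the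
  coefficient at the basis element of \<open>K\<^sub>2\<close> that omits the index \<open>k\<close>.
\<close>
definition zigzag :: "nat \<Rightarrow> (nat \<Rightarrow> 'a) \<Rightarrow> (nat \<Rightarrow> nat set \<Rightarrow> 'a) \<Rightarrow> (nat set \<Rightarrow> 'a) \<Rightarrow> bool"
  where "zigzag N x y z \<longleftrightarrow>
    (\<forall>i<n. g i ^ N * x 0 = f 1 * y 2 {i} + f 2 * y 1 {i} \<and>
       g i ^ N * x 1 = - (f 0 * y 2 {i}) + f 2 * y 0 {i} \<and>
       g i ^ N * x 2 = - (f 0 * y 1 {i}) - f 1 * y 0 {i}) \<and>
    (\<forall>J\<in>subsets_of_size n 2. cech_level g N (y 0) J = - (f 0 * z J) \<and>
       cech_level g N (y 1) J = f 1 * z J \<and> cech_level g N (y 2) J = - (f 2 * z J))"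

lemma zigzagD:
  assumes "zigzag N x y z"
  shows "i < n \<Longrightarrow> g i ^ N * x 0 = f 1 * y 2 {i} + f 2 * y 1 {i}"
    "i < n \<Longrightarrow> g i ^ N * x 1 = - (f 0 * y 2 {i}) + f 2 * y 0 {i}"
    "i < n \<Longrightarrow> g i ^ N * x 2 = - (f 0 * y 1 {i}) - f 1 * y 0 {i}"
    "J \<in> subsets_of_size n 2 \<Longrightarrow> cech_level g N (y 0) J = - (f 0 * z J)"
    "J \<in> subsets_of_size n 2 \<Longrightarrow> cech_level g N (y 1) J = f 1 * z J"
    "J \<in> subsets_of_size n 2 \<Longrightarrow> cech_level g N (y 2) J = - (f 2 * z J)"
  using assms by (auto simp: zigzag_def)

lemma zigzag_add:
  assumes "zigzag N x y z" "zigzag N x' y' z'"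
  shows "zigzag N (\<lambda>k. x k + x' k) (\<lambda>k I. y k I + y' k I) (\<lambda>J. z J + z' J)"
  unfolding zigzag_def
  by (intro conjI allI impI ballI;
      simp only: distrib_left cech_level_add zigzagD[OF assms(1)] zigzagD[OF assms(2)];
      simp add: algebra_simps)

lemma zigzag_scale:
  assumes "zigzag N x y z"
  shows "zigzag N (\<lambda>k. r * x k) (\<lambda>k I. r * y k I) (\<lambda>J. r * z J)"
proof -
  have e: "g i ^ N * (r * a) = r * (g i ^ N * a)" for i a
    by (rule mult.left_commute)
  show ?thesis
    unfolding zigzag_def
    by (intro conjI allI impI ballI; simp only: e cech_level_scale zigzagD[OF assms];
        simp add: algebra_simps)
qed

lemma zigzag_diff:
  assumes "zigzag N x y z" "zigzag N x' y' z'"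
  shows "zigzag N (\<lambda>k. x k - x' k) (\<lambda>k I. y k I - y' k I) (\<lambda>J. z J - z' J)"
  using zigzag_add[OF assms(1) zigzag_scale[OF assms(2), of "- 1"]] by simp

lemma zigzag_raise:
  assumes "zigzag N x y z"
  shows "zigzag (N + M) x (\<lambda>k I. prod_power g M I * y k I) (\<lambda>J. prod_power g M J * z J)"
proof -
  have e: "g i ^ (N + M) * a = g i ^ M * (g i ^ N * a)" for i a
    by (simp add: power_add algebra_simps)
  show ?thesis
    unfolding zigzag_def
    by (intro conjI allI impI ballI;
        simp only: e cech_level_raise subsets_of_size_finite prod_power_singleton zigzagD[OF assms];
        simp add: algebra_simps)
qed

text \<open>\<open>d \<delta> x = \<delta> \<delta> y = 0\<close>, and \<open>d\<close> is injective on \<open>R\<close>.\<close>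
lemma zigzag_cycle:
  assumes "zigzag N x y z"
  shows "f 0 * x 0 + f 1 * x 1 + f 2 * x 2 = 0"
proof (rule cech_0_exact)
  fix i assume i: "i < n"
  have "g i ^ N * (f 0 * x 0 + f 1 * x 1 + f 2 * x 2) =
      f 0 * (g i ^ N * x 0) + f 1 * (g i ^ N * x 1) + f 2 * (g i ^ N * x 2)"
    by (simp add: algebra_simps)
  also have "\<dots> = 0"
    by (simp only: zigzagD(1-3)[OF assms i]) (simp add: algebra_simps)
  finally show "g i ^ N * (f 0 * x 0 + f 1 * x 1 + f 2 * x 2) = 0" .
qed

text \<open>\<open>\<delta> d z = d d y = 0\<close>, and \<open>\<delta>\<close> is injective on cochains with values in \<open>K\<^sub>3\<close>.\<close>
lemma zigzag_cocycle:
  assumes "zigzag N x y z" "J \<in> subsets_of_size n 3"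
  shows "prod_power g exponent J * cech_level g N z J = 0"
proof (rule koszul_exact_3)
  show "J \<in> subsets_of_size n 3" "0 < (3::nat)" using assms(2) by simp_all
  have D: "cech_level g N (cech_level g N (y k)) J = 0" for k
    using assms(2) by (intro cech_level_cech_level subsets_of_size_finite)
  have sub: "J - {j} \<in> subsets_of_size n 2" if "j \<in> J" for j
    using assms(2) subsets_of_size_remove[of J n 2, OF _ that] by simp
  have "cech_level g N (cech_level g N (y 0)) J = cech_level g N (\<lambda>J. (- f 0) * z J) J"
    by (rule cech_level_cong) (use assms(1) sub in \<open>simp add: zigzag_def\<close>)
  then show "f 0 * cech_level g N z J = 0" unfolding D cech_level_scale by simp
  have "cech_level g N (cech_level g N (y 1)) J = cech_level g N (\<lambda>J. f 1 * z J) J"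
    by (rule cech_level_cong) (use assms(1) sub in \<open>simp add: zigzag_def\<close>)
  then show "f 1 * cech_level g N z J = 0" unfolding D cech_level_scale by simp
  have "cech_level g N (cech_level g N (y 2)) J = cech_level g N (\<lambda>J. (- f 2) * z J) J"
    by (rule cech_level_cong) (use assms(1) sub in \<open>simp add: zigzag_def\<close>)
  then show "f 2 * cech_level g N z J = 0" unfolding D cech_level_scale by simp
qed

text \<open>
  Exactness gives first \<open>y\<close> with \<open>d x = \<delta> y\<close>, then \<open>z\<close> with \<open>d y = \<delta> z\<close> because \<open>\<delta> d y = d d x = 0\<close>. Each of the
  two steps raises the level by \<open>exponent\<close>.
\<close>
lemma zigzag_total:
  assumes "f 0 * x 0 + f 1 * x 1 + f 2 * x 2 = 0"
  shows "\<exists>N y z. zigzag N x y z"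
proof -
  let ?M = exponent
  have "\<forall>I\<in>subsets_of_size n 1. \<exists>v. prod_power g ?M I * x 0 = f 1 * v 2 + f 2 * v 1 \<and>
      prod_power g ?M I * x 1 = - (f 0 * v 2) + f 2 * v 0 \<and>
      prod_power g ?M I * x 2 = - (f 0 * v 1) - f 1 * v (0::nat)"
  proof
    fix I assume "I \<in> subsets_of_size n 1"
    then obtain y\<^sub>0 y\<^sub>1 y\<^sub>2 where "prod_power g ?M I * x 0 = f 1 * y\<^sub>2 + f 2 * y\<^sub>1"
      "prod_power g ?M I * x 1 = - (f 0 * y\<^sub>2) + f 2 * y\<^sub>0" "prod_power g ?M I * x 2 = - (f 0 * y\<^sub>1) - f 1 * y\<^sub>0"
      using koszul_exact_1[OF _ _ assms, of I 1] by auto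
    then show "\<exists>v. prod_power g ?M I * x 0 = f 1 * v 2 + f 2 * v 1 \<and>
      prod_power g ?M I * x 1 = - (f 0 * v 2) + f 2 * v 0 \<and>
      prod_power g ?M I * x 2 = - (f 0 * v 1) - f 1 * v (0::nat)"
      by (intro exI[of _ "(\<lambda>_. y\<^sub>2)(0 := y\<^sub>0, 1 := y\<^sub>1)"]) simp
  qed
  from bchoice[OF this] obtain v where v: "\<And>I. I \<in> subsets_of_size n 1 \<Longrightarrow>
      prod_power g ?M I * x 0 = f 1 * v I 2 + f 2 * v I 1 \<and>
      prod_power g ?M I * x 1 = - (f 0 * v I 2) + f 2 * v I 0 \<and>
      prod_power g ?M I * x 2 = - (f 0 * v I 1) - f 1 * v I (0::nat)"
    by blast
  define y where "y k I = v I k" for k I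
  have "\<forall>J\<in>subsets_of_size n 2. \<exists>w. prod_power g ?M J * cech_level g ?M (y 0) J = - (f 0 * w) \<and>
      prod_power g ?M J * cech_level g ?M (y 1) J = f 1 * w \<and>
      prod_power g ?M J * cech_level g ?M (y 2) J = - (f 2 * w)"
  proof
    fix J assume J: "J \<in> subsets_of_size n 2"
    then have J': "J \<in> subsets_of_size n (Suc 1)" by (simp add: numeral_2_eq_2 One_nat_def)
    have sub: "J - {j} \<in> subsets_of_size n 1" if "j \<in> J" for j
      using subsets_of_size_remove[OF J' that] .
    have D: "cech_level g ?M (\<lambda>I. prod_power g ?M I * a) J = 0" for a
    proof -
      have "cech_level g ?M (\<lambda>I. prod_power g ?M I * a) J = cech_level g ?M (cech_level g ?M (\<lambda>_. a)) J"
        by (rule cech_level_cong) (use sub in \<open>force simp: subsets_of_size_1\<close>)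
      then show ?thesis using cech_level_cech_level[OF subsets_of_size_finite[OF J]] by simp
    qed
    show "\<exists>w. prod_power g ?M J * cech_level g ?M (y 0) J = - (f 0 * w) \<and>
      prod_power g ?M J * cech_level g ?M (y 1) J = f 1 * w \<and>
      prod_power g ?M J * cech_level g ?M (y 2) J = - (f 2 * w)"
    proof (rule koszul_exact_2[OF J zero_less_numeral])
      show "f 1 * cech_level g ?M (y 2) J + f 2 * cech_level g ?M (y 1) J = 0"
        unfolding cech_level_scale[symmetric] cech_level_add[symmetric]
        by (subst D[of "x 0", symmetric], rule cech_level_cong) (use v[OF sub] in \<open>simp add: y_def\<close>)
      show "- (f 0 * cech_level g ?M (y 2) J) + f 2 * cech_level g ?M (y 0) J = 0"
        unfolding mult_minus_left[symmetric] unfolding cech_level_scale[symmetric] cech_level_add[symmetric]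
        by (subst D[of "x 1", symmetric], rule cech_level_cong) (use v[OF sub] in \<open>simp add: y_def\<close>)
      show "- (f 0 * cech_level g ?M (y 1) J) - f 1 * cech_level g ?M (y 0) J = 0"
        unfolding mult_minus_left[symmetric] unfolding cech_level_scale[symmetric] cech_level_diff[symmetric]
        by (subst D[of "x 2", symmetric], rule cech_level_cong) (use v[OF sub] in \<open>simp add: y_def\<close>)
    qed
  qed
  from bchoice[OF this] obtain z where z: "\<And>J. J \<in> subsets_of_size n 2 \<Longrightarrow>
      prod_power g ?M J * cech_level g ?M (y 0) J = - (f 0 * z J) \<and>
      prod_power g ?M J * cech_level g ?M (y 1) J = f 1 * z J \<and>
      prod_power g ?M J * cech_level g ?M (y 2) J = - (f 2 * z J)"
    by blast
  have "zigzag (?M + ?M) x (\<lambda>k I. prod_power g ?M I * y k I) z"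
    unfolding zigzag_def
  proof (intro conjI allI impI ballI)
    fix i assume "i < n"
    then have i: "{i} \<in> subsets_of_size n 1" by simp
    have vi: "g i ^ ?M * x 0 = f 1 * y 2 {i} + f 2 * y 1 {i}"
      "g i ^ ?M * x 1 = - (f 0 * y 2 {i}) + f 2 * y 0 {i}"
      "g i ^ ?M * x 2 = - (f 0 * y 1 {i}) - f 1 * y 0 {i}"
      using v[OF i] unfolding y_def prod_power_singleton by blast+
    have e: "g i ^ (?M + ?M) * a = g i ^ ?M * (g i ^ ?M * a)" for a
      by (simp add: power_add mult.assoc)
    show "g i ^ (?M + ?M) * x 0 = f 1 * (prod_power g ?M {i} * y 2 {i}) + f 2 * (prod_power g ?M {i} * y 1 {i})"
      "g i ^ (?M + ?M) * x 1 = - (f 0 * (prod_power g ?M {i} * y 2 {i})) + f 2 * (prod_power g ?M {i} * y 0 {i})"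
      "g i ^ (?M + ?M) * x 2 = - (f 0 * (prod_power g ?M {i} * y 1 {i})) - f 1 * (prod_power g ?M {i} * y 0 {i})"
      unfolding e vi by (simp_all add: algebra_simps)
  qed (use z in \<open>simp_all add: cech_level_raise subsets_of_size_finite\<close>)
  then show ?thesis by blast
qed

text \<open>
  The components of \<open>\<delta> y\<close> are Cech cocycles of degree one, since \<open>d \<delta> y = \<delta> \<delta> z = 0\<close>, and hence come from
  elements of \<open>R\<close>.
\<close>
lemma zigzag_surjective:
  assumes y0: "\<And>J. J \<in> subsets_of_size n 2 \<Longrightarrow> cech_level g N y\<^sub>0 J = - (f 0 * z J)"
    and y1: "\<And>J. J \<in> subsets_of_size n 2 \<Longrightarrow> cech_level g N y\<^sub>1 J = f 1 * z J"
    and y2: "\<And>J. J \<in> subsets_of_size n 2 \<Longrightarrow> cech_level g N y\<^sub>2 J = - (f 2 * z J)"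
  shows "\<exists>x y. zigzag N x y z"
proof -
  have "\<exists>x. \<forall>i<n. (\<lambda>I. f 1 * y\<^sub>2 I + f 2 * y\<^sub>1 I) {i} = g i ^ N * x"
    by (rule cech_1_exact) (simp add: cech_level_add cech_level_scale y1 y2)
  then obtain x\<^sub>0 where x0: "\<forall>i<n. f 1 * y\<^sub>2 {i} + f 2 * y\<^sub>1 {i} = g i ^ N * x\<^sub>0" by auto
  have "\<exists>x. \<forall>i<n. (\<lambda>I. (- f 0) * y\<^sub>2 I + f 2 * y\<^sub>0 I) {i} = g i ^ N * x"
    by (rule cech_1_exact) (simp only: cech_level_add cech_level_scale y0 y2, simp add: algebra_simps)
  then obtain x\<^sub>1 where x1: "\<forall>i<n. - (f 0 * y\<^sub>2 {i}) + f 2 * y\<^sub>0 {i} = g i ^ N * x\<^sub>1" by auto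
  have "\<exists>x. \<forall>i<n. (\<lambda>I. (- f 0) * y\<^sub>1 I - f 1 * y\<^sub>0 I) {i} = g i ^ N * x"
    by (rule cech_1_exact) (simp only: cech_level_diff cech_level_scale y0 y1, simp add: algebra_simps)
  then obtain x\<^sub>2 where x2: "\<forall>i<n. - (f 0 * y\<^sub>1 {i}) - f 1 * y\<^sub>0 {i} = g i ^ N * x\<^sub>2" by auto
  have "zigzag N ((\<lambda>_. x\<^sub>2)(0 := x\<^sub>0, 1 := x\<^sub>1)) ((\<lambda>_. y\<^sub>2)(0 := y\<^sub>0, 1 := y\<^sub>1)) z"
    unfolding zigzag_def using x0 x1 x2 y0 y1 y2 by simp
  then show ?thesis by blast
qed

text \<open>
  If \<open>x = \<delta> v\<close>, then \<open>\<delta> (y - d v) = 0\<close>, so \<open>y - d v = \<delta> w\<close> at a higher level; then \<open>\<delta> (z - d w) = 0\<close> and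
  \<open>z = d w\<close> after raising the level once more.
\<close>
lemma zigzag_of_boundary:
  assumes zz: "zigzag N x y z"
    and x: "x 0 = f 1 * v 2 + f 2 * v 1" "x 1 = - (f 0 * v 2) + f 2 * v 0"
      "x 2 = - (f 0 * v 1) - f 1 * v (0::nat)"
  shows "\<exists>M w. \<forall>J\<in>subsets_of_size n 2. prod_power g M J * z J = cech_level g (N + M) w J"
proof -
  let ?M = exponent
  define u where "u k I = y k I - prod_power g N I * v k" for k I
  have "\<forall>I\<in>subsets_of_size n 1. \<exists>w. prod_power g ?M I * u 0 I = - (f 0 * w) \<and>
      prod_power g ?M I * u 1 I = f 1 * w \<and> prod_power g ?M I * u 2 I = - (f 2 * w)"
  proof
    fix I assume I: "I \<in> subsets_of_size n 1"
    then obtain i where i: "I = {i}" "i < n" by (auto simp: subsets_of_size_1)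
    have z: "g i ^ N * x 0 = f 1 * y 2 {i} + f 2 * y 1 {i}"
      "g i ^ N * x 1 = - (f 0 * y 2 {i}) + f 2 * y 0 {i}"
      "g i ^ N * x 2 = - (f 0 * y 1 {i}) - f 1 * y 0 {i}"
      using zz i by (auto simp: zigzag_def)
    show "\<exists>w. prod_power g ?M I * u 0 I = - (f 0 * w) \<and>
      prod_power g ?M I * u 1 I = f 1 * w \<and> prod_power g ?M I * u 2 I = - (f 2 * w)"
    proof (rule koszul_exact_2)
      show "I \<in> subsets_of_size n 1" "0 < (1::nat)" using I by simp_all
      show "f 1 * u 2 I + f 2 * u 1 I = 0" "- (f 0 * u 2 I) + f 2 * u 0 I = 0"
        "- (f 0 * u 1 I) - f 1 * u 0 I = 0"
        using z unfolding x i u_def by (simp_all add: algebra_simps)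
    qed
  qed
  from bchoice[OF this] obtain w where w: "\<And>I. I \<in> subsets_of_size n 1 \<Longrightarrow>
      prod_power g ?M I * u 0 I = - (f 0 * w I) \<and>
      prod_power g ?M I * u 1 I = f 1 * w I \<and> prod_power g ?M I * u 2 I = - (f 2 * w I)" by blast
  have "prod_power g (?M + ?M) J * z J = cech_level g (N + (?M + ?M)) (\<lambda>I. prod_power g ?M I * w I) J"
    if J: "J \<in> subsets_of_size n 2" for J
  proof -
    have J': "J \<in> subsets_of_size n (Suc 1)" using J by (simp add: numeral_2_eq_2 One_nat_def)
    have sub: "J - {j} \<in> subsets_of_size n 1" if "j \<in> J" for j
      using subsets_of_size_remove[OF J' that] .
    note fin = subsets_of_size_finite[OF J]
    have const: "cech_level g N (\<lambda>I. prod_power g N I * a) J = 0" for a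
    proof -
      have "cech_level g N (\<lambda>I. prod_power g N I * a) J = cech_level g N (cech_level g N (\<lambda>_. a)) J"
        by (rule cech_level_cong) (use sub in \<open>force simp: subsets_of_size_1\<close>)
      then show ?thesis using cech_level_cech_level[OF fin] by simp
    qed
    have u: "cech_level g N (u k) J = cech_level g N (y k) J" for k
      unfolding u_def cech_level_diff const by simp
    have raise: "prod_power g ?M J * cech_level g N (y k) J = cech_level g (N + ?M) (\<lambda>I. prod_power g ?M I * u k I) J" for k
      by (simp add: cech_level_raise[OF fin] u)
    let ?W = "cech_level g (N + ?M) w J"
    have 0: "prod_power g ?M J * cech_level g N (y 0) J = - f 0 * ?W"
      unfolding raise unfolding cech_level_scale[symmetric] by (rule cech_level_cong) (use w[OF sub] in simp)
    have 1: "prod_power g ?M J * cech_level g N (y 1) J = f 1 * ?W"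
      unfolding raise unfolding cech_level_scale[symmetric] by (rule cech_level_cong) (use w[OF sub] in simp)
    have 2: "prod_power g ?M J * cech_level g N (y 2) J = - f 2 * ?W"
      unfolding raise unfolding cech_level_scale[symmetric] by (rule cech_level_cong) (use w[OF sub] in simp)
    have "prod_power g ?M J * (prod_power g ?M J * z J - ?W) = 0"
    proof (rule koszul_exact_3[OF J zero_less_numeral])
      have y: "cech_level g N (y 0) J = - (f 0 * z J)" "cech_level g N (y 1) J = f 1 * z J"
        "cech_level g N (y 2) J = - (f 2 * z J)"
        using zz J by (auto simp: zigzag_def)
      show "f 0 * (prod_power g ?M J * z J - ?W) = 0" using 0 unfolding y by (simp add: algebra_simps)
      show "f 1 * (prod_power g ?M J * z J - ?W) = 0" using 1 unfolding y by (simp add: algebra_simps)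
      show "f 2 * (prod_power g ?M J * z J - ?W) = 0" using 2 unfolding y by (simp add: algebra_simps)
    qed
    then have "prod_power g (?M + ?M) J * z J = prod_power g ?M J * ?W"
      by (simp add: prod_power_add algebra_simps)
    then show ?thesis by (simp add: cech_level_raise[OF fin] add.assoc[symmetric])
  qed
  then show ?thesis by blast
qed

text \<open>
  If \<open>z = d w\<close>, then the components of \<open>y - \<delta> w\<close> are Cech cocycles of degree one, so \<open>y - \<delta> w = d v\<close> with
  \<open>v \<in> K\<^sub>2\<close>. Then \<open>d x = \<delta> y = d \<delta> v\<close>, and \<open>d\<close> is injective on \<open>R\<close>.
\<close>
lemma zigzag_to_boundary:
  assumes zz: "zigzag N x y z"
    and z: "\<And>J. J \<in> subsets_of_size n 2 \<Longrightarrow> z J = cech_level g N w J"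
  shows "\<exists>v. x 0 = f 1 * v 2 + f 2 * v 1 \<and> x 1 = - (f 0 * v 2) + f 2 * v 0 \<and>
      x 2 = - (f 0 * v 1) - f 1 * v (0::nat)"
proof -
  have y: "cech_level g N (y 0) J = - (f 0 * z J)" "cech_level g N (y 1) J = f 1 * z J"
    "cech_level g N (y 2) J = - (f 2 * z J)" if "J \<in> subsets_of_size n 2" for J
    using zz that by (auto simp: zigzag_def)
  have "\<exists>v. \<forall>i<n. (\<lambda>I. y 0 I + f 0 * w I) {i} = g i ^ N * v"
    by (rule cech_1_exact) (simp add: cech_level_add cech_level_scale y z)
  then obtain v\<^sub>0 where v0: "\<And>i. i < n \<Longrightarrow> g i ^ N * v\<^sub>0 = y 0 {i} + f 0 * w {i}" by auto
  have "\<exists>v. \<forall>i<n. (\<lambda>I. y 1 I - f 1 * w I) {i} = g i ^ N * v"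
    by (rule cech_1_exact) (simp add: cech_level_diff cech_level_scale y z)
  then obtain v\<^sub>1 where v1: "\<And>i. i < n \<Longrightarrow> g i ^ N * v\<^sub>1 = y 1 {i} - f 1 * w {i}" by auto
  have "\<exists>v. \<forall>i<n. (\<lambda>I. y 2 I + f 2 * w I) {i} = g i ^ N * v"
    by (rule cech_1_exact) (simp add: cech_level_add cech_level_scale y z)
  then obtain v\<^sub>2 where v2: "\<And>i. i < n \<Longrightarrow> g i ^ N * v\<^sub>2 = y 2 {i} + f 2 * w {i}" by auto
  have "x 0 - (f 1 * v\<^sub>2 + f 2 * v\<^sub>1) = 0" "x 1 - (- (f 0 * v\<^sub>2) + f 2 * v\<^sub>0) = 0"
    "x 2 - (- (f 0 * v\<^sub>1) - f 1 * v\<^sub>0) = 0"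
  proof -
    have zi: "g i ^ N * x 0 = f 1 * y 2 {i} + f 2 * y 1 {i}"
      "g i ^ N * x 1 = - (f 0 * y 2 {i}) + f 2 * y 0 {i}"
      "g i ^ N * x 2 = - (f 0 * y 1 {i}) - f 1 * y 0 {i}" if "i < n" for i
      using zz that by (auto simp: zigzag_def)
    have e: "g i ^ N * (a - (b * c + b' * c')) = g i ^ N * a - (b * (g i ^ N * c) + b' * (g i ^ N * c'))"
      for i a b b' c c'
      by (simp add: algebra_simps)
    have "x 0 - (f 1 * v\<^sub>2 + f 2 * v\<^sub>1) = 0"
      by (rule cech_0_exact[of N]) (simp only: e zi(1) v1 v2, simp add: algebra_simps)
    moreover have "x 1 - ((- f 0) * v\<^sub>2 + f 2 * v\<^sub>0) = 0"
      by (rule cech_0_exact[of N]) (simp only: e zi(2) v0 v2, simp add: algebra_simps)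
    moreover have "x 2 - ((- f 0) * v\<^sub>1 + (- f 1) * v\<^sub>0) = 0"
      by (rule cech_0_exact[of N]) (simp only: e zi(3) v0 v1, simp add: algebra_simps)
    ultimately show "x 0 - (f 1 * v\<^sub>2 + f 2 * v\<^sub>1) = 0" "x 1 - (- (f 0 * v\<^sub>2) + f 2 * v\<^sub>0) = 0"
      "x 2 - (- (f 0 * v\<^sub>1) - f 1 * v\<^sub>0) = 0" by simp_all
  qed
  then show ?thesis
    by (intro exI[of _ "(\<lambda>_. v\<^sub>2)(0 := v\<^sub>0, 1 := v\<^sub>1)"]) simp
qed

end

section \<open>Kernels, quotients and isomorphisms of bigraded modules\<close>

lemma module_cong:
  fixes M N :: "('a, 'b, 'm) module_scheme"
  assumes "module R M" "carrier N = carrier M" "\<zero>\<^bsub>N\<^esub> = \<zero>\<^bsub>M\<^esub>" "add N = add M" "smult N = smult M"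
  shows "module R N"
proof -
  have "add_monoid N = add_monoid M" using assms(2-4) by simp
  then show ?thesis
    using assms(1) unfolding module_def abelian_group_def abelian_monoid_def abelian_group_axioms_def
      module_axioms_def by (simp add: assms(2-5))
qed

lemma module_dsum:
  assumes "cring R" "\<And>i. i \<in> I \<Longrightarrow> module R (M i)"
  shows "module R (dsum I M)"
proof -
  have M: "abelian_group (M i)" if "i \<in> I" for i
    using assms(2)[OF that] by (simp add: module_def)
  note cl = abelian_monoid.a_closed[OF abelian_group.axioms(1)[OF M]]
    abelian_monoid.zero_closed[OF abelian_group.axioms(1)[OF M]] module.smult_closed[OF assms(2)]
  show ?thesis
  proof (rule moduleI)
    show "cring R" by fact
    show "abelian_group (dsum I M)"
    proof (rule abelian_groupI)
      fix x y z assume "x \<in> carrier (dsum I M)" "y \<in> carrier (dsum I M)" "z \<in> carrier (dsum I M)"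
      then show "x \<oplus>\<^bsub>dsum I M\<^esub> y \<oplus>\<^bsub>dsum I M\<^esub> z = x \<oplus>\<^bsub>dsum I M\<^esub> (y \<oplus>\<^bsub>dsum I M\<^esub> z)"
        using abelian_monoid.a_assoc[OF abelian_group.axioms(1)[OF M]]
        by (auto simp: dsum_def cl PiE_iff intro!: restrict_ext)
    next
      fix x y assume "x \<in> carrier (dsum I M)" "y \<in> carrier (dsum I M)"
      then show "x \<oplus>\<^bsub>dsum I M\<^esub> y = y \<oplus>\<^bsub>dsum I M\<^esub> x"
        using abelian_monoid.a_comm[OF abelian_group.axioms(1)[OF M]]
        by (auto simp: dsum_def PiE_iff intro!: restrict_ext)
    next
      fix x assume x: "x \<in> carrier (dsum I M)"
      then show "\<zero>\<^bsub>dsum I M\<^esub> \<oplus>\<^bsub>dsum I M\<^esub> x = x"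
        using abelian_monoid.l_zero[OF abelian_group.axioms(1)[OF M]]
        by (auto simp: dsum_def PiE_iff extensional_def fun_eq_iff)
      show "\<exists>y\<in>carrier (dsum I M). y \<oplus>\<^bsub>dsum I M\<^esub> x = \<zero>\<^bsub>dsum I M\<^esub>"
        using x abelian_group.l_neg[OF M] abelian_group.a_inv_closed[OF M]
        by (intro bexI[of _ "\<lambda>i\<in>I. \<ominus>\<^bsub>M i\<^esub> x i"])
          (auto simp: dsum_def PiE_iff intro!: restrict_ext)
    qed (auto simp: dsum_def cl PiE_iff)
  next
    fix a b x assume "a \<in> carrier R" "b \<in> carrier R" "x \<in> carrier (dsum I M)"
    then show "(a \<oplus>\<^bsub>R\<^esub> b) \<odot>\<^bsub>dsum I M\<^esub> x = a \<odot>\<^bsub>dsum I M\<^esub> x \<oplus>\<^bsub>dsum I M\<^esub> b \<odot>\<^bsub>dsum I M\<^esub> x"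
      "(a \<otimes>\<^bsub>R\<^esub> b) \<odot>\<^bsub>dsum I M\<^esub> x = a \<odot>\<^bsub>dsum I M\<^esub> (b \<odot>\<^bsub>dsum I M\<^esub> x)"
      using module.smult_l_distr[OF assms(2)] module.smult_assoc1[OF assms(2)]
      by (auto simp: dsum_def PiE_iff intro!: restrict_ext)
  next
    fix a x y assume "a \<in> carrier R" "x \<in> carrier (dsum I M)" "y \<in> carrier (dsum I M)"
    then show "a \<odot>\<^bsub>dsum I M\<^esub> (x \<oplus>\<^bsub>dsum I M\<^esub> y) = a \<odot>\<^bsub>dsum I M\<^esub> x \<oplus>\<^bsub>dsum I M\<^esub> a \<odot>\<^bsub>dsum I M\<^esub> y"
      using module.smult_r_distr[OF assms(2)]
      by (auto simp: dsum_def PiE_iff intro!: restrict_ext)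
  next
    fix x assume "x \<in> carrier (dsum I M)"
    then show "\<one>\<^bsub>R\<^esub> \<odot>\<^bsub>dsum I M\<^esub> x = x"
      using module.smult_one[OF assms(2)]
      by (auto simp: dsum_def PiE_iff extensional_def fun_eq_iff)
  qed (auto simp: dsum_def cl PiE_iff)
qed

lemma module_kernel_module:
  assumes "module R M" "submodule {x \<in> carrier M. h x = \<zero>\<^bsub>N\<^esub>} R M"
  shows "module R (kernel_module M h N)"
  by (rule module_cong[OF submodule.submodule_is_module[OF assms(2,1)]])
    (simp_all add: kernel_module_def)

locale submodule_pair = module R M + submodule H R M for R (structure) and M (structure) and H
begin

lemma H_subgroup: "subgroup H (add_monoid M)" ..

lemma H_abelian_subgroup: "abelian_subgroup H M"
  by (intro abelian_subgroupI3 additive_subgroupI H_subgroup) unfold_locales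

lemma coset_eq_iff:
  assumes "x \<in> carrier M" "y \<in> carrier M"
  shows "H +>\<^bsub>M\<^esub> x = H +>\<^bsub>M\<^esub> y \<longleftrightarrow> (\<exists>h\<in>H. x = h \<oplus>\<^bsub>M\<^esub> y)"
proof
  assume eq: "H +>\<^bsub>M\<^esub> x = H +>\<^bsub>M\<^esub> y"
  have "x \<in> H +>\<^bsub>M\<^esub> x"
    using H_abelian_subgroup assms(1) by (rule abelian_subgroup.a_rcos_self)
  then show "\<exists>h\<in>H. x = h \<oplus>\<^bsub>M\<^esub> y" unfolding eq by (auto simp: a_r_coset_def')
next
  assume "\<exists>h\<in>H. x = h \<oplus>\<^bsub>M\<^esub> y"
  then have "x \<in> H +>\<^bsub>M\<^esub> y" by (auto simp: a_r_coset_def')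
  from M.a_repr_independence[OF this assms(2) H_subgroup]
  show "H +>\<^bsub>M\<^esub> x = H +>\<^bsub>M\<^esub> y" by simp
qed

lemma coset_add:
  assumes "x \<in> carrier M" "y \<in> carrier M"
  shows "(H +>\<^bsub>M\<^esub> x) <+>\<^bsub>M\<^esub> (H +>\<^bsub>M\<^esub> y) = H +>\<^bsub>M\<^esub> (x \<oplus>\<^bsub>M\<^esub> y)"
  using H_abelian_subgroup assms by (rule abelian_subgroup.a_rcos_sum)

lemma coset_zero: "H +>\<^bsub>M\<^esub> \<zero>\<^bsub>M\<^esub> = H"
  using subset by simp

lemma coset_self: "x \<in> carrier M \<Longrightarrow> x \<in> H +>\<^bsub>M\<^esub> x"
  using H_abelian_subgroup by (rule abelian_subgroup.a_rcos_self)

text \<open>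
  Operations on quotients are unions over all representatives of a coset. All terms of such a union
  coincide, and the union is their common value.
\<close>
lemma coset_UN:
  assumes "x \<in> carrier M" "\<And>h. h \<in> H \<Longrightarrow> F (h \<oplus>\<^bsub>M\<^esub> x) = V"
  shows "(\<Union>y\<in>H +>\<^bsub>M\<^esub> x. F y) = V"
proof -
  have "F y = V" if "y \<in> H +>\<^bsub>M\<^esub> x" for y
    using that assms(2) by (auto simp: a_r_coset_def')
  then show ?thesis using coset_self[OF assms(1)] by auto
qed

lemma coset_smult:
  assumes "r \<in> carrier R" "x \<in> carrier M"
  shows "(\<Union>y\<in>H +>\<^bsub>M\<^esub> x. H +>\<^bsub>M\<^esub> (r \<odot>\<^bsub>M\<^esub> y)) = H +>\<^bsub>M\<^esub> (r \<odot>\<^bsub>M\<^esub> x)"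
proof (rule coset_UN[OF assms(2)])
  fix h assume h: "h \<in> H"
  then have "h \<in> carrier M" using subset by auto
  then have "r \<odot>\<^bsub>M\<^esub> (h \<oplus>\<^bsub>M\<^esub> x) = r \<odot>\<^bsub>M\<^esub> h \<oplus>\<^bsub>M\<^esub> r \<odot>\<^bsub>M\<^esub> x"
    using assms by (intro smult_r_distr)
  then show "H +>\<^bsub>M\<^esub> (r \<odot>\<^bsub>M\<^esub> (h \<oplus>\<^bsub>M\<^esub> x)) = H +>\<^bsub>M\<^esub> (r \<odot>\<^bsub>M\<^esub> x)"
    using h assms \<open>h \<in> carrier M\<close> by (subst coset_eq_iff) auto
qed

end

text \<open>
  A homomorphism whose values are defined by choices is best described by its graph. The equivalence
  \<open>X = X' \<longleftrightarrow> Z = Z'\<close> says that the graph is single-valued and that the homomorphism is injective.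
\<close>
lemma bigraded_iso_of_relation:
  assumes carrier: "\<And>X Z. \<Phi> X Z \<Longrightarrow> X \<in> carrier A \<and> Z \<in> carrier B"
    and total: "\<And>X. X \<in> carrier A \<Longrightarrow> \<exists>Z. \<Phi> X Z"
    and onto: "\<And>Z. Z \<in> carrier B \<Longrightarrow> \<exists>X. \<Phi> X Z"
    and eq: "\<And>X Z X' Z'. \<Phi> X Z \<Longrightarrow> \<Phi> X' Z' \<Longrightarrow> X = X' \<longleftrightarrow> Z = Z'"
    and add: "\<And>X Z X' Z'. \<Phi> X Z \<Longrightarrow> \<Phi> X' Z' \<Longrightarrow> \<Phi> (X \<oplus>\<^bsub>A\<^esub> X') (Z \<oplus>\<^bsub>B\<^esub> Z')"
    and smult: "\<And>r X Z. r \<in> carrier R \<Longrightarrow> \<Phi> X Z \<Longrightarrow> \<Phi> (r \<odot>\<^bsub>A\<^esub> X) (r \<odot>\<^bsub>B\<^esub> Z)"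
    and piece_A: "\<And>d X. X \<in> piece A d \<Longrightarrow> \<exists>Z\<in>piece B d. \<Phi> X Z"
    and piece_B: "\<And>d Z. Z \<in> piece B d \<Longrightarrow> \<exists>X\<in>piece A d. \<Phi> X Z"
  shows "\<exists>\<phi>. \<phi> \<in> bigraded_iso R A B"
proof -
  define \<phi> where "\<phi> X = (THE Z. \<Phi> X Z)" for X
  have \<phi>I: "\<phi> X = Z" if "\<Phi> X Z" for X Z
    unfolding \<phi>_def using that eq by (intro the_equality) blast+
  have \<phi>: "\<Phi> X (\<phi> X)" if "X \<in> carrier A" for X
    using total[OF that] \<phi>I by blast
  have "bij_betw \<phi> (carrier A) (carrier B)"
    unfolding bij_betw_def
  proof
    show "inj_on \<phi> (carrier A)"
      using \<phi> eq by (intro inj_onI) metis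
    show "\<phi> ` carrier A = carrier B"
      using \<phi> carrier onto \<phi>I by (auto simp: image_iff) metis
  qed
  moreover have "\<phi> \<in> hom (add_monoid A) (add_monoid B)"
    using \<phi> carrier add \<phi>I by (auto simp: hom_def)
  moreover have "\<phi> (r \<odot>\<^bsub>A\<^esub> X) = r \<odot>\<^bsub>B\<^esub> \<phi> X" if "r \<in> carrier R" "X \<in> carrier A" for r X
    using \<phi> smult \<phi>I that by blast
  moreover have "\<phi> ` piece A d = piece B d" for d
  proof
    show "\<phi> ` piece A d \<subseteq> piece B d" using piece_A \<phi>I by blast
    show "piece B d \<subseteq> \<phi> ` piece A d" using piece_B \<phi>I by blast
  qed
  ultimately show ?thesis by (auto simp: bigraded_iso_def iso_def)
qed

locale module_map = dom: module R M + cod: module R N for R (structure)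
    and M :: "('a, 'b) bigraded_module" and N :: "('a, 'c) bigraded_module" +
  fixes h
  assumes map_closed: "x \<in> carrier M \<Longrightarrow> h x \<in> carrier N"
    and map_add: "x \<in> carrier M \<Longrightarrow> y \<in> carrier M \<Longrightarrow> h (x \<oplus>\<^bsub>M\<^esub> y) = h x \<oplus>\<^bsub>N\<^esub> h y"
    and map_smult: "r \<in> carrier R \<Longrightarrow> x \<in> carrier M \<Longrightarrow> h (r \<odot>\<^bsub>M\<^esub> x) = r \<odot>\<^bsub>N\<^esub> h x"
begin

lemma map_zero: "h \<zero>\<^bsub>M\<^esub> = \<zero>\<^bsub>N\<^esub>"
proof -
  have "h (\<zero> \<odot>\<^bsub>M\<^esub> \<zero>\<^bsub>M\<^esub>) = \<zero> \<odot>\<^bsub>N\<^esub> h \<zero>\<^bsub>M\<^esub>" by (rule map_smult) auto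
  then show ?thesis by (simp add: map_closed)
qed

lemma minus_eq_smult_dom: "x \<in> carrier M \<Longrightarrow> \<ominus>\<^bsub>M\<^esub> x = (\<ominus> \<one>) \<odot>\<^bsub>M\<^esub> x"
  by (simp add: dom.smult_l_minus)

lemma minus_eq_smult_cod: "x \<in> carrier N \<Longrightarrow> \<ominus>\<^bsub>N\<^esub> x = (\<ominus> \<one>) \<odot>\<^bsub>N\<^esub> x"
  by (simp add: cod.smult_l_minus)

lemma submodule_kernel: "submodule {x \<in> carrier M. h x = \<zero>\<^bsub>N\<^esub>} R M"
  by (rule dom.submoduleI)
    (auto simp: map_add map_smult map_zero minus_eq_smult_dom)

lemma submodule_image: "submodule (h ` carrier M) R N"
proof (rule cod.submoduleI)
  show "\<zero>\<^bsub>N\<^esub> \<in> h ` carrier M" using map_zero by (metis dom.M.zero_closed imageI)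
  fix y assume "y \<in> h ` carrier M"
  then obtain x where x: "x \<in> carrier M" "y = h x" by auto
  show "\<ominus>\<^bsub>N\<^esub> y \<in> h ` carrier M"
    using x map_smult[of "\<ominus> \<one>" x] by (intro image_eqI[of _ _ "(\<ominus> \<one>) \<odot>\<^bsub>M\<^esub> x"])
      (auto simp: minus_eq_smult_cod map_closed)
  fix z assume "z \<in> h ` carrier M"
  then obtain x' where x': "x' \<in> carrier M" "z = h x'" by auto
  show "y \<oplus>\<^bsub>N\<^esub> z \<in> h ` carrier M"
    using x x' by (intro image_eqI[of _ _ "x \<oplus>\<^bsub>M\<^esub> x'"]) (auto simp: map_add)
next
  fix r y assume "r \<in> carrier R" "y \<in> h ` carrier M"
  then show "r \<odot>\<^bsub>N\<^esub> y \<in> h ` carrier M"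
    by (auto simp flip: map_smult)
qed (auto simp: map_closed)

lemma module_kernel: "module R (kernel_module M h N)" if "module R M"
  using that submodule_kernel by (rule module_kernel_module)

lemma submodule_pair_kernel:
  fixes A
  assumes "module_map R A M k" "\<And>x. x \<in> carrier A \<Longrightarrow> h (k x) = \<zero>\<^bsub>N\<^esub>"
  shows "submodule_pair R (kernel_module M h N) (k ` carrier A)"
proof -
  interpret k: module_map R A M k by fact
  interpret K: module R "kernel_module M h N"
    by (rule module_kernel) unfold_locales
  have "submodule (k ` carrier A) R (kernel_module M h N)"
  proof (rule K.module_incl_imp_submodule)
    show "k ` carrier A \<subseteq> carrier (kernel_module M h N)"
      using assms(2) k.map_closed by (auto simp: kernel_module_def)
    have "module R (M\<lparr>carrier := k ` carrier A\<rparr>)"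
      by (rule submodule.submodule_is_module[OF k.submodule_image]) unfold_locales
    then show "module R (kernel_module M h N\<lparr>carrier := k ` carrier A\<rparr>)"
      by (rule module_cong) (simp_all add: kernel_module_def)
  qed
  with K.module_axioms show ?thesis by (rule submodule_pair.intro)
qed

end

lemma kernel_module_simps [simp]:
  "carrier (kernel_module M h N) = {x \<in> carrier M. h x = \<zero>\<^bsub>N\<^esub>}"
  "add (kernel_module M h N) = add M" "\<zero>\<^bsub>kernel_module M h N\<^esub> = \<zero>\<^bsub>M\<^esub>"
  "smult (kernel_module M h N) = smult M"
  "piece (kernel_module M h N) e = {x \<in> piece M e. h x = \<zero>\<^bsub>N\<^esub>}"
  by (simp_all add: kernel_module_def)

lemma quotient_module_simps:
  "carrier (quotient_module M H) = (\<lambda>x. H +>\<^bsub>M\<^esub> x) ` carrier M"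
  "X \<oplus>\<^bsub>quotient_module M H\<^esub> Y = X <+>\<^bsub>M\<^esub> Y" "\<zero>\<^bsub>quotient_module M H\<^esub> = H"
  "r \<odot>\<^bsub>quotient_module M H\<^esub> X = (\<Union>x\<in>X. H +>\<^bsub>M\<^esub> (r \<odot>\<^bsub>M\<^esub> x))"
  "piece (quotient_module M H) e = (\<lambda>x. H +>\<^bsub>M\<^esub> x) ` piece M e"
  by (auto simp: quotient_module_def A_RCOSETS_def')

section \<open>Localizations of a commutative ring\<close>

text \<open>
  The ring operations are those of a type class, so that computations in \<open>R\<close> can use its simplification
  rules.
\<close>
locale ring_record =
  fixes R :: "('a::comm_ring_1, 'a) bigraded_module"
  assumes carrier_R [simp]: "carrier R = UNIV"
    and mult_R [simp]: "monoid.mult R = (*)"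
    and one_R [simp]: "\<one>\<^bsub>R\<^esub> = 1"
    and zero_R [simp]: "\<zero>\<^bsub>R\<^esub> = 0"
    and add_R [simp]: "add R = (+)"
    and smult_R [simp]: "smult R = (*)"
begin

lemma cring_R: "cring R"
proof (rule cringI)
  show "abelian_group R"
    by (rule abelian_groupI) (auto simp: add.assoc add.commute intro!: exI[of _ "- x" for x])
  show "Group.comm_monoid R"
    by (rule comm_monoidI) (auto simp: mult.assoc mult.commute)
qed (auto simp: algebra_simps)

sublocale cring R by (rule cring_R)

lemma a_inv_R [simp]: "\<ominus>\<^bsub>R\<^esub> x = - x"
  by (rule minus_equality) auto

lemma nat_pow_R [simp]: "x [^]\<^bsub>R\<^esub> (k::nat) = x ^ k"
  by (induction k) (simp_all add: mult.commute)

lemma finsum_R [simp]: "finite A \<Longrightarrow> finsum R h A = sum h A"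
  by (induction A rule: finite_induct) auto

lemma finprod_R [simp]: "finite A \<Longrightarrow> finprod R h A = prod h A"
  by (induction A rule: finite_induct) auto

lemma shift_simps [simp]:
  "carrier (shift R a) = UNIV" "\<zero>\<^bsub>shift R a\<^esub> = 0" "add (shift R a) = (+)" "smult (shift R a) = (*)"
  "piece (shift R a) e = piece R (a + e)"
  by (simp_all add: shift_def)

lemma module_shift: "module R (shift R a)"
  by (rule moduleI[OF cring_R], rule abelian_groupI)
    (auto simp: algebra_simps intro!: exI[of _ "- x" for x])

end

locale localization_at = ring_record R for R :: "('a::comm_ring_1, 'a) bigraded_module" +
  fixes S :: "'a set"
  assumes one_S: "1 \<in> S" and mult_S: "s \<in> S \<Longrightarrow> t \<in> S \<Longrightarrow> s * t \<in> S"
begin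

text \<open>The class of \<open>m / s\<close>, which is the same set for all twists of \<open>R\<close>.\<close>
definition frac :: "'a \<Rightarrow> 'a \<Rightarrow> ('a \<times> 'a) set"
  where "frac m s = {(m', s'). s' \<in> S \<and> (\<exists>t\<in>S. t * s' * m = t * s * m')}"

lemma fraction_shift [simp]: "fraction R S (shift R a) = frac"
  by (simp add: fraction_def frac_def fun_eq_iff)

lemma frac_rep: "s \<in> S \<Longrightarrow> (m, s) \<in> frac m s"
  using one_S by (auto simp: frac_def)

lemma fracE:
  assumes "(m', s') \<in> frac m s"
  obtains t where "s' \<in> S" "t \<in> S" "t * s' * m = t * s * m'"
  using assms by (auto simp: frac_def)

lemma frac_eqI:
  assumes "s \<in> S" "s' \<in> S" "t \<in> S" and eq: "t * s' * m = t * s * m'"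
  shows "frac m s = frac m' s'"
proof -
  have "\<exists>w\<in>S. w * r * m' = w * s' * n" if "u \<in> S" "u * r * m = u * s * n" for u r n
  proof
    show "u * t * s \<in> S" using assms that by (simp add: mult_S)
    have "u * t * s * r * m' = u * r * (t * s * m')" by (simp add: ac_simps)
    also have "\<dots> = t * s' * (u * r * m)" unfolding eq[symmetric] by (simp add: ac_simps)
    also have "\<dots> = u * t * s * s' * n" unfolding that(2) by (simp add: ac_simps)
    finally show "u * t * s * r * m' = u * t * s * s' * n" .
  qed
  moreover have "\<exists>w\<in>S. w * r * m = w * s * n" if "u \<in> S" "u * r * m' = u * s' * n" for u r n
  proof
    show "u * t * s' \<in> S" using assms that by (simp add: mult_S)
    have "u * t * s' * r * m = u * r * (t * s' * m)" by (simp add: ac_simps)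
    also have "\<dots> = t * s * (u * r * m')" unfolding eq by (simp add: ac_simps)
    also have "\<dots> = u * t * s' * s * n" unfolding that(2) by (simp add: ac_simps)
    finally show "u * t * s' * r * m = u * t * s' * s * n" .
  qed
  ultimately show ?thesis unfolding frac_def by blast
qed

lemma frac_eq_iff:
  assumes "s \<in> S" "s' \<in> S"
  shows "frac m s = frac m' s' \<longleftrightarrow> (\<exists>t\<in>S. t * s' * m = t * s * m')"
proof
  assume "frac m s = frac m' s'"
  then have "(m', s') \<in> frac m s" using frac_rep[OF assms(2)] by simp
  then show "\<exists>t\<in>S. t * s' * m = t * s * m'" by (auto simp: frac_def)
next
  assume "\<exists>t\<in>S. t * s' * m = t * s * m'"
  then show "frac m s = frac m' s'" using frac_eqI[OF assms] by blast
qed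

lemma frac_UN:
  assumes "s \<in> S" "\<And>m' s' t. s' \<in> S \<Longrightarrow> t \<in> S \<Longrightarrow> t * s' * m = t * s * m' \<Longrightarrow> F m' s' = V"
  shows "(\<Union>(m', s')\<in>frac m s. F m' s') = V"
proof -
  have "F m' s' = V" if "(m', s') \<in> frac m s" for m' s'
    using that assms(2) by (elim fracE)
  then show ?thesis using frac_rep[OF assms(1), of m] by (auto split: prod.splits)
qed

lemma carrier_localization: "carrier (localization R S (shift R a)) = {frac m s | m s. s \<in> S}"
  by (simp add: localization_def)

lemma frac_in_carrier [simp]: "s \<in> S \<Longrightarrow> frac m s \<in> carrier (localization R S (shift R a))"
  by (auto simp: carrier_localization)

lemma zero_localization: "\<zero>\<^bsub>localization R S (shift R a)\<^esub> = frac 0 1"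
  by (simp add: localization_def)

lemma frac_zero: "s \<in> S \<Longrightarrow> frac 0 s = frac 0 1"
  by (rule frac_eqI[where t = 1]) (simp_all add: one_S)

lemma add_localization:
  assumes "s \<in> S" "t \<in> S"
  shows "frac m s \<oplus>\<^bsub>localization R S (shift R a)\<^esub> frac n t = frac (t * m + s * n) (s * t)"
proof -
  have "(\<Union>(m', s')\<in>frac m s. \<Union>(n', t')\<in>frac n t. frac (t' * m' + s' * n') (s' * t')) =
      frac (t * m + s * n) (s * t)"
  proof (intro frac_UN assms)
    fix m' s' u n' t' v
    assume *: "s' \<in> S" "u \<in> S" "u * s' * m = u * s * m'" "t' \<in> S" "v \<in> S" "v * t' * n = v * t * n'"
    show "frac (t' * m' + s' * n') (s' * t') = frac (t * m + s * n) (s * t)"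
    proof (rule frac_eqI)
      show "u * v \<in> S" "s' * t' \<in> S" "s * t \<in> S" using * assms by (simp_all add: mult_S)
      have "u * v * (s * t) * (t' * m' + s' * n') = v * t * t' * (u * s * m') + u * s * s' * (v * t * n')"
        by (simp add: algebra_simps)
      also have "\<dots> = v * t * t' * (u * s' * m) + u * s * s' * (v * t' * n)"
        by (simp only: *)
      finally show "u * v * (s * t) * (t' * m' + s' * n') = u * v * (s' * t') * (t * m + s * n)"
        by (simp add: algebra_simps)
    qed
  qed
  then show ?thesis by (simp add: localization_def)
qed

lemma add_localization_same:
  assumes "s \<in> S"
  shows "frac m s \<oplus>\<^bsub>localization R S (shift R a)\<^esub> frac n s = frac (m + n) s"
  unfolding add_localization[OF assms assms]
  by (rule frac_eqI[where t = 1]) (use assms in \<open>simp_all add: one_S mult_S algebra_simps\<close>)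

lemma smult_localization:
  assumes "s \<in> S"
  shows "r \<odot>\<^bsub>localization R S (shift R a)\<^esub> frac m s = frac (r * m) s"
proof -
  have "(\<Union>(m', s')\<in>frac m s. frac (r * m') s') = frac (r * m) s"
  proof (intro frac_UN assms)
    fix m' s' t assume "s' \<in> S" "t \<in> S" "t * s' * m = t * s * m'"
    then show "frac (r * m') s' = frac (r * m) s"
      using assms by (intro frac_eqI[of s' s t]) (simp_all add: mult.left_commute[of _ r])
  qed
  then show ?thesis by (simp add: localization_def)
qed

lemma module_localization: "module R (localization R S (shift R a))"
proof (rule moduleI[OF cring_R])
  let ?L = "localization R S (shift R a)"
  note simps = carrier_localization add_localization smult_localization zero_localization mult_S one_S
  show "abelian_group ?L"
  proof (rule abelian_groupI)
    fix x assume "x \<in> carrier ?L"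
    then obtain m s where x: "x = frac m s" "s \<in> S" by (auto simp: simps)
    then have "frac (- m) s \<oplus>\<^bsub>?L\<^esub> x = \<zero>\<^bsub>?L\<^esub>"
      by (simp add: add_localization_same frac_zero zero_localization)
    then show "\<exists>y\<in>carrier ?L. y \<oplus>\<^bsub>?L\<^esub> x = \<zero>\<^bsub>?L\<^esub>"
      using x by (intro bexI[of _ "frac (- m) s"]) auto
    show "\<zero>\<^bsub>?L\<^esub> \<oplus>\<^bsub>?L\<^esub> x = x"
      using x by (simp add: simps)
  next
    fix x y assume "x \<in> carrier ?L" "y \<in> carrier ?L"
    then obtain m s m' s' where x: "x = frac m s" "s \<in> S" "y = frac m' s'" "s' \<in> S" by (auto simp: simps)
    then show "x \<oplus>\<^bsub>?L\<^esub> y \<in> carrier ?L" by (simp add: add_localization mult_S)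
    show "x \<oplus>\<^bsub>?L\<^esub> y = y \<oplus>\<^bsub>?L\<^esub> x" using x by (simp add: simps add.commute mult.commute)
  next
    fix x y z assume "x \<in> carrier ?L" "y \<in> carrier ?L" "z \<in> carrier ?L"
    then obtain m s m' s' m'' s'' where
      x: "x = frac m s" "s \<in> S" "y = frac m' s'" "s' \<in> S" "z = frac m'' s''" "s'' \<in> S" by (auto simp: simps)
    then show "x \<oplus>\<^bsub>?L\<^esub> y \<oplus>\<^bsub>?L\<^esub> z = x \<oplus>\<^bsub>?L\<^esub> (y \<oplus>\<^bsub>?L\<^esub> z)"
      by (simp add: simps algebra_simps)
  qed (simp add: zero_localization one_S)
next
  fix b x assume "x \<in> carrier (localization R S (shift R a))"
  then obtain m s where x: "x = frac m s" "s \<in> S" by (auto simp: carrier_localization)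
  then show "b \<odot>\<^bsub>localization R S (shift R a)\<^esub> x \<in> carrier (localization R S (shift R a))"
    "\<one>\<^bsub>R\<^esub> \<odot>\<^bsub>localization R S (shift R a)\<^esub> x = x"
    by (simp_all add: smult_localization)
next
  fix b c x assume "x \<in> carrier (localization R S (shift R a))"
  then obtain m s where x: "x = frac m s" "s \<in> S" by (auto simp: carrier_localization)
  then show "(b \<oplus>\<^bsub>R\<^esub> c) \<odot>\<^bsub>localization R S (shift R a)\<^esub> x =
      b \<odot>\<^bsub>localization R S (shift R a)\<^esub> x \<oplus>\<^bsub>localization R S (shift R a)\<^esub> c \<odot>\<^bsub>localization R S (shift R a)\<^esub> x"
    "(b \<otimes>\<^bsub>R\<^esub> c) \<odot>\<^bsub>localization R S (shift R a)\<^esub> x =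
      b \<odot>\<^bsub>localization R S (shift R a)\<^esub> (c \<odot>\<^bsub>localization R S (shift R a)\<^esub> x)"
    by (simp_all add: smult_localization add_localization_same algebra_simps)
next
  fix b x y assume "x \<in> carrier (localization R S (shift R a))" "y \<in> carrier (localization R S (shift R a))"
  then obtain m s m' s' where x: "x = frac m s" "s \<in> S" "y = frac m' s'" "s' \<in> S"
    by (auto simp: carrier_localization)
  then show "b \<odot>\<^bsub>localization R S (shift R a)\<^esub> (x \<oplus>\<^bsub>localization R S (shift R a)\<^esub> y) =
      b \<odot>\<^bsub>localization R S (shift R a)\<^esub> x \<oplus>\<^bsub>localization R S (shift R a)\<^esub> b \<odot>\<^bsub>localization R S (shift R a)\<^esub> y"
    by (simp add: smult_localization add_localization mult_S algebra_simps)
qed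

lemma finsum_localization:
  assumes "finite A" "s \<in> S"
  shows "finsum (localization R S (shift R a)) (\<lambda>j. frac (h j) s) A = frac (\<Sum>j\<in>A. h j) s"
  using assms(1)
proof (induction A rule: finite_induct)
  interpret L: module R "localization R S (shift R a)" by (rule module_localization)
  case empty
  then show ?case using assms(2) by (simp add: zero_localization frac_zero)
next
  interpret L: module R "localization R S (shift R a)" by (rule module_localization)
  case (insert j A)
  then show ?case using assms(2) by (subst L.finsum_insert) (auto simp: add_localization_same)
qed

end

section \<open>Cech modules by numerators and levels\<close>

locale cech_ring = ring_record R for R :: "('a::comm_ring_1, 'a) bigraded_module" +
  fixes gs :: "'a list"
begin

abbreviation g :: "nat \<Rightarrow> 'a" where "g \<equiv> (!) gs"
abbreviation n :: nat where "n \<equiv> length gs"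
abbreviation S :: "nat set \<Rightarrow> 'a set" where "S \<equiv> denominators R gs"

lemma S_eq: "finite I \<Longrightarrow> S I = {\<Prod>i\<in>I. g i ^ a i | a. True}"
  by (simp add: denominators_def)

lemma localization_at_S:
  assumes "finite I"
  shows "localization_at R (S I)"
proof
  show "1 \<in> S I" unfolding S_eq[OF assms] by (auto intro!: exI[of _ "\<lambda>_. 0"])
  fix s t assume "s \<in> S I" "t \<in> S I"
  then obtain a b where "s = (\<Prod>i\<in>I. g i ^ a i)" "t = (\<Prod>i\<in>I. g i ^ b i)"
    unfolding S_eq[OF assms] by auto
  then have "s * t = (\<Prod>i\<in>I. g i ^ (a i + b i))" by (simp add: power_add prod.distrib)
  then show "s * t \<in> S I" unfolding S_eq[OF assms] by (auto intro!: exI[of _ "\<lambda>i. a i + b i"])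
qed

lemma prod_power_in_S: "finite I \<Longrightarrow> prod_power g N I \<in> S I"
  by (auto simp: S_eq prod_power_def intro!: exI[of _ "\<lambda>_. N"])

lemma S_mono:
  assumes "finite I" "J \<subseteq> I"
  shows "S J \<subseteq> S I"
proof
  have fin: "finite J" using assms finite_subset by auto
  fix s assume "s \<in> S J"
  then obtain a where "s = (\<Prod>i\<in>J. g i ^ a i)" unfolding S_eq[OF fin] by auto
  also have "\<dots> = (\<Prod>i\<in>I. g i ^ (if i \<in> J then a i else 0))"
    by (rule prod.mono_neutral_cong_left) (use assms in auto)
  finally show "s \<in> S I" unfolding S_eq[OF assms(1)] by (intro CollectI exI conjI TrueI)
qed

definition level_fraction :: "nat set \<Rightarrow> 'a \<Rightarrow> 'a \<Rightarrow> ('a \<times> 'a) set"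
  where "level_fraction I = localization_at.frac (S I)"

definition cochain :: "nat \<Rightarrow> nat \<Rightarrow> (nat set \<Rightarrow> 'a) \<Rightarrow> nat set \<Rightarrow> ('a \<times> 'a) set"
  where "cochain p N m = (\<lambda>I\<in>subsets_of_size n p. level_fraction I (m I) (prod_power g N I))"

lemma level_fraction_prod_power_raise:
  assumes "finite I"
  shows "level_fraction I m (prod_power g N I) = level_fraction I (prod_power g M I * m) (prod_power g (N + M) I)"
proof -
  interpret localization_at R "S I" by (rule localization_at_S[OF assms])
  show ?thesis unfolding level_fraction_def
    by (rule frac_eqI[OF prod_power_in_S[OF assms] prod_power_in_S[OF assms] one_S]) (simp add: prod_power_add ac_simps)
qed

text \<open>
  Every denominator divides a power of \<open>g\<^sub>I\<close>. The right hand side asks for all large exponents so that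
  finitely many index sets can be treated at once.
\<close>
lemma level_fraction_prod_power_eq_iff:
  assumes "finite I"
  shows "level_fraction I m (prod_power g N I) = level_fraction I m' (prod_power g N I) \<longleftrightarrow>
    (\<exists>K. \<forall>K'\<ge>K. prod_power g K' I * m = prod_power g K' I * m')"
proof -
  interpret localization_at R "S I" by (rule localization_at_S[OF assms])
  have "(\<exists>t\<in>S I. t * prod_power g N I * m = t * prod_power g N I * m') \<longleftrightarrow>
      (\<exists>K. \<forall>K'\<ge>K. prod_power g K' I * m = prod_power g K' I * m')"
  proof
    assume "\<exists>t\<in>S I. t * prod_power g N I * m = t * prod_power g N I * m'"
    then obtain a where a: "(\<Prod>i\<in>I. g i ^ a i) * prod_power g N I * m = (\<Prod>i\<in>I. g i ^ a i) * prod_power g N I * m'"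
      unfolding S_eq[OF assms] by auto
    have "prod_power g K I * m = prod_power g K I * m'" if "K \<ge> (\<Sum>i\<in>I. a i) + N" for K
    proof -
      have le: "a i + N \<le> K" if "i \<in> I" for i
        using member_le_sum[OF that, of a] assms \<open>K \<ge> (\<Sum>i\<in>I. a i) + N\<close> by simp
      have "prod_power g K I = (\<Prod>i\<in>I. g i ^ (K - (a i + N))) * ((\<Prod>i\<in>I. g i ^ a i) * prod_power g N I)"
        unfolding prod_power_def prod.distrib[symmetric] power_add[symmetric]
        by (rule prod.cong[OF refl]) (use le in simp)
      then show ?thesis using a by (simp only: mult.assoc)
    qed
    then show "\<exists>K. \<forall>K'\<ge>K. prod_power g K' I * m = prod_power g K' I * m'" by blast
  next
    assume "\<exists>K. \<forall>K'\<ge>K. prod_power g K' I * m = prod_power g K' I * m'"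
    then obtain K where "prod_power g K I * m = prod_power g K I * m'" by auto
    then have "prod_power g K I * prod_power g N I * m = prod_power g K I * prod_power g N I * m'"
      by (metis mult.assoc mult.commute)
    then show "\<exists>t\<in>S I. t * prod_power g N I * m = t * prod_power g N I * m'"
      using prod_power_in_S[OF assms] by blast
  qed
  then show ?thesis
    unfolding level_fraction_def by (simp add: frac_eq_iff prod_power_in_S[OF assms])
qed

lemma cochain_raise: "cochain p N m = cochain p (N + M) (\<lambda>I. prod_power g M I * m I)"
  unfolding cochain_def by (rule restrict_ext) (simp add: level_fraction_prod_power_raise[of _ _ N M] subsets_of_size_finite)

lemma cochain_cong: "(\<And>I. I \<in> subsets_of_size n p \<Longrightarrow> m I = m' I) \<Longrightarrow> cochain p N m = cochain p N m'"
  unfolding cochain_def by (rule restrict_ext) simp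

lemma eventually_level:
  assumes "finite A" "\<And>x. x \<in> A \<Longrightarrow> \<exists>K. \<forall>K'\<ge>K. P x (K'::nat)"
  shows "\<exists>K. \<forall>x\<in>A. P x K"
proof -
  have "\<forall>\<^sub>F K in sequentially. \<forall>x\<in>A. P x K"
    using assms by (intro eventually_ball_finite) (auto simp: eventually_sequentially)
  then show ?thesis by (auto simp: eventually_sequentially)
qed

lemma cochain_eq_iff:
  "cochain p N m = cochain p N m' \<longleftrightarrow> (\<exists>K. \<forall>I\<in>subsets_of_size n p. prod_power g K I * m I = prod_power g K I * m' I)"
proof
  assume eq: "cochain p N m = cochain p N m'"
  have "level_fraction I (m I) (prod_power g N I) = level_fraction I (m' I) (prod_power g N I)" if "I \<in> subsets_of_size n p" for I
    using fun_cong[OF eq, of I] that by (simp add: cochain_def)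
  then show "\<exists>K. \<forall>I\<in>subsets_of_size n p. prod_power g K I * m I = prod_power g K I * m' I"
    by (intro eventually_level) (simp_all add: level_fraction_prod_power_eq_iff subsets_of_size_finite)
next
  assume "\<exists>K. \<forall>I\<in>subsets_of_size n p. prod_power g K I * m I = prod_power g K I * m' I"
  then obtain K where "\<forall>I\<in>subsets_of_size n p. prod_power g K I * m I = prod_power g K I * m' I" by blast
  then show "cochain p N m = cochain p N m'"
    unfolding cochain_raise[of p N _ K] by (intro cochain_cong) simp
qed

lemma module_cech: "module R (cech_module R gs p (shift R a))"
  unfolding cech_module_def
  by (intro module_dsum cring_R localization_at.module_localization localization_at_S
      subsets_of_size_finite)

lemma cochain_in_carrier: "cochain p N m \<in> carrier (cech_module R gs p (shift R a))"
  using localization_at.frac_in_carrier[OF localization_at_S prod_power_in_S]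
  by (auto simp: cochain_def cech_module_def dsum_def level_fraction_def subsets_of_size_finite)

lemma localization_cochain:
  assumes "finite I" "x \<in> carrier (localization R (S I) (shift R a))"
  shows "\<exists>N. \<forall>N'\<ge>N. \<exists>m. x = level_fraction I m (prod_power g N' I)"
proof -
  interpret localization_at R "S I" by (rule localization_at_S[OF assms(1)])
  obtain m s where x: "x = frac m s" "s \<in> S I"
    using assms(2) by (auto simp: carrier_localization)
  then obtain a where s: "s = (\<Prod>i\<in>I. g i ^ a i)" unfolding S_eq[OF assms(1)] by auto
  have "x = level_fraction I ((\<Prod>i\<in>I. g i ^ (N - a i)) * m) (prod_power g N I)" if N: "N \<ge> (\<Sum>i\<in>I. a i)" for N
  proof -
    have le: "a i \<le> N" if "i \<in> I" for i
      using member_le_sum[OF that, of a] assms(1) N by simp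
    have "prod_power g N I = s * (\<Prod>i\<in>I. g i ^ (N - a i))"
      unfolding prod_power_def s prod.distrib[symmetric] power_add[symmetric]
      by (rule prod.cong[OF refl]) (use le in simp)
    then show ?thesis
      unfolding x(1) level_fraction_def
      by (intro frac_eqI[OF x(2) prod_power_in_S[OF assms(1)] one_S]) (simp add: mult.assoc)
  qed
  then show ?thesis by blast
qed

text \<open>The finitely many components of a cochain have a common level.\<close>
lemma carrier_cech_cochain:
  assumes "x \<in> carrier (cech_module R gs p (shift R a))"
  shows "\<exists>N m. x = cochain p N m"
proof -
  have x: "x \<in> (\<Pi>\<^sub>E I\<in>subsets_of_size n p. carrier (localization R (S I) (shift R a)))"
    using assms by (simp add: cech_module_def dsum_def)
  have "\<exists>N. \<forall>I\<in>subsets_of_size n p. \<exists>m. x I = level_fraction I m (prod_power g N I)"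
    by (intro eventually_level localization_cochain) (use x in \<open>auto simp: subsets_of_size_finite\<close>)
  then obtain N where "\<forall>I\<in>subsets_of_size n p. \<exists>m. x I = level_fraction I m (prod_power g N I)" by blast
  then obtain m where m: "\<forall>I\<in>subsets_of_size n p. x I = level_fraction I (m I) (prod_power g N I)" by metis
  have "x = cochain p N m"
  proof
    fix I show "x I = cochain p N m I"
      using m PiE_arb[OF x] by (cases "I \<in> subsets_of_size n p") (auto simp: cochain_def)
  qed
  then show ?thesis by blast
qed

lemma add_cochain: "cochain p N m \<oplus>\<^bsub>cech_module R gs p (shift R a)\<^esub> cochain p N m' = cochain p N (\<lambda>I. m I + m' I)"
  by (simp add: cochain_def cech_module_def dsum_def level_fraction_def)
    (rule restrict_ext, simp add: subsets_of_size_finite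
      localization_at.add_localization_same[OF localization_at_S prod_power_in_S])

lemma smult_cochain: "r \<odot>\<^bsub>cech_module R gs p (shift R a)\<^esub> cochain p N m = cochain p N (\<lambda>I. r * m I)"
  by (simp add: cochain_def cech_module_def dsum_def level_fraction_def)
    (rule restrict_ext, simp add: subsets_of_size_finite
      localization_at.smult_localization[OF localization_at_S prod_power_in_S])

lemma zero_cochain: "\<zero>\<^bsub>cech_module R gs p (shift R a)\<^esub> = cochain p N (\<lambda>_. 0)"
  by (simp add: cochain_def cech_module_def dsum_def level_fraction_def)
    (rule restrict_ext, simp add: subsets_of_size_finite
      localization_at.zero_localization[OF localization_at_S]
      localization_at.frac_zero[OF localization_at_S prod_power_in_S])

lemma localization_map_level_fraction:
  assumes "finite J" "I \<subseteq> J" "s \<in> S I"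
  shows "localization_map R (S J) (shift R a) (\<lambda>m. c * m) (level_fraction I m s) = level_fraction J (c * m) s"
proof -
  have fin: "finite I" using assms finite_subset by auto
  interpret I: localization_at R "S I" by (rule localization_at_S[OF fin])
  interpret J: localization_at R "S J" by (rule localization_at_S[OF assms(1)])
  have sub: "S I \<subseteq> S J" by (rule S_mono[OF assms(1,2)])
  show ?thesis
    unfolding localization_map_def level_fraction_def J.fraction_shift
  proof (intro I.frac_UN assms(3))
    fix m' s' t assume "s' \<in> S I" "t \<in> S I" "t * s' * m = t * s * m'"
    then show "J.frac (c * m') s' = J.frac (c * m) s"
      using assms(3) sub by (intro J.frac_eqI[of s' s t]) (auto simp: mult.left_commute[of _ c])
  qed
qed

lemma cech_differential_cochain:
  "cech_differential R gs p (shift R a) (cochain p N m) = cochain (Suc p) N (cech_level g N m)"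
  unfolding cech_differential_def cochain_def Suc_eq_plus1[symmetric] Let_def
proof (rule restrict_ext)
  fix J assume J: "J \<in> subsets_of_size n (Suc p)"
  then have fin: "finite J" by (rule subsets_of_size_finite)
  interpret localization_at R "S J" by (rule localization_at_S[OF fin])
  let ?L = "localization R (S J) (shift R a)"
  have gJ: "prod_power g N J \<in> S J" by (rule prod_power_in_S[OF fin])
  have "finsum ?L (\<lambda>j. (\<ominus>\<^bsub>R\<^esub> \<one>\<^bsub>R\<^esub>) [^]\<^bsub>R\<^esub> card {i \<in> J. i < j} \<odot>\<^bsub>?L\<^esub>
      localization_map R (S J) (shift R a) (\<lambda>m. m)
        ((\<lambda>I\<in>subsets_of_size n p. level_fraction I (m I) (prod_power g N I)) (J - {j}))) J =
    finsum ?L (\<lambda>j. frac ((- 1) ^ card {i \<in> J. i < j} * (g j ^ N * m (J - {j}))) (prod_power g N J)) J"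
  proof (rule abelian_monoid.finsum_cong'[OF _ refl])
    show "abelian_monoid ?L"
      using module_localization[of a] by (simp add: module_def abelian_group_def)
    show "(\<lambda>j. frac ((- 1) ^ card {i \<in> J. i < j} * (g j ^ N * m (J - {j}))) (prod_power g N J)) \<in> J \<rightarrow> carrier ?L"
      using gJ by auto
    fix j assume j: "j \<in> J"
    have fin': "finite (J - {j})" using fin by simp
    have "localization_map R (S J) (shift R a) (\<lambda>m. m) (level_fraction (J - {j}) (m (J - {j})) (prod_power g N (J - {j})))
        = level_fraction J (m (J - {j})) (prod_power g N (J - {j}))"
      using localization_map_level_fraction[OF fin _ prod_power_in_S[OF fin'], where c = 1] by auto
    also have "\<dots> = frac (g j ^ N * m (J - {j})) (prod_power g N J)"
      unfolding level_fraction_def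
    proof (rule frac_eqI[OF _ gJ one_S])
      show "prod_power g N (J - {j}) \<in> S J" using prod_power_in_S[OF fin'] S_mono[OF fin, of "J - {j}"] by auto
    qed (simp add: prod_power_remove[OF fin j])
    finally show "(\<ominus>\<^bsub>R\<^esub> \<one>\<^bsub>R\<^esub>) [^]\<^bsub>R\<^esub> card {i \<in> J. i < j} \<odot>\<^bsub>?L\<^esub>
      localization_map R (S J) (shift R a) (\<lambda>m. m)
        ((\<lambda>I\<in>subsets_of_size n p. level_fraction I (m I) (prod_power g N I)) (J - {j})) =
      frac ((- 1) ^ card {i \<in> J. i < j} * (g j ^ N * m (J - {j}))) (prod_power g N J)"
      using subsets_of_size_remove[OF J j] gJ by (simp add: smult_localization)
  qed
  then show "finsum ?L (\<lambda>j. (\<ominus>\<^bsub>R\<^esub> \<one>\<^bsub>R\<^esub>) [^]\<^bsub>R\<^esub> card {i \<in> J. i < j} \<odot>\<^bsub>?L\<^esub>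
      localization_map R (S J) (shift R a) (\<lambda>m. m)
        ((\<lambda>I\<in>subsets_of_size n p. level_fraction I (m I) (prod_power g N I)) (J - {j}))) J =
      level_fraction J (cech_level g N m J) (prod_power g N J)"
    by (simp only: finsum_localization[OF fin gJ] level_fraction_def cech_level_def)
qed

end

section \<open>Local cohomology by numerators and levels\<close>

context cech_ring
begin

lemma cochain_common_level:
  assumes "x \<in> carrier (cech_module R gs p (shift R a))" "y \<in> carrier (cech_module R gs p (shift R a))"
  shows "\<exists>N m m'. x = cochain p N m \<and> y = cochain p N m'"
proof -
  obtain N m N' m' where "x = cochain p N m" "y = cochain p N' m'"
    using assms[THEN carrier_cech_cochain] by blast
  then have "x = cochain p (N + N') (\<lambda>I. prod_power g N' I * m I)" "y = cochain p (N + N') (\<lambda>I. prod_power g N I * m' I)"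
    using cochain_raise[of p N m N'] cochain_raise[of p N' m' N] by (simp_all add: add.commute)
  then show ?thesis by blast
qed

lemma module_map_cech_differential:
  "module_map R (cech_module R gs p (shift R a)) (cech_module R gs (Suc p) (shift R a))
    (cech_differential R gs p (shift R a))"
proof (intro module_map.intro module_cech module_map_axioms.intro)
  fix x y assume "x \<in> carrier (cech_module R gs p (shift R a))" "y \<in> carrier (cech_module R gs p (shift R a))"
  then obtain N m m' where xy: "x = cochain p N m" "y = cochain p N m'" using cochain_common_level by blast
  show "cech_differential R gs p (shift R a) (x \<oplus>\<^bsub>cech_module R gs p (shift R a)\<^esub> y) =
    cech_differential R gs p (shift R a) x \<oplus>\<^bsub>cech_module R gs (Suc p) (shift R a)\<^esub>
      cech_differential R gs p (shift R a) y"
    unfolding xy add_cochain cech_differential_cochain by (rule cochain_cong) (rule cech_level_add)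
next
  fix r x assume "x \<in> carrier (cech_module R gs p (shift R a))"
  then obtain N m where x: "x = cochain p N m" using carrier_cech_cochain by blast
  show "cech_differential R gs p (shift R a) x \<in> carrier (cech_module R gs (Suc p) (shift R a))"
    unfolding x cech_differential_cochain by (rule cochain_in_carrier)
  show "cech_differential R gs p (shift R a) (r \<odot>\<^bsub>cech_module R gs p (shift R a)\<^esub> x) =
      r \<odot>\<^bsub>cech_module R gs (Suc p) (shift R a)\<^esub> cech_differential R gs p (shift R a) x"
    unfolding x smult_cochain cech_differential_cochain by (rule cochain_cong) (rule cech_level_scale)
qed

definition boundaries :: "nat \<Rightarrow> (nat set \<Rightarrow> ('a \<times> 'a) set) set"
  where "boundaries p = {cochain (Suc p) N (cech_level g N w) | N w. True}"

lemma cech_boundaries_eq: "cech_boundaries R gs (Suc p) (shift R a) = boundaries p"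
proof -
  have "carrier (cech_module R gs p (shift R a)) = {cochain p N m | N m. True}"
    using carrier_cech_cochain cochain_in_carrier by fast
  moreover have "h ` {cochain p N m | N m. True} = {h (cochain p N m) | N m. True}" for h :: "_ \<Rightarrow> nat set \<Rightarrow> ('a \<times> 'a) set"
    by blast
  ultimately show ?thesis
    by (simp add: cech_boundaries_def boundaries_def cech_differential_cochain)
qed

lemma boundaries_image:
  "boundaries p = cech_differential R gs p (shift R a) ` carrier (cech_module R gs p (shift R a))"
  using cech_boundaries_eq[of p a] by (simp add: cech_boundaries_def)

lemma add_cech_shift: "add (cech_module R gs p (shift R a)) = add (cech_module R gs p (shift R 0))"
  by (simp add: cech_module_def dsum_def localization_def fraction_def)

definition cocycles :: "int \<times> int \<Rightarrow> nat \<Rightarrow> ('a, nat set \<Rightarrow> ('a \<times> 'a) set) bigraded_module"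
  where "cocycles a p = kernel_module (cech_module R gs p (shift R a))
    (cech_differential R gs p (shift R a)) (cech_module R gs (Suc p) (shift R a))"

lemma local_cohomology_eq:
  "local_cohomology R gs (Suc p) (shift R a) = quotient_module (cocycles a (Suc p)) (boundaries p)"
  by (simp add: local_cohomology_def cocycles_def cech_boundaries_eq One_nat_def)

lemma submodule_pair_cech: "submodule_pair R (cech_module R gs (Suc p) (shift R a)) (boundaries p)"
  unfolding boundaries_image[of p a]
  by (intro submodule_pair.intro module_cech module_map.submodule_image module_map_cech_differential)

text \<open>
  The class of the cochain with numerators \<open>z\<close> at level \<open>N\<close>. Cochains and their addition are the same
  for all twists of \<open>R\<close>, so the untwisted ring represents them all; only the grading depends on the twist.
\<close>
definition cohomology_class :: "nat \<Rightarrow> nat \<Rightarrow> (nat set \<Rightarrow> 'a) \<Rightarrow> (nat set \<Rightarrow> ('a \<times> 'a) set) set"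
  where "cohomology_class p N z = boundaries p +>\<^bsub>cech_module R gs (Suc p) (shift R 0)\<^esub> cochain (Suc p) N z"

lemma cohomology_class_eq: "boundaries p +>\<^bsub>cech_module R gs (Suc p) (shift R a)\<^esub> cochain (Suc p) N z = cohomology_class p N z"
  by (simp add: cohomology_class_def a_r_coset_def' add_cech_shift[of _ a])

lemma cohomology_class_cocycles_eq: "boundaries p +>\<^bsub>cocycles a (Suc p)\<^esub> cochain (Suc p) N z = cohomology_class p N z"
  by (simp add: cohomology_class_def a_r_coset_def' add_cech_shift[of _ a] cocycles_def)

text \<open>The differential of the cochain vanishes in the localizations, that is, at a higher level.\<close>
definition represents_cocycle :: "nat \<Rightarrow> nat \<Rightarrow> (nat set \<Rightarrow> 'a) \<Rightarrow> bool"
  where "represents_cocycle p N z \<longleftrightarrow> (\<exists>K. \<forall>J\<in>subsets_of_size n (Suc p). prod_power g K J * cech_level g N z J = 0)"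

lemma cochain_in_cocycles: "cochain p N z \<in> carrier (cocycles a p) \<longleftrightarrow> represents_cocycle p N z"
  by (simp add: cocycles_def cochain_in_carrier cech_differential_cochain zero_cochain[of _ _ N] cochain_eq_iff
      represents_cocycle_def)

lemma carrier_local_cohomology:
  "carrier (local_cohomology R gs (Suc p) (shift R a)) = {cohomology_class p N z | N z. represents_cocycle (Suc p) N z}"
proof -
  have "carrier (cocycles a (Suc p)) = {cochain (Suc p) N z | N z. represents_cocycle (Suc p) N z}"
  proof (intro equalityI subsetI)
    fix x assume x: "x \<in> carrier (cocycles a (Suc p))"
    then have "x \<in> carrier (cech_module R gs (Suc p) (shift R a))" by (simp add: cocycles_def)
    then obtain N z where "x = cochain (Suc p) N z" using carrier_cech_cochain by blast
    then show "x \<in> {cochain (Suc p) N z | N z. represents_cocycle (Suc p) N z}"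
      using x cochain_in_cocycles by blast
  qed (auto simp: cochain_in_cocycles)
  moreover have "h ` {cochain (Suc p) N z | N z. represents_cocycle (Suc p) N z} =
      {h (cochain (Suc p) N z) | N z. represents_cocycle (Suc p) N z}"
    for h :: "_ \<Rightarrow> (nat set \<Rightarrow> ('a \<times> 'a) set) set"
    by blast
  ultimately show ?thesis
    by (simp add: local_cohomology_eq quotient_module_simps cohomology_class_cocycles_eq)
qed

lemma cohomology_class_raise: "cohomology_class p N z = cohomology_class p (N + M) (\<lambda>I. prod_power g M I * z I)"
  by (simp only: cohomology_class_def cochain_raise[of "Suc p" N z M])

text \<open>
  If the cochains differ by a boundary \<open>d w\<close> with \<open>w\<close> of some level \<open>K\<close>, the three cochains are raised to a
  common level at which their numerators satisfy the equation.
\<close>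
lemma cohomology_class_eq_iff:
  "cohomology_class p N z = cohomology_class p N z' \<longleftrightarrow>
    (\<exists>M w. \<forall>J\<in>subsets_of_size n (Suc p). prod_power g M J * (z J - z' J) = cech_level g (N + M) w J)"
proof -
  interpret submodule_pair R "cech_module R gs (Suc p) (shift R 0)" "boundaries p"
    by (rule submodule_pair_cech)
  have "cohomology_class p N z = cohomology_class p N z' \<longleftrightarrow> (\<exists>h\<in>boundaries p. cochain (Suc p) N z =
      h \<oplus>\<^bsub>cech_module R gs (Suc p) (shift R 0)\<^esub> cochain (Suc p) N z')"
    unfolding cohomology_class_def by (intro coset_eq_iff cochain_in_carrier)
  also have "\<dots> \<longleftrightarrow> (\<exists>M w. \<forall>J\<in>subsets_of_size n (Suc p). prod_power g M J * (z J - z' J) = cech_level g (N + M) w J)"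
  proof
    assume "\<exists>h\<in>boundaries p. cochain (Suc p) N z =
      h \<oplus>\<^bsub>cech_module R gs (Suc p) (shift R 0)\<^esub> cochain (Suc p) N z'"
    then obtain K w where "cochain (Suc p) N z = cochain (Suc p) K (cech_level g K w)
        \<oplus>\<^bsub>cech_module R gs (Suc p) (shift R 0)\<^esub> cochain (Suc p) N z'"
      by (auto simp: boundaries_def)
    then have "cochain (Suc p) (K + N) (\<lambda>J. prod_power g K J * z J) =
        cochain (Suc p) (K + N) (\<lambda>J. prod_power g N J * cech_level g K w J + prod_power g K J * z' J)"
      unfolding cochain_raise[of "Suc p" K _ N] cochain_raise[of "Suc p" N _ K] add.commute[of N K] add_cochain .
    then obtain L where L: "\<forall>J\<in>subsets_of_size n (Suc p). prod_power g L J * (prod_power g K J * z J) =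
        prod_power g L J * (prod_power g N J * cech_level g K w J + prod_power g K J * z' J)"
      unfolding cochain_eq_iff by blast
    have "prod_power g (L + K) J * (z J - z' J) = cech_level g (N + (L + K)) (\<lambda>I. prod_power g (L + N) I * w I) J"
      if J: "J \<in> subsets_of_size n (Suc p)" for J
    proof -
      have "prod_power g (L + K) J * (z J - z' J) = prod_power g L J * (prod_power g K J * z J) - prod_power g L J * (prod_power g K J * z' J)"
        by (simp add: prod_power_add algebra_simps)
      also have "\<dots> = prod_power g (L + N) J * cech_level g K w J"
        using L J by (simp add: prod_power_add algebra_simps)
      also have "\<dots> = cech_level g (K + (L + N)) (\<lambda>I. prod_power g (L + N) I * w I) J"
        by (rule cech_level_raise[symmetric, OF subsets_of_size_finite[OF J]])
      finally show ?thesis by (simp only: ac_simps)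
    qed
    then show "\<exists>M w. \<forall>J\<in>subsets_of_size n (Suc p). prod_power g M J * (z J - z' J) = cech_level g (N + M) w J"
      by blast
  next
    assume "\<exists>M w. \<forall>J\<in>subsets_of_size n (Suc p). prod_power g M J * (z J - z' J) = cech_level g (N + M) w J"
    then obtain M w where w: "\<And>J. J \<in> subsets_of_size n (Suc p) \<Longrightarrow>
        prod_power g M J * (z J - z' J) = cech_level g (N + M) w J" by blast
    have "cochain (Suc p) N z = cochain (Suc p) (N + M) (\<lambda>J. cech_level g (N + M) w J + prod_power g M J * z' J)"
      unfolding cochain_raise[of "Suc p" N z M]
      by (rule cochain_cong) (simp flip: w, simp add: algebra_simps)
    also have "\<dots> = cochain (Suc p) (N + M) (cech_level g (N + M) w)
        \<oplus>\<^bsub>cech_module R gs (Suc p) (shift R 0)\<^esub> cochain (Suc p) N z'"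
      unfolding cochain_raise[of "Suc p" N z' M] add_cochain ..
    finally show "\<exists>h\<in>boundaries p. cochain (Suc p) N z =
        h \<oplus>\<^bsub>cech_module R gs (Suc p) (shift R 0)\<^esub> cochain (Suc p) N z'"
      unfolding boundaries_def by blast
  qed
  finally show ?thesis .
qed

lemma zero_local_cohomology: "\<zero>\<^bsub>local_cohomology R gs (Suc p) (shift R a)\<^esub> = cohomology_class p N (\<lambda>_. 0)"
proof -
  interpret submodule_pair R "cech_module R gs (Suc p) (shift R 0)" "boundaries p"
    by (rule submodule_pair_cech)
  show ?thesis
    unfolding local_cohomology_eq quotient_module_simps cohomology_class_def zero_cochain[of "Suc p" 0 N, symmetric]
    by (rule coset_zero[symmetric])
qed

lemma add_local_cohomology:
  "cohomology_class p N z \<oplus>\<^bsub>local_cohomology R gs (Suc p) (shift R a)\<^esub> cohomology_class p N z' = cohomology_class p N (\<lambda>J. z J + z' J)"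
proof -
  interpret submodule_pair R "cech_module R gs (Suc p) (shift R a)" "boundaries p"
    by (rule submodule_pair_cech)
  have "set_add (cocycles a (Suc p)) = set_add (cech_module R gs (Suc p) (shift R a))"
    by (simp add: set_add_def' cocycles_def fun_eq_iff)
  then show ?thesis
    unfolding local_cohomology_eq quotient_module_simps cohomology_class_eq[of p a, symmetric]
    by (simp add: coset_add cochain_in_carrier add_cochain)
qed

lemma smult_local_cohomology:
  "r \<odot>\<^bsub>local_cohomology R gs (Suc p) (shift R a)\<^esub> cohomology_class p N z = cohomology_class p N (\<lambda>J. r * z J)"
proof -
  interpret submodule_pair R "cech_module R gs (Suc p) (shift R a)" "boundaries p"
    by (rule submodule_pair_cech)
  have "boundaries p +>\<^bsub>cocycles a (Suc p)\<^esub> x = boundaries p +>\<^bsub>cech_module R gs (Suc p) (shift R a)\<^esub> x" for x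
    by (simp add: a_r_coset_def' cocycles_def)
  moreover have "smult (cocycles a (Suc p)) = smult (cech_module R gs (Suc p) (shift R a))"
    by (simp add: cocycles_def)
  ultimately show ?thesis
    unfolding local_cohomology_eq quotient_module_simps cohomology_class_eq[of p a, symmetric]
    by (simp add: coset_smult cochain_in_carrier smult_cochain)
qed

lemma local_cohomology_map_cohomology_class:
  "local_cohomology_map R gs (Suc p) (shift R a) (\<lambda>x. c * x) (cohomology_class p N z) = cohomology_class p N (\<lambda>J. c * z J)"
proof -
  interpret submodule_pair R "cech_module R gs (Suc p) (shift R a)" "boundaries p"
    by (rule submodule_pair_cech)
  have map: "(\<lambda>I\<in>subsets_of_size n (Suc p). localization_map R (S I) (shift R a) (\<lambda>x. c * x) (cochain (Suc p) K m I))
      = cochain (Suc p) K (\<lambda>J. c * m J)" for K m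
    unfolding cochain_def by (rule restrict_ext)
      (simp add: localization_map_level_fraction prod_power_in_S subsets_of_size_finite)
  show ?thesis
    unfolding local_cohomology_map_def cech_boundaries_eq cohomology_class_eq[of p a, symmetric]
  proof (rule coset_UN[OF cochain_in_carrier])
    fix h assume "h \<in> boundaries p"
    then obtain K w where h: "h = cochain (Suc p) K (cech_level g K w)" by (auto simp: boundaries_def)
    have "h \<oplus>\<^bsub>cech_module R gs (Suc p) (shift R a)\<^esub> cochain (Suc p) N z =
        cochain (Suc p) (K + N) (\<lambda>J. prod_power g N J * cech_level g K w J + prod_power g K J * z J)"
      unfolding h cochain_raise[of "Suc p" K _ N] cochain_raise[of "Suc p" N _ K] add.commute[of N K] add_cochain ..
    then have "(\<lambda>I\<in>subsets_of_size n (Suc p). localization_map R (S I) (shift R a) (\<lambda>x. c * x)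
          ((h \<oplus>\<^bsub>cech_module R gs (Suc p) (shift R a)\<^esub> cochain (Suc p) N z) I)) =
        cochain (Suc p) (K + N) (\<lambda>J. c * (prod_power g N J * cech_level g K w J + prod_power g K J * z J))"
      by (simp only: map)
    also have "\<dots> = cochain (Suc p) (K + N) (\<lambda>J. prod_power g N J * cech_level g K (\<lambda>I. c * w I) J + prod_power g K J * (c * z J))"
      by (rule cochain_cong) (simp add: cech_level_scale algebra_simps)
    also have "\<dots> = cochain (Suc p) K (cech_level g K (\<lambda>I. c * w I))
        \<oplus>\<^bsub>cech_module R gs (Suc p) (shift R a)\<^esub> cochain (Suc p) N (\<lambda>J. c * z J)"
      unfolding cochain_raise[of "Suc p" K _ N] cochain_raise[of "Suc p" N _ K] add.commute[of N K] add_cochain ..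
    finally have eq: "(\<lambda>I\<in>subsets_of_size n (Suc p). localization_map R (S I) (shift R a) (\<lambda>x. c * x)
          ((h \<oplus>\<^bsub>cech_module R gs (Suc p) (shift R a)\<^esub> cochain (Suc p) N z) I)) =
        cochain (Suc p) K (cech_level g K (\<lambda>I. c * w I))
        \<oplus>\<^bsub>cech_module R gs (Suc p) (shift R a)\<^esub> cochain (Suc p) N (\<lambda>J. c * z J)" .
    have b: "cochain (Suc p) K (cech_level g K (\<lambda>I. c * w I)) \<in> boundaries p" by (auto simp: boundaries_def)
    show "boundaries p +>\<^bsub>cech_module R gs (Suc p) (shift R a)\<^esub>
        (\<lambda>I\<in>subsets_of_size n (Suc p). localization_map R (S I) (shift R a) (\<lambda>x. c * x)
          ((h \<oplus>\<^bsub>cech_module R gs (Suc p) (shift R a)\<^esub> cochain (Suc p) N z) I)) =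
        boundaries p +>\<^bsub>cech_module R gs (Suc p) (shift R a)\<^esub> cochain (Suc p) N (\<lambda>J. c * z J)"
      unfolding eq
      by (subst coset_eq_iff) (use b in \<open>auto intro!: cochain_in_carrier M.a_closed\<close>)
  qed
qed

end

section \<open>Homogeneous cochains\<close>

lemma multiple_0 [simp]: "multiple 0 a = 0"
  by (simp add: multiple_def zero_prod_def)

lemma multiple_add: "multiple (k + l) a = multiple k a + multiple l a"
  by (simp add: multiple_def plus_prod_def algebra_simps)

lemma multiple_1 [simp]: "multiple 1 a = a"
  by (simp add: multiple_def)

text \<open>\<open>component a\<close> is the projection onto the homogeneous elements of degree \<open>a\<close>.\<close>
locale graded_ring = ring_record R for R :: "('a::comm_ring_1, 'a) bigraded_module" +
  fixes component :: "int \<times> int \<Rightarrow> 'a \<Rightarrow> 'a"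
  assumes component_add: "component a (x + y) = component a x + component a y"
    and component_component: "component a (component b x) = (if a = b then component b x else 0)"
    and piece_iff: "x \<in> piece R a \<longleftrightarrow> component a x = x"
    and component_mult: "x \<in> piece R a \<Longrightarrow> component (a + b) (x * y) = x * component b y"
    and one_piece: "1 \<in> piece R 0"
begin

lemma component_zero [simp]: "component a 0 = 0"
  using component_add[of a 0 0] by simp

lemma component_uminus: "component a (- x) = - component a x"
  using component_add[of a x "- x"] by (simp add: eq_neg_iff_add_eq_0 add.commute)

lemma component_diff: "component a (x - y) = component a x - component a y"
  using component_add[of a x "- y"] by (simp add: component_uminus)

lemma component_sum: "component a (sum h I) = (\<Sum>i\<in>I. component a (h i))"
  by (induction I rule: infinite_finite_induct) (simp_all add: component_add)

lemma component_sign: "component a ((- 1) ^ k * x) = (- 1) ^ k * component a x"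
  by (induction k) (simp_all add: component_uminus)

lemma component_in_piece: "component a x \<in> piece R a"
  by (simp add: piece_iff component_component)

lemma zero_piece: "0 \<in> piece R a"
  by (simp add: piece_iff)

lemma piece_mult: "x \<in> piece R a \<Longrightarrow> y \<in> piece R b \<Longrightarrow> x * y \<in> piece R (a + b)"
  using component_mult[of x a b y] by (simp add: piece_iff)

lemma piece_power: "x \<in> piece R a \<Longrightarrow> x ^ k \<in> piece R (multiple (int k) a)"
proof (induction k)
  case (Suc k)
  then show ?case using piece_mult[of x a "x ^ k"] by (simp add: multiple_add)
qed (simp add: one_piece)

lemma piece_prod: "(\<And>i. i \<in> I \<Longrightarrow> x i \<in> piece R (a i)) \<Longrightarrow> prod x I \<in> piece R (sum a I)"
  by (induction I rule: infinite_finite_induct) (simp_all add: one_piece piece_mult)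

lemma piece_disjoint: "x \<in> piece R a \<Longrightarrow> x \<in> piece R b \<Longrightarrow> a \<noteq> b \<Longrightarrow> x = 0"
  using component_component[of a b x] by (simp add: piece_iff)

end

locale graded_cech = graded_ring R component + cech_ring R gs
  for R :: "('a::comm_ring_1, 'a) bigraded_module" and component gs +
  fixes dg :: "nat \<Rightarrow> int \<times> int"
  assumes g_piece: "i < length gs \<Longrightarrow> gs ! i \<in> piece R (dg i)"
begin

text \<open>The degree of \<open>g\<^sub>I\<^sup>N\<close>.\<close>
definition deg :: "nat \<Rightarrow> nat set \<Rightarrow> int \<times> int"
  where "deg N I = (\<Sum>i\<in>I. multiple (int N) (dg i))"

lemma deg_singleton [simp]: "deg N {i} = multiple (int N) (dg i)"
  by (simp add: deg_def)

lemma deg_remove: "finite J \<Longrightarrow> j \<in> J \<Longrightarrow> deg N J = multiple (int N) (dg j) + deg N (J - {j})"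
  unfolding deg_def by (rule sum.remove)

lemma deg_add: "deg (M + N) I = deg M I + deg N I"
  by (simp add: deg_def multiple_add sum.distrib)

lemma g_power_piece: "i < n \<Longrightarrow> g i ^ N \<in> piece R (multiple (int N) (dg i))"
  by (intro piece_power g_piece)

lemma prod_power_piece: "I \<subseteq> {..<n} \<Longrightarrow> prod_power g N I \<in> piece R (deg N I)"
  unfolding prod_power_def deg_def by (rule piece_prod) (auto intro: g_power_piece)

lemma component_cech_level:
  assumes "J \<in> subsets_of_size n p"
  shows "component (a + deg N J) (cech_level g N m J) = cech_level g N (\<lambda>I. component (a + deg N I) (m I)) J"
  unfolding cech_level_def component_sum
proof (rule sum.cong[OF refl])
  fix j assume j: "j \<in> J"
  have "a + deg N J = multiple (int N) (dg j) + (a + deg N (J - {j}))"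
    by (simp add: deg_remove[OF subsets_of_size_finite[OF assms] j])
  moreover have "g j ^ N \<in> piece R (multiple (int N) (dg j))"
    using assms j by (intro g_power_piece) (auto simp: subsets_of_size_def)
  ultimately show "component (a + deg N J) ((- 1) ^ card {i \<in> J. i < j} * (g j ^ N * m (J - {j}))) =
      (- 1) ^ card {i \<in> J. i < j} * (g j ^ N * component (a + deg N (J - {j})) (m (J - {j})))"
    by (simp only: component_sign component_mult)
qed

text \<open>
  The denominator \<open>s\<close> of a homogeneous fraction is a monomial in the \<open>g\<^sub>i\<close>, so extending it to \<open>g\<^sub>I\<^sup>N\<close>
  multiplies the numerator by a homogeneous element.
\<close>
lemma piece_localization:
  assumes I: "I \<subseteq> {..<n}" and x: "x \<in> piece (localization R (S I) (shift R a)) e"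
  shows "\<exists>N. \<forall>N'\<ge>N. \<exists>m\<in>piece R (a + e + deg N' I). x = level_fraction I m (prod_power g N' I)"
proof -
  have fin: "finite I" using I finite_subset by auto
  interpret localization_at R "S I" by (rule localization_at_S[OF fin])
  obtain m s e' where m: "x = frac m s" "s \<in> S I" "s \<in> piece R e'" "m \<in> piece R (a + (e + e'))"
    using x by (auto simp: localization_def)
  then obtain b where s: "s = (\<Prod>i\<in>I. g i ^ b i)" unfolding S_eq[OF fin] by auto
  have gi: "g i ^ k \<in> piece R (multiple (int k) (dg i))" if "i \<in> I" for i k
    using I that by (intro g_power_piece) auto
  have "\<exists>m'\<in>piece R (a + e + deg N I). x = level_fraction I m' (prod_power g N I)" if N: "N \<ge> (\<Sum>i\<in>I. b i)" for N
  proof -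
    define s' where "s' = (\<Prod>i\<in>I. g i ^ (N - b i))"
    have le: "b i \<le> N" if "i \<in> I" for i
      using member_le_sum[OF that, of b] fin N by simp
    have gN: "prod_power g N I = s * s'"
      unfolding prod_power_def s s'_def prod.distrib[symmetric] power_add[symmetric]
      by (rule prod.cong[OF refl]) (use le in simp)
    show ?thesis
    proof (cases "e' = (\<Sum>i\<in>I. multiple (int (b i)) (dg i))")
      case True
      have s': "s' \<in> piece R (\<Sum>i\<in>I. multiple (int (N - b i)) (dg i))"
        unfolding s'_def by (rule piece_prod) (rule gi)
      have "e' + (\<Sum>i\<in>I. multiple (int (N - b i)) (dg i)) = deg N I"
        unfolding True deg_def sum.distrib[symmetric] multiple_add[symmetric]
        by (rule sum.cong[OF refl]) (use le in \<open>simp add: of_nat_diff\<close>)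
      then have eq: "a + e + deg N I = (\<Sum>i\<in>I. multiple (int (N - b i)) (dg i)) + (a + (e + e'))"
        by (simp add: ac_simps flip: \<open>_ = deg N I\<close>)
      have "s' * m \<in> piece R (a + e + deg N I)"
        unfolding eq by (rule piece_mult[OF s' m(4)])
      moreover have "x = level_fraction I (s' * m) (prod_power g N I)"
        unfolding m(1) level_fraction_def
        by (intro frac_eqI[OF m(2) prod_power_in_S[OF fin] one_S]) (simp add: gN mult.assoc)
      ultimately show ?thesis by blast
    next
      (* The degree e' of s can differ from the one read off from the exponents only if s = 0;
         then the localization is zero. *)
      case False
      have "s \<in> piece R (\<Sum>i\<in>I. multiple (int (b i)) (dg i))"
        unfolding s by (rule piece_prod) (rule gi)
      then have "s = 0" using piece_disjoint[OF m(3)] False by blast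
      then have "x = level_fraction I 0 (prod_power g N I)"
        unfolding m(1) level_fraction_def
        by (intro frac_eqI[OF m(2) prod_power_in_S[OF fin] m(2)]) simp
      then show ?thesis using zero_piece by blast
    qed
  qed
  then show ?thesis by blast
qed

lemma level_fraction_in_piece:
  assumes "I \<subseteq> {..<n}" "m \<in> piece R (a + e + deg N I)"
  shows "level_fraction I m (prod_power g N I) \<in> piece (localization R (S I) (shift R a)) e"
proof -
  have fin: "finite I" using assms finite_subset by auto
  interpret localization_at R "S I" by (rule localization_at_S[OF fin])
  have "piece (localization R (S I) (shift R a)) e =
      {frac m s | m s e'. s \<in> S I \<and> s \<in> piece R e' \<and> m \<in> piece R (a + (e + e'))}"
    by (simp add: localization_def)
  moreover have "m \<in> piece R (a + (e + deg N I))"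
    using assms(2) by (simp only: add.assoc)
  ultimately show ?thesis
    using prod_power_piece[OF assms(1), of N] prod_power_in_S[OF fin, of N] unfolding level_fraction_def by blast
qed

definition homogeneous :: "nat \<Rightarrow> int \<times> int \<Rightarrow> nat \<Rightarrow> (nat set \<Rightarrow> 'a) \<Rightarrow> bool"
  where "homogeneous p a N m \<longleftrightarrow> (\<forall>I\<in>subsets_of_size n p. m I \<in> piece R (a + deg N I))"

lemma piece_cech:
  "piece (cech_module R gs p (shift R a)) e = {cochain p N m | N m. homogeneous p (a + e) N m}"
proof (intro equalityI subsetI)
  fix x assume "x \<in> piece (cech_module R gs p (shift R a)) e"
  then have x: "x \<in> (\<Pi>\<^sub>E I\<in>subsets_of_size n p. piece (localization R (S I) (shift R a)) e)"
    by (simp add: cech_module_def dsum_def)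
  have "\<exists>N. \<forall>I\<in>subsets_of_size n p. \<exists>m\<in>piece R (a + e + deg N I). x I = level_fraction I m (prod_power g N I)"
    by (intro eventually_level piece_localization) (use x in \<open>auto simp: subsets_of_size_def\<close>)
  then obtain N where "\<forall>I\<in>subsets_of_size n p. \<exists>m. m \<in> piece R (a + e + deg N I) \<and> x I = level_fraction I m (prod_power g N I)"
    by blast
  from bchoice[OF this] obtain m where
    m: "\<forall>I\<in>subsets_of_size n p. m I \<in> piece R (a + e + deg N I) \<and> x I = level_fraction I (m I) (prod_power g N I)"
    by blast
  have "x = cochain p N m"
  proof
    fix I show "x I = cochain p N m I"
      using m PiE_arb[OF x] by (cases "I \<in> subsets_of_size n p") (auto simp: cochain_def)
  qed
  then show "x \<in> {cochain p N m | N m. homogeneous p (a + e) N m}"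
    using m by (auto simp: homogeneous_def)
next
  fix x assume "x \<in> {cochain p N m | N m. homogeneous p (a + e) N m}"
  then obtain N m where x: "x = cochain p N m" and m: "homogeneous p (a + e) N m" by blast
  have "level_fraction I (m I) (prod_power g N I) \<in> piece (localization R (S I) (shift R a)) e"
    if "I \<in> subsets_of_size n p" for I
    using that m by (intro level_fraction_in_piece) (auto simp: homogeneous_def subsets_of_size_def)
  then show "x \<in> piece (cech_module R gs p (shift R a)) e"
    by (auto simp: x cochain_def cech_module_def dsum_def)
qed

lemma piece_local_cohomology:
  "piece (local_cohomology R gs (Suc p) (shift R a)) e =
    {cohomology_class p N z | N z. represents_cocycle (Suc p) N z \<and> homogeneous (Suc p) (a + e) N z}"
proof -
  have "x \<in> piece (cocycles a (Suc p)) e \<longleftrightarrow>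
      (\<exists>N z. x = cochain (Suc p) N z \<and> represents_cocycle (Suc p) N z \<and> homogeneous (Suc p) (a + e) N z)" for x
  proof -
    have "x \<in> piece (cocycles a (Suc p)) e \<longleftrightarrow>
        (\<exists>N z. x = cochain (Suc p) N z \<and> homogeneous (Suc p) (a + e) N z) \<and> x \<in> carrier (cocycles a (Suc p))"
      by (auto simp: cocycles_def piece_cech cochain_in_carrier)
    then show ?thesis using cochain_in_cocycles by blast
  qed
  then have "piece (cocycles a (Suc p)) e =
      {cochain (Suc p) N z | N z. represents_cocycle (Suc p) N z \<and> homogeneous (Suc p) (a + e) N z}"
    by blast
  moreover have "h ` {cochain (Suc p) N z | N z. represents_cocycle (Suc p) N z \<and> homogeneous (Suc p) (a + e) N z} =
      {h (cochain (Suc p) N z) | N z. represents_cocycle (Suc p) N z \<and> homogeneous (Suc p) (a + e) N z}"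
    for h :: "_ \<Rightarrow> (nat set \<Rightarrow> ('a \<times> 'a) set) set"
    by blast
  ultimately show ?thesis
    by (simp add: local_cohomology_eq quotient_module_simps cohomology_class_cocycles_eq)
qed

end

section \<open>The Koszul complex of three forms\<close>

context ring_record
begin

lemma module_koszul: "module R (koszul_module R d k p)"
  unfolding koszul_module_def by (intro module_dsum cring_R module_shift)

lemma koszul_module_simps:
  "carrier (koszul_module R d k p) = (\<Pi>\<^sub>E I\<in>subsets_of_size k p. UNIV)"
  "x \<oplus>\<^bsub>koszul_module R d k p\<^esub> y = (\<lambda>I\<in>subsets_of_size k p. x I + y I)"
  "r \<odot>\<^bsub>koszul_module R d k p\<^esub> x = (\<lambda>I\<in>subsets_of_size k p. r * x I)"
  "\<zero>\<^bsub>koszul_module R d k p\<^esub> = (\<lambda>I\<in>subsets_of_size k p. 0)"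
  "piece (koszul_module R d k p) e = (\<Pi>\<^sub>E I\<in>subsets_of_size k p. piece R (multiple (- int p) d + e))"
  by (simp_all add: koszul_module_def dsum_def)

lemma koszul_differential_eq:
  "koszul_differential R f k (Suc p) c = (\<lambda>J\<in>subsets_of_size k p.
    \<Sum>i\<in>{..<k} - J. (- 1) ^ card {j \<in> insert i J. j \<le> i} * f i * c (insert i J))"
  by (simp add: koszul_differential_def)

lemma insert_in_subsets_of_size:
  "J \<in> subsets_of_size k p \<Longrightarrow> i \<in> {..<k} - J \<Longrightarrow> insert i J \<in> subsets_of_size k (Suc p)"
  by (auto simp: subsets_of_size_def finite_subset)

lemma module_map_koszul:
  "module_map R (koszul_module R d k (Suc p)) (koszul_module R d k p) (koszul_differential R f k (Suc p))"
proof (intro module_map.intro module_koszul module_map_axioms.intro)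
  fix x y :: "nat set \<Rightarrow> 'a" and r :: 'a
  show "koszul_differential R f k (Suc p) x \<in> carrier (koszul_module R d k p)"
    by (simp add: koszul_differential_eq koszul_module_simps)
  show "koszul_differential R f k (Suc p) (x \<oplus>\<^bsub>koszul_module R d k (Suc p)\<^esub> y) =
      koszul_differential R f k (Suc p) x \<oplus>\<^bsub>koszul_module R d k p\<^esub> koszul_differential R f k (Suc p) y"
    unfolding koszul_differential_eq koszul_module_simps
  proof (rule restrict_ext)
    fix J assume J: "J \<in> subsets_of_size k p"
    show "(\<Sum>i\<in>{..<k} - J. (- 1) ^ card {j \<in> insert i J. j \<le> i} * f i *
        (\<lambda>I\<in>subsets_of_size k (Suc p). x I + y I) (insert i J)) =
      (\<lambda>J\<in>subsets_of_size k p. \<Sum>i\<in>{..<k} - J. (- 1) ^ card {j \<in> insert i J. j \<le> i} * f i * x (insert i J)) J +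
      (\<lambda>J\<in>subsets_of_size k p. \<Sum>i\<in>{..<k} - J. (- 1) ^ card {j \<in> insert i J. j \<le> i} * f i * y (insert i J)) J"
      unfolding restrict_apply'[OF J] sum.distrib[symmetric]
      by (rule sum.cong[OF refl]) (simp only: restrict_apply'[OF insert_in_subsets_of_size[OF J]] distrib_left)
  qed
  show "koszul_differential R f k (Suc p) (r \<odot>\<^bsub>koszul_module R d k (Suc p)\<^esub> x) =
      r \<odot>\<^bsub>koszul_module R d k p\<^esub> koszul_differential R f k (Suc p) x"
    unfolding koszul_differential_eq koszul_module_simps
  proof (rule restrict_ext)
    fix J assume J: "J \<in> subsets_of_size k p"
    show "(\<Sum>i\<in>{..<k} - J. (- 1) ^ card {j \<in> insert i J. j \<le> i} * f i *
        (\<lambda>I\<in>subsets_of_size k (Suc p). r * x I) (insert i J)) =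
      r * (\<lambda>J\<in>subsets_of_size k p. \<Sum>i\<in>{..<k} - J. (- 1) ^ card {j \<in> insert i J. j \<le> i} * f i * x (insert i J)) J"
      unfolding restrict_apply'[OF J] sum_distrib_left
      by (rule sum.cong[OF refl]) (simp only: restrict_apply'[OF insert_in_subsets_of_size[OF J]] ac_simps)
  qed
qed

lemma subsets_of_size_3:
  "subsets_of_size 3 0 = {{}}" "subsets_of_size 3 1 = {{0}, {1}, {2}}"
  "subsets_of_size 3 2 = {{1, 2}, {0, 2}, {0, 1}}"
proof -
  have 3: "{..<3::nat} = {0, 1, 2}" by auto
  show "subsets_of_size 3 0 = {{}}" by (auto simp: subsets_of_size_def finite_subset)
  show "subsets_of_size 3 1 = {{0}, {1}, {2}}"
    unfolding subsets_of_size_1 3 by simp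
  show "subsets_of_size 3 2 = {{1, 2}, {0, 2}, {0, 1}}"
  proof (intro equalityI subsetI)
    fix I assume "I \<in> subsets_of_size 3 2"
    then have I: "I \<subseteq> {0, 1, 2}" "card I = 2" by (auto simp: subsets_of_size_def 3)
    then obtain a b where "I = {a, b}" "a \<noteq> b" by (auto simp: card_2_iff)
    then show "I \<in> {{1, 2}, {0, 2}, {0, 1}}" using I(1) by auto
  qed (auto simp: subsets_of_size_def)
qed

lemma filter_insert:
  "{j \<in> insert a A. P j} = (if P a then insert a {j \<in> A. P j} else {j \<in> A. P j})" "{j \<in> {}. P j} = {}"
  by auto

text \<open>The positions that determine the signs of the Koszul differential.\<close>
lemma koszul_positions:
  "card {j \<in> insert (i::nat) {}. j \<le> i} = 1"
  "card {j \<in> insert (1::nat) {0}. j \<le> 1} = 2" "card {j \<in> insert (2::nat) {0}. j \<le> 2} = 2"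
  "card {j \<in> insert (0::nat) {1}. j \<le> 0} = 1" "card {j \<in> insert (2::nat) {1}. j \<le> 2} = 2"
  "card {j \<in> insert (0::nat) {2}. j \<le> 0} = 1" "card {j \<in> insert (1::nat) {2}. j \<le> 1} = 1"
  "card {j \<in> insert (0::nat) {1, 2}. j \<le> 0} = 1" "card {j \<in> insert (1::nat) {0, 2}. j \<le> 1} = 2"
  "card {j \<in> insert (2::nat) {0, 1}. j \<le> 2} = 3"
  by (simp_all only: filter_insert) simp_all

lemma koszul_complements:
  "{..<3::nat} - {} = {0, 1, 2}" "{..<3::nat} - {0} = {1, 2}" "{..<3::nat} - {1} = {0, 2}"
  "{..<3::nat} - {2} = {0, 1}" "{..<3::nat} - {1, 2} = {0}" "{..<3::nat} - {0, 2} = {1}"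
  "{..<3::nat} - {0, 1} = {2}"
  by auto

lemma koszul_sums:
  fixes h :: "nat \<Rightarrow> 'a"
  shows "sum h {0, 1, 2} = h 0 + h 1 + h 2" "sum h {1, 2} = h 1 + h 2" "sum h {0, 2} = h 0 + h 2"
    "sum h {0, 1} = h 0 + h 1" "sum h {i} = h i"
  by simp_all

lemma koszul_differential_1:
  "koszul_differential R f 3 1 c = (\<lambda>J\<in>{{}}. - (f 0 * c {0} + f 1 * c {1} + f 2 * c {2}))"
proof -
  have "koszul_differential R f 3 1 c = (\<lambda>J\<in>{{}}. \<Sum>i\<in>{..<3} - J.
      (- 1) ^ card {j \<in> insert i J. j \<le> i} * f i * c (insert i J))"
    using koszul_differential_eq[of f 3 0 c] by (simp only: subsets_of_size_3 One_nat_def)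
  moreover have "(\<Sum>i\<in>{..<3} - {}. (- 1) ^ card {j \<in> insert i {}. j \<le> i} * f i * c (insert i {})) =
      - (f 0 * c {0} + f 1 * c {1} + f 2 * c {2})"
    unfolding koszul_complements koszul_sums koszul_positions by simp
  ultimately show ?thesis by (auto simp only: intro!: restrict_ext)
qed

lemma koszul_differential_2:
  "koszul_differential R f 3 2 c {0} = f 1 * c {0, 1} + f 2 * c {0, 2}"
  "koszul_differential R f 3 2 c {1} = - (f 0 * c {0, 1}) + f 2 * c {1, 2}"
  "koszul_differential R f 3 2 c {2} = - (f 0 * c {0, 2}) - f 1 * c {1, 2}"
proof -
  have eq: "koszul_differential R f 3 2 c J = (\<Sum>i\<in>{..<3} - J.
      (- 1) ^ card {j \<in> insert i J. j \<le> i} * f i * c (insert i J))" if "J \<in> {{0}, {1}, {2}}" for J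
    using koszul_differential_eq[of f 3 1 c, unfolded Suc_1] restrict_apply'[OF that]
    by (simp only: subsets_of_size_3)
  have eqs: "koszul_differential R f 3 2 c {0} = (\<Sum>i\<in>{..<3} - {0}.
      (- 1) ^ card {j \<in> insert i {0}. j \<le> i} * f i * c (insert i {0}))"
    "koszul_differential R f 3 2 c {1} = (\<Sum>i\<in>{..<3} - {1}.
      (- 1) ^ card {j \<in> insert i {1}. j \<le> i} * f i * c (insert i {1}))"
    "koszul_differential R f 3 2 c {2} = (\<Sum>i\<in>{..<3} - {2}.
      (- 1) ^ card {j \<in> insert i {2}. j \<le> i} * f i * c (insert i {2}))"
    by (rule eq, simp)+
  show "koszul_differential R f 3 2 c {0} = f 1 * c {0, 1} + f 2 * c {0, 2}"
    "koszul_differential R f 3 2 c {1} = - (f 0 * c {0, 1}) + f 2 * c {1, 2}"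
    "koszul_differential R f 3 2 c {2} = - (f 0 * c {0, 2}) - f 1 * c {1, 2}"
    unfolding eqs koszul_complements koszul_sums koszul_positions by (simp_all add: insert_commute)
qed

lemma koszul_top_3:
  "koszul_top R f 3 r {1, 2} = - f 0 * r" "koszul_top R f 3 r {0, 2} = f 1 * r"
  "koszul_top R f 3 r {0, 1} = - f 2 * r"
proof -
  let ?c = "\<lambda>I\<in>subsets_of_size 3 3. r"
  have eq: "koszul_top R f 3 r J = (\<Sum>i\<in>{..<3} - J.
      (- 1) ^ card {j \<in> insert i J. j \<le> i} * f i * ?c (insert i J))" if "J \<in> {{1, 2}, {0, 2}, {0, 1}}" for J
  proof -
    have "Suc 2 = 3" by simp
    then show ?thesis
      unfolding koszul_top_def koszul_differential_eq[of f 3 2 ?c, unfolded \<open>Suc 2 = 3\<close>]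
        subsets_of_size_3(3)
      by (intro restrict_apply' that)
  qed
  have top: "?c (insert 0 {1, 2}) = r" "?c (insert 1 {0, 2}) = r" "?c (insert 2 {0, 1}) = r"
    by (auto simp: subsets_of_size_def)
  have eqs: "koszul_top R f 3 r {1, 2} = (\<Sum>i\<in>{..<3} - {1, 2}.
      (- 1) ^ card {j \<in> insert i {1, 2}. j \<le> i} * f i * ?c (insert i {1, 2}))"
    "koszul_top R f 3 r {0, 2} = (\<Sum>i\<in>{..<3} - {0, 2}.
      (- 1) ^ card {j \<in> insert i {0, 2}. j \<le> i} * f i * ?c (insert i {0, 2}))"
    "koszul_top R f 3 r {0, 1} = (\<Sum>i\<in>{..<3} - {0, 1}.
      (- 1) ^ card {j \<in> insert i {0, 1}. j \<le> i} * f i * ?c (insert i {0, 1}))"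
    by (rule eq, simp)+
  show "koszul_top R f 3 r {1, 2} = - f 0 * r" "koszul_top R f 3 r {0, 2} = f 1 * r"
    "koszul_top R f 3 r {0, 1} = - f 2 * r"
    unfolding eqs koszul_complements koszul_sums koszul_positions top by simp_all
qed

text \<open>The element of \<open>K\<^sub>1\<close> with coefficients \<open>x 0\<close>, \<open>x 1\<close>, \<open>x 2\<close>.\<close>
definition koszul_vec :: "(nat \<Rightarrow> 'a) \<Rightarrow> nat set \<Rightarrow> 'a"
  where "koszul_vec x = (\<lambda>I\<in>subsets_of_size 3 1. x (the_elem I))"

lemma koszul_vec_singleton: "k < 3 \<Longrightarrow> koszul_vec x {k} = x k"
  by (simp add: koszul_vec_def)

lemma less_3: "k < 3 \<longleftrightarrow> k = 0 \<or> k = 1 \<or> k = (2::nat)"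
  by auto

lemma koszul_vec_eq_iff: "koszul_vec x = koszul_vec x' \<longleftrightarrow> x 0 = x' 0 \<and> x 1 = x' 1 \<and> x 2 = x' 2"
proof
  assume eq: "koszul_vec x = koszul_vec x'"
  have "x k = x' k" if "k < 3" for k
    using fun_cong[OF eq, of "{k}"] that by (simp add: koszul_vec_singleton)
  then show "x 0 = x' 0 \<and> x 1 = x' 1 \<and> x 2 = x' 2" by simp
next
  assume "x 0 = x' 0 \<and> x 1 = x' 1 \<and> x 2 = x' 2"
  then show "koszul_vec x = koszul_vec x'"
    unfolding koszul_vec_def subsets_of_size_3 by (intro restrict_ext) auto
qed

lemma carrier_koszul_1:
  assumes "c \<in> carrier (koszul_module R d 3 1)"
  shows "c = koszul_vec (\<lambda>k. c {k})"
proof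
  fix I
  show "c I = koszul_vec (\<lambda>k. c {k}) I"
    using assms PiE_arb[of c "subsets_of_size 3 1" "\<lambda>_. UNIV" I]
    by (cases "I \<in> subsets_of_size 3 1") (auto simp: koszul_vec_def koszul_module_simps subsets_of_size_1)
qed

lemma koszul_vec_in_carrier: "koszul_vec x \<in> carrier (koszul_module R d 3 1)"
  by (simp add: koszul_vec_def koszul_module_simps)

lemma add_koszul_vec: "koszul_vec x \<oplus>\<^bsub>koszul_module R d 3 1\<^esub> koszul_vec y = koszul_vec (\<lambda>k. x k + y k)"
  by (auto simp: koszul_module_simps koszul_vec_def intro!: restrict_ext)

lemma smult_koszul_vec: "r \<odot>\<^bsub>koszul_module R d 3 1\<^esub> koszul_vec x = koszul_vec (\<lambda>k. r * x k)"
  by (auto simp: koszul_module_simps koszul_vec_def intro!: restrict_ext)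

lemma piece_koszul_1:
  "koszul_vec x \<in> piece (koszul_module R d 3 1) e \<longleftrightarrow>
    x 0 \<in> piece R (multiple (- 1) d + e) \<and> x 1 \<in> piece R (multiple (- 1) d + e) \<and>
    x 2 \<in> piece R (multiple (- 1) d + e)"
  by (simp add: koszul_module_simps koszul_vec_def PiE_iff subsets_of_size_3)

lemma koszul_cycle_iff:
  "koszul_differential R f 3 1 (koszul_vec x) = \<zero>\<^bsub>koszul_module R d 3 0\<^esub> \<longleftrightarrow>
    f 0 * x 0 + f 1 * x 1 + f 2 * x 2 = 0"
proof -
  have "koszul_differential R f 3 1 (koszul_vec x) = (\<lambda>J\<in>{{}}. - (f 0 * x 0 + f 1 * x 1 + f 2 * x 2))"
    unfolding koszul_differential_1 by (simp add: koszul_vec_singleton)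
  moreover have "(\<lambda>J\<in>{{}::nat set}. a) = (\<lambda>J\<in>{{}}. b) \<longleftrightarrow> a = b" for a b :: 'a
    by (auto dest: fun_cong[of _ _ "{}"])
  ultimately show ?thesis
    unfolding koszul_module_simps subsets_of_size_3 by (simp only: neg_equal_0_iff_equal)
qed

text \<open>\<open>x = \<delta> v\<close>, where \<open>v k\<close> is the coefficient at the basis element of \<open>K\<^sub>2\<close> that omits \<open>k\<close>.\<close>
definition koszul_boundary :: "(nat \<Rightarrow> 'a) \<Rightarrow> (nat \<Rightarrow> 'a) \<Rightarrow> bool"
  where "koszul_boundary f x \<longleftrightarrow> (\<exists>v. x 0 = f 1 * v 2 + f 2 * v 1 \<and> x 1 = - (f 0 * v 2) + f 2 * v 0 \<and>
      x 2 = - (f 0 * v 1) - f 1 * v (0::nat))"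

lemma koszul_differential_2_koszul_vec:
  "koszul_differential R f 3 2 c = koszul_vec (\<lambda>k. if k = 0 then f 1 * c {0, 1} + f 2 * c {0, 2}
    else if k = 1 then - (f 0 * c {0, 1}) + f 2 * c {1, 2} else - (f 0 * c {0, 2}) - f 1 * c {1, 2})"
proof -
  have "koszul_differential R f 3 2 c \<in> carrier (koszul_module R d 3 1)"
    using koszul_differential_eq[of f 3 1 c] by (simp add: koszul_module_simps)
  then have "koszul_differential R f 3 2 c = koszul_vec (\<lambda>k. koszul_differential R f 3 2 c {k})"
    by (rule carrier_koszul_1)
  also have "\<dots> = koszul_vec (\<lambda>k. if k = 0 then f 1 * c {0, 1} + f 2 * c {0, 2}
    else if k = 1 then - (f 0 * c {0, 1}) + f 2 * c {1, 2} else - (f 0 * c {0, 2}) - f 1 * c {1, 2})"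
    by (simp add: koszul_vec_eq_iff koszul_differential_2)
  finally show ?thesis .
qed

lemma koszul_boundaries:
  "koszul_differential R f 3 2 ` carrier (koszul_module R d 3 2) = {koszul_vec x | x. koszul_boundary f x}"
proof (intro equalityI subsetI)
  fix y assume "y \<in> koszul_differential R f 3 2 ` carrier (koszul_module R d 3 2)"
  then obtain c where c: "y = koszul_differential R f 3 2 c" by blast
  define x where "x = (\<lambda>k::nat. if k = 0 then f 1 * c {0, 1} + f 2 * c {0, 2}
      else if k = 1 then - (f 0 * c {0, 1}) + f 2 * c {1, 2} else - (f 0 * c {0, 2}) - f 1 * c {1, 2})"
  have "y = koszul_vec x"
    unfolding c koszul_differential_2_koszul_vec x_def ..
  moreover have "koszul_boundary f x"
  proof -
    define v where "v = (\<lambda>k::nat. if k = 0 then c {1, 2} else if k = 1 then c {0, 2} else c {0, 1})"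
    have "v 0 = c {1, 2}" "v 1 = c {0, 2}" "v 2 = c {0, 1}" "x 0 = f 1 * c {0, 1} + f 2 * c {0, 2}"
      "x 1 = - (f 0 * c {0, 1}) + f 2 * c {1, 2}" "x 2 = - (f 0 * c {0, 2}) - f 1 * c {1, 2}"
      by (simp_all add: v_def x_def)
    then show ?thesis unfolding koszul_boundary_def by (intro exI[of _ v]) (simp only: simp_thms)
  qed
  ultimately show "y \<in> {koszul_vec x | x. koszul_boundary f x}" by auto
next
  fix y assume "y \<in> {koszul_vec x | x. koszul_boundary f x}"
  then obtain x where x: "y = koszul_vec x" "koszul_boundary f x" by auto
  from x(2) obtain v where v: "x 0 = f 1 * v 2 + f 2 * v 1" "x 1 = - (f 0 * v 2) + f 2 * v 0"
      "x 2 = - (f 0 * v 1) - f 1 * v (0::nat)"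
    unfolding koszul_boundary_def by auto
  define c where "c = (\<lambda>I\<in>subsets_of_size 3 2. if I = {1, 2} then v 0 else if I = {0, 2} then v 1 else v 2)"
  have "{0, 2} \<noteq> {1, 2::nat}" "{0, 1} \<noteq> {1, 2::nat}" "{0, 1} \<noteq> {0, 2::nat}"
    by (simp_all add: doubleton_eq_iff)
  then have c: "c {1, 2} = v 0" "c {0, 2} = v 1" "c {0, 1} = v 2"
    by (simp_all add: c_def subsets_of_size_3)
  have "koszul_differential R f 3 2 c = y"
    unfolding koszul_differential_2_koszul_vec x(1) koszul_vec_eq_iff c v by simp
  moreover have "c \<in> carrier (koszul_module R d 3 2)"
    by (simp add: c_def koszul_module_simps)
  ultimately show "y \<in> koszul_differential R f 3 2 ` carrier (koszul_module R d 3 2)"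
    by (intro image_eqI[of _ _ c]) simp_all
qed

definition koszul_cycles :: "int \<times> int \<Rightarrow> (nat \<Rightarrow> 'a) \<Rightarrow> ('a, nat set \<Rightarrow> 'a) bigraded_module"
  where "koszul_cycles d f = kernel_module (koszul_module R d 3 1) (koszul_differential R f 3 1) (koszul_module R d 3 0)"

lemma submodule_pair_koszul:
  "submodule_pair R (koszul_cycles d f) {koszul_vec x | x. koszul_boundary f x}"
  unfolding koszul_cycles_def koszul_boundaries[of f d, symmetric]
proof (rule module_map.submodule_pair_kernel)
  show "module_map R (koszul_module R d 3 1) (koszul_module R d 3 0) (koszul_differential R f 3 1)"
    by (rule module_map_koszul[of d 3 0 f, folded One_nat_def])
  show "module_map R (koszul_module R d 3 2) (koszul_module R d 3 1) (koszul_differential R f 3 2)"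
    by (rule module_map_koszul[of d 3 1 f, unfolded Suc_1])
  fix c
  show "koszul_differential R f 3 1 (koszul_differential R f 3 2 c) = \<zero>\<^bsub>koszul_module R d 3 0\<^esub>"
    unfolding koszul_differential_2_koszul_vec koszul_cycle_iff by simp (simp add: algebra_simps)
qed

text \<open>As for Cech cochains, the coset does not depend on the twist \<open>d\<close>.\<close>
definition koszul_class :: "(nat \<Rightarrow> 'a) \<Rightarrow> (nat \<Rightarrow> 'a) \<Rightarrow> (nat set \<Rightarrow> 'a) set"
  where "koszul_class f x = {koszul_vec x | x. koszul_boundary f x} +>\<^bsub>koszul_module R 0 3 1\<^esub> koszul_vec x"

lemma koszul_class_eq: "{koszul_vec x | x. koszul_boundary f x} +>\<^bsub>koszul_cycles d f\<^esub> koszul_vec x = koszul_class f x"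
  unfolding koszul_class_def koszul_cycles_def a_r_coset_def' kernel_module_simps koszul_module_simps ..

lemma koszul_H1_eq: "koszul_H1 R d f 3 = quotient_module (koszul_cycles d f) {koszul_vec x | x. koszul_boundary f x}"
  by (simp only: koszul_H1_def koszul_cycles_def koszul_boundaries)

lemma koszul_vec_in_cycles: "koszul_vec x \<in> carrier (koszul_cycles d f) \<longleftrightarrow> f 0 * x 0 + f 1 * x 1 + f 2 * x 2 = 0"
  by (simp only: koszul_cycles_def kernel_module_simps mem_Collect_eq koszul_cycle_iff koszul_vec_in_carrier simp_thms)

lemma carrier_koszul_H1:
  "carrier (koszul_H1 R d f 3) = {koszul_class f x | x. f 0 * x 0 + f 1 * x 1 + f 2 * x 2 = 0}"
proof -
  have "carrier (koszul_cycles d f) = {koszul_vec x | x. f 0 * x 0 + f 1 * x 1 + f 2 * x 2 = 0}"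
  proof (intro equalityI subsetI)
    fix c assume c: "c \<in> carrier (koszul_cycles d f)"
    then have "c \<in> carrier (koszul_module R d 3 1)" by (simp add: koszul_cycles_def)
    then obtain x where x: "c = koszul_vec x" using carrier_koszul_1 by blast
    show "c \<in> {koszul_vec x | x. f 0 * x 0 + f 1 * x 1 + f 2 * x 2 = 0}"
      using c[unfolded x koszul_vec_in_cycles] x by auto
  next
    fix c assume "c \<in> {koszul_vec x | x. f 0 * x 0 + f 1 * x 1 + f 2 * x 2 = 0}"
    then obtain x where "c = koszul_vec x" "f 0 * x 0 + f 1 * x 1 + f 2 * x 2 = 0" by auto
    then show "c \<in> carrier (koszul_cycles d f)" by (simp only: koszul_vec_in_cycles)
  qed
  moreover have "h ` {koszul_vec x | x. f 0 * x 0 + f 1 * x 1 + f 2 * x 2 = 0} =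
      {h (koszul_vec x) | x. f 0 * x 0 + f 1 * x 1 + f 2 * x 2 = 0}" for h :: "_ \<Rightarrow> (nat set \<Rightarrow> 'a) set"
    by blast
  ultimately show ?thesis
    by (simp only: koszul_H1_eq quotient_module_simps koszul_class_eq)
qed

lemma piece_koszul_H1:
  "piece (koszul_H1 R d f 3) e = {koszul_class f x | x. f 0 * x 0 + f 1 * x 1 + f 2 * x 2 = 0 \<and>
    koszul_vec x \<in> piece (koszul_module R d 3 1) e}"
proof -
  have "piece (koszul_cycles d f) e = {koszul_vec x | x. f 0 * x 0 + f 1 * x 1 + f 2 * x 2 = 0 \<and>
    koszul_vec x \<in> piece (koszul_module R d 3 1) e}"
  proof (intro equalityI subsetI)
    fix c assume "c \<in> piece (koszul_cycles d f) e"
    then have c: "c \<in> piece (koszul_module R d 3 1) e"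
      "koszul_differential R f 3 1 c = \<zero>\<^bsub>koszul_module R d 3 0\<^esub>"
      by (simp_all add: koszul_cycles_def)
    then have "c \<in> carrier (koszul_module R d 3 1)" by (auto simp: koszul_module_simps)
    then obtain x where x: "c = koszul_vec x" using carrier_koszul_1 by blast
    show "c \<in> {koszul_vec x | x. f 0 * x 0 + f 1 * x 1 + f 2 * x 2 = 0 \<and>
        koszul_vec x \<in> piece (koszul_module R d 3 1) e}"
      using c[unfolded x koszul_cycle_iff] x by (intro CollectI exI[of _ x] conjI) simp_all
  next
    fix c assume "c \<in> {koszul_vec x | x. f 0 * x 0 + f 1 * x 1 + f 2 * x 2 = 0 \<and>
        koszul_vec x \<in> piece (koszul_module R d 3 1) e}"
    then obtain x where "c = koszul_vec x" "f 0 * x 0 + f 1 * x 1 + f 2 * x 2 = 0"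
        "koszul_vec x \<in> piece (koszul_module R d 3 1) e"
      by auto
    then show "c \<in> piece (koszul_cycles d f) e"
      by (simp only: koszul_cycles_def kernel_module_simps koszul_cycle_iff mem_Collect_eq simp_thms)
  qed
  moreover have "h ` {koszul_vec x | x. f 0 * x 0 + f 1 * x 1 + f 2 * x 2 = 0 \<and>
      koszul_vec x \<in> piece (koszul_module R d 3 1) e} =
      {h (koszul_vec x) | x. f 0 * x 0 + f 1 * x 1 + f 2 * x 2 = 0 \<and>
      koszul_vec x \<in> piece (koszul_module R d 3 1) e}" for h :: "_ \<Rightarrow> (nat set \<Rightarrow> 'a) set"
    by blast
  ultimately show ?thesis
    by (simp only: koszul_H1_eq quotient_module_simps koszul_class_eq)
qed

lemma add_koszul_H1:
  assumes "f 0 * x 0 + f 1 * x 1 + f 2 * x 2 = 0" "f 0 * x' 0 + f 1 * x' 1 + f 2 * x' 2 = 0"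
  shows "koszul_class f x \<oplus>\<^bsub>koszul_H1 R d f 3\<^esub> koszul_class f x' = koszul_class f (\<lambda>k. x k + x' k)"
proof -
  interpret submodule_pair R "koszul_cycles d f" "{koszul_vec x | x. koszul_boundary f x}"
    by (rule submodule_pair_koszul)
  have "koszul_vec x \<oplus>\<^bsub>koszul_cycles d f\<^esub> koszul_vec x' = koszul_vec (\<lambda>k. x k + x' k)"
    by (simp only: koszul_cycles_def kernel_module_simps add_koszul_vec)
  then show ?thesis
    using coset_add[of "koszul_vec x" "koszul_vec x'"] assms
    by (simp only: koszul_H1_eq quotient_module_simps koszul_class_eq koszul_vec_in_cycles)
qed

lemma smult_koszul_H1:
  assumes "f 0 * x 0 + f 1 * x 1 + f 2 * x 2 = 0"
  shows "r \<odot>\<^bsub>koszul_H1 R d f 3\<^esub> koszul_class f x = koszul_class f (\<lambda>k. r * x k)"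
proof -
  interpret submodule_pair R "koszul_cycles d f" "{koszul_vec x | x. koszul_boundary f x}"
    by (rule submodule_pair_koszul)
  have "r \<odot>\<^bsub>koszul_cycles d f\<^esub> koszul_vec x = koszul_vec (\<lambda>k. r * x k)"
    by (simp only: koszul_cycles_def kernel_module_simps smult_koszul_vec)
  then show ?thesis
    using coset_smult[of r "koszul_vec x"] assms
    by (simp only: koszul_H1_eq quotient_module_simps koszul_class_eq koszul_vec_in_cycles carrier_R UNIV_I simp_thms)
qed

lemma koszul_class_eq_iff:
  assumes "f 0 * x 0 + f 1 * x 1 + f 2 * x 2 = 0" "f 0 * x' 0 + f 1 * x' 1 + f 2 * x' 2 = 0"
  shows "koszul_class f x = koszul_class f x' \<longleftrightarrow> koszul_boundary f (\<lambda>k. x k - x' k)"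
proof -
  interpret submodule_pair R "koszul_cycles 0 f" "{koszul_vec x | x. koszul_boundary f x}"
    by (rule submodule_pair_koszul)
  have "koszul_class f x = koszul_class f x' \<longleftrightarrow>
      (\<exists>h\<in>{koszul_vec x | x. koszul_boundary f x}. koszul_vec x = h \<oplus>\<^bsub>koszul_cycles 0 f\<^esub> koszul_vec x')"
    using coset_eq_iff[of "koszul_vec x" "koszul_vec x'"] assms by (simp only: koszul_class_eq koszul_vec_in_cycles)
  also have "\<dots> \<longleftrightarrow> (\<exists>u. koszul_boundary f u \<and> koszul_vec x = koszul_vec (\<lambda>k. u k + x' k))"
    by (auto simp only: koszul_cycles_def kernel_module_simps add_koszul_vec mem_Collect_eq bex_simps)
  also have "\<dots> \<longleftrightarrow> koszul_boundary f (\<lambda>k. x k - x' k)"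
  proof
    assume "\<exists>u. koszul_boundary f u \<and> koszul_vec x = koszul_vec (\<lambda>k. u k + x' k)"
    then obtain u where "koszul_boundary f u" "u 0 = x 0 - x' 0" "u 1 = x 1 - x' 1" "u 2 = x 2 - x' 2"
      unfolding koszul_vec_eq_iff by auto
    then show "koszul_boundary f (\<lambda>k. x k - x' k)" by (simp add: koszul_boundary_def)
  next
    assume "koszul_boundary f (\<lambda>k. x k - x' k)"
    then show "\<exists>u. koszul_boundary f u \<and> koszul_vec x = koszul_vec (\<lambda>k. u k + x' k)"
      by (intro exI[of _ "\<lambda>k. x k - x' k"]) simp
  qed
  finally show ?thesis .
qed

end

section \<open>The isomorphism\<close>

locale graded_koszul_cech =
  graded_cech R component gs dg + koszul_cech "(!) gs" f "length gs" p q
  for R :: "('a::comm_ring_1, 'a) bigraded_module" and component gs dg f p q +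
  fixes d :: "int \<times> int"
  assumes f_piece: "k < 3 \<Longrightarrow> f k \<in> piece R d"
begin

lemma component_f_mult:
  assumes "k < 3"
  shows "component (multiple (- 1) d + e) (f k * y) = f k * component (multiple (- 2) d + e) y"
    "component (multiple (- 2) d + e) (f k * y) = f k * component (multiple (- 3) d + e) y"
proof -
  have "multiple (- 1) d = d + multiple (- 2) d" "multiple (- 2) d = d + multiple (- 3) d"
    by (simp_all add: multiple_def plus_prod_def prod_eq_iff)
  then show "component (multiple (- 1) d + e) (f k * y) = f k * component (multiple (- 2) d + e) y"
    "component (multiple (- 2) d + e) (f k * y) = f k * component (multiple (- 3) d + e) y"
    by (simp_all only: add.assoc component_mult[OF f_piece[OF assms]])
qed

text \<open>
  Multiplication by \<open>f\<^sub>k\<close> and by \<open>g\<^sub>i\<^sup>N\<close> shifts degrees by \<open>d\<close> and by the degree of \<open>g\<^sub>i\<^sup>N\<close>. Applying the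
  projections to the matching degrees therefore preserves the equations of a zigzag.
\<close>
lemma zigzag_component:
  assumes "zigzag N x y z"
  shows "zigzag N (\<lambda>k. component (multiple (- 1) d + e) (x k))
    (\<lambda>k I. component (multiple (- 2) d + e + deg N I) (y k I))
    (\<lambda>J. component (multiple (- 3) d + e + deg N J) (z J))"
proof -
  have g: "g i ^ N * component (multiple (- 1) d + e) a = component (multiple (- 1) d + (e + deg N {i})) (g i ^ N * a)"
    if "i < n" for i a
    using component_mult[OF g_power_piece[OF that, of N], of "multiple (- 1) d + e" a] by (simp add: ac_simps)
  have f: "f 0 * component (multiple (- 2) d + a + b) c = component (multiple (- 1) d + (a + b)) (f 0 * c)"
    "f 1 * component (multiple (- 2) d + a + b) c = component (multiple (- 1) d + (a + b)) (f 1 * c)"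
    "f 2 * component (multiple (- 2) d + a + b) c = component (multiple (- 1) d + (a + b)) (f 2 * c)"
    "f 0 * component (multiple (- 3) d + a + b) c = component (multiple (- 2) d + a + b) (f 0 * c)"
    "f 1 * component (multiple (- 3) d + a + b) c = component (multiple (- 2) d + a + b) (f 1 * c)"
    "f 2 * component (multiple (- 3) d + a + b) c = component (multiple (- 2) d + a + b) (f 2 * c)"
    for a b c
    by (simp_all only: add.assoc component_f_mult less_3 simp_thms)
  show ?thesis
    unfolding zigzag_def f
    by (intro conjI allI impI ballI;
        simp only: g zigzagD[OF assms] component_add[symmetric] component_diff[symmetric] component_uminus[symmetric]
          component_cech_level[symmetric])
qed

lemma zigzag_cong:
  assumes "zigzag N x y z" "x 0 = x' 0" "x 1 = x' 1" "x 2 = x' 2"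
    "\<And>J. J \<in> subsets_of_size n 2 \<Longrightarrow> z J = z' J"
  shows "zigzag N x' y z'"
  using assms by (simp add: zigzag_def)

text \<open>The coefficients \<open>- f\<^sub>0\<close>, \<open>f\<^sub>1\<close>, \<open>- f\<^sub>2\<close> of \<open>\<delta>\<close> on the generator of \<open>K\<^sub>3\<close>.\<close>
definition top_coeff :: "nat set \<Rightarrow> 'a"
  where "top_coeff J = koszul_top R f 3 1 J"

abbreviation H2 where "H2 \<equiv> local_cohomology R gs 2 (shift R (multiple (- 3) d))"
abbreviation H2_target where
  "H2_target \<equiv> dsum (subsets_of_size 3 2) (\<lambda>_. local_cohomology R gs 2 (shift R (multiple (- 2) d)))"
abbreviation H2_kernel where
  "H2_kernel \<equiv> kernel_module H2 (koszul_local_cohomology_map R gs 2 d f 3) H2_target"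

lemma koszul_top_eq_top_coeff: "koszul_top R f 3 r J = top_coeff J * r" if "J \<in> subsets_of_size 3 2"
  using that unfolding subsets_of_size_3 top_coeff_def by (elim insertE emptyE; simp add: koszul_top_3)

lemma koszul_map_cohomology_class:
  "koszul_local_cohomology_map R gs 2 d f 3 (cohomology_class 1 N z) =
    (\<lambda>J\<in>subsets_of_size 3 2. cohomology_class 1 N (\<lambda>I. top_coeff J * z I))"
proof -
  have "local_cohomology_map R gs 2 (shift R (multiple (- int 2) d)) (\<lambda>r. koszul_top R f 3 r J) (cohomology_class 1 N z) =
      cohomology_class 1 N (\<lambda>I. top_coeff J * z I)" if "J \<in> subsets_of_size 3 2" for J
    unfolding koszul_top_eq_top_coeff[OF that] by (rule local_cohomology_map_cohomology_class[of 1, unfolded Suc_1])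
  moreover have "3 - 1 = (2::nat)" by simp
  ultimately show ?thesis
    unfolding koszul_local_cohomology_map_def \<open>3 - 1 = (2::nat)\<close> by (intro restrict_ext)
qed

lemma zero_target: "\<zero>\<^bsub>H2_target\<^esub> = (\<lambda>J\<in>subsets_of_size 3 2. cohomology_class 1 N (\<lambda>_. 0))"
  by (simp add: dsum_def zero_local_cohomology[of 1 _ N, unfolded Suc_1])

lemma koszul_map_eq_zero_iff:
  "koszul_local_cohomology_map R gs 2 d f 3 (cohomology_class 1 N z) = \<zero>\<^bsub>H2_target\<^esub> \<longleftrightarrow>
    (\<forall>t\<in>{- f 0, f 1, - f 2}. cohomology_class 1 N (\<lambda>I. t * z I) = cohomology_class 1 N (\<lambda>_. 0))"
proof -
  have "koszul_local_cohomology_map R gs 2 d f 3 (cohomology_class 1 N z) = \<zero>\<^bsub>H2_target\<^esub> \<longleftrightarrow>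
      (\<forall>J\<in>subsets_of_size 3 2. cohomology_class 1 N (\<lambda>I. top_coeff J * z I) = cohomology_class 1 N (\<lambda>_. 0))"
    unfolding koszul_map_cohomology_class zero_target[of N] by (auto simp: fun_eq_iff restrict_def)
  then show ?thesis unfolding subsets_of_size_3 by (simp add: top_coeff_def koszul_top_3)
qed

text \<open>The graph of the isomorphism.\<close>
definition connecting :: "(nat set \<Rightarrow> 'a) set \<Rightarrow> (nat set \<Rightarrow> ('a \<times> 'a) set) set \<Rightarrow> bool"
  where "connecting X Z \<longleftrightarrow> (\<exists>N x y z. X = koszul_class f x \<and> Z = cohomology_class 1 N z \<and> zigzag N x y z)"

lemma connectingI: "zigzag N x y z \<Longrightarrow> connecting (koszul_class f x) (cohomology_class 1 N z)"
  unfolding connecting_def by blast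

lemma connecting_common_level:
  assumes "connecting X Z" "connecting X' Z'"
  obtains N x y z x' y' z' where "X = koszul_class f x" "Z = cohomology_class 1 N z" "zigzag N x y z"
    "X' = koszul_class f x'" "Z' = cohomology_class 1 N z'" "zigzag N x' y' z'"
proof -
  obtain N x y z where 1: "X = koszul_class f x" "Z = cohomology_class 1 N z" "zigzag N x y z"
    using assms(1) unfolding connecting_def by blast
  obtain N' x' y' z' where 2: "X' = koszul_class f x'" "Z' = cohomology_class 1 N' z'" "zigzag N' x' y' z'"
    using assms(2) unfolding connecting_def by blast
  show thesis
  proof (rule that)
    show "X = koszul_class f x" "X' = koszul_class f x'" by fact+
    show "Z = cohomology_class 1 (N + N') (\<lambda>J. prod_power g N' J * z J)" unfolding 1 by (rule cohomology_class_raise)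
    show "zigzag (N + N') x (\<lambda>k I. prod_power g N' I * y k I) (\<lambda>J. prod_power g N' J * z J)"
      using 1(3) by (rule zigzag_raise)
    show "Z' = cohomology_class 1 (N + N') (\<lambda>J. prod_power g N J * z' J)"
      unfolding 2 add.commute[of N N'] by (rule cohomology_class_raise)
    show "zigzag (N + N') x' (\<lambda>k I. prod_power g N I * y' k I) (\<lambda>J. prod_power g N J * z' J)"
      unfolding add.commute[of N N'] using 2(3) by (rule zigzag_raise)
  qed
qed

lemma zigzag_represents_cocycle: "zigzag N x y z \<Longrightarrow> represents_cocycle 2 N z"
proof -
  assume zz: "zigzag N x y z"
  have "Suc 2 = 3" by simp
  show "represents_cocycle 2 N z"
    unfolding represents_cocycle_def \<open>Suc 2 = 3\<close> using zigzag_cocycle[OF zz] by blast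
qed

lemma zigzag_in_kernel:
  assumes "zigzag N x y z"
  shows "koszul_local_cohomology_map R gs 2 d f 3 (cohomology_class 1 N z) = \<zero>\<^bsub>H2_target\<^esub>"
proof -
  have "cohomology_class 1 N (\<lambda>I. t * z I) = cohomology_class 1 N (\<lambda>_. 0)"
    if "\<And>J. J \<in> subsets_of_size n 2 \<Longrightarrow> t * z J = cech_level g N w J" for t w
    unfolding cohomology_class_eq_iff Suc_1 by (rule exI[of _ 0], rule exI[of _ w]) (simp add: that)
  from this[of "- f 0" "y 0"] this[of "f 1" "y 1"] this[of "- f 2" "y 2"] show ?thesis
    unfolding koszul_map_eq_zero_iff by (simp add: zigzagD(4-6)[OF assms])
qed

lemma carrier_H2: "carrier H2 = {cohomology_class 1 N z | N z. represents_cocycle 2 N z}"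
  using carrier_local_cohomology[of 1, unfolded Suc_1] .

lemma piece_H2:
  "piece H2 e = {cohomology_class 1 N z | N z. represents_cocycle 2 N z \<and> homogeneous 2 (multiple (- 3) d + e) N z}"
  using piece_local_cohomology[of 1, unfolded Suc_1] .

lemma connecting_carrier:
  assumes "connecting X Z"
  shows "X \<in> carrier (koszul_H1 R d f 3) \<and> Z \<in> carrier H2_kernel"
proof -
  obtain N x y z where *: "X = koszul_class f x" "Z = cohomology_class 1 N z" "zigzag N x y z"
    using assms unfolding connecting_def by blast
  have "X \<in> carrier (koszul_H1 R d f 3)"
    unfolding carrier_koszul_H1 *(1) using zigzag_cycle[OF *(3)] by (intro CollectI exI[of _ x] conjI refl)
  moreover have "Z \<in> carrier H2"
    unfolding carrier_H2 *(2) using zigzag_represents_cocycle[OF *(3)] by blast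
  ultimately show ?thesis
    using zigzag_in_kernel[OF *(3)] by (simp add: *(2))
qed

text \<open>
  Every class in the kernel arises: choose cochains bounding its three images and raise all
  levels to a common one.
\<close>
lemma H2_kernel_zigzag:
  assumes "koszul_local_cohomology_map R gs 2 d f 3 (cohomology_class 1 N z) = \<zero>\<^bsub>H2_target\<^esub>"
  shows "\<exists>M x y. zigzag (N + M) x y (\<lambda>J. prod_power g M J * z J)"
proof -
  have ex: "\<exists>M w. \<forall>J\<in>subsets_of_size n 2. prod_power g M J * (t * z J) = cech_level g (N + M) w J"
    if "t \<in> {- f 0, f 1, - f 2}" for t
  proof -
    have "cohomology_class 1 N (\<lambda>I. t * z I) = cohomology_class 1 N (\<lambda>_. 0)"
      using assms that unfolding koszul_map_eq_zero_iff by (rule bspec)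
    then show ?thesis unfolding cohomology_class_eq_iff Suc_1 diff_zero .
  qed
  obtain M\<^sub>0 w\<^sub>0 where w0: "\<And>J. J \<in> subsets_of_size n 2 \<Longrightarrow>
      prod_power g M\<^sub>0 J * (- f 0 * z J) = cech_level g (N + M\<^sub>0) w\<^sub>0 J"
    using ex[of "- f 0"] by auto
  obtain M\<^sub>1 w\<^sub>1 where w1: "\<And>J. J \<in> subsets_of_size n 2 \<Longrightarrow>
      prod_power g M\<^sub>1 J * (f 1 * z J) = cech_level g (N + M\<^sub>1) w\<^sub>1 J"
    using ex[of "f 1"] by auto
  obtain M\<^sub>2 w\<^sub>2 where w2: "\<And>J. J \<in> subsets_of_size n 2 \<Longrightarrow>
      prod_power g M\<^sub>2 J * (- f 2 * z J) = cech_level g (N + M\<^sub>2) w\<^sub>2 J"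
    using ex[of "- f 2"] by auto
  note w = w0 w1 w2
  let ?M = "M\<^sub>0 + M\<^sub>1 + M\<^sub>2"
  have raise: "cech_level g (N + (M' + K)) (\<lambda>I. prod_power g K I * w I) J = prod_power g (M' + K) J * (t * z J)"
    if "J \<in> subsets_of_size n 2" "prod_power g M' J * (t * z J) = cech_level g (N + M') w J" for J K M' t w
    using cech_level_raise[OF subsets_of_size_finite[OF that(1)], of g "N + M'" K w]
    unfolding that(2)[symmetric] by (simp add: prod_power_add ac_simps)
  have "\<exists>x y. zigzag (N + ?M) x y (\<lambda>J. prod_power g ?M J * z J)"
  proof (rule zigzag_surjective)
    fix J assume J: "J \<in> subsets_of_size n 2"
    show "cech_level g (N + ?M) (\<lambda>I. prod_power g (M\<^sub>1 + M\<^sub>2) I * w\<^sub>0 I) J = - (f 0 * (prod_power g ?M J * z J))"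
      using raise[OF J w(1)[OF J], of "M\<^sub>1 + M\<^sub>2"] by (simp add: ac_simps)
    show "cech_level g (N + ?M) (\<lambda>I. prod_power g (M\<^sub>0 + M\<^sub>2) I * w\<^sub>1 I) J = f 1 * (prod_power g ?M J * z J)"
      using raise[OF J w(2)[OF J], of "M\<^sub>0 + M\<^sub>2"] by (simp add: ac_simps)
    show "cech_level g (N + ?M) (\<lambda>I. prod_power g (M\<^sub>0 + M\<^sub>1) I * w\<^sub>2 I) J = - (f 2 * (prod_power g ?M J * z J))"
      using raise[OF J w(3)[OF J], of "M\<^sub>0 + M\<^sub>1"] by (simp add: ac_simps)
  qed
  then show ?thesis by blast
qed

text \<open>
  At a common level the difference of two zigzags is a zigzag, so the statement reduces to the fact that
  \<open>x\<close> is a boundary if and only if \<open>z\<close> is one.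
\<close>
lemma connecting_eq_iff:
  assumes "connecting X Z" "connecting X' Z'"
  shows "X = X' \<longleftrightarrow> Z = Z'"
proof -
  obtain N x y z x' y' z' where
    *: "X = koszul_class f x" "Z = cohomology_class 1 N z" "zigzag N x y z"
      "X' = koszul_class f x'" "Z' = cohomology_class 1 N z'" "zigzag N x' y' z'"
    using connecting_common_level[OF assms] .
  note zz = zigzag_diff[OF *(3,6)]
  have X: "X = X' \<longleftrightarrow> koszul_boundary f (\<lambda>k. x k - x' k)"
    unfolding *(1,4) by (intro koszul_class_eq_iff zigzag_cycle[OF *(3)] zigzag_cycle[OF *(6)])
  have Z: "Z = Z' \<longleftrightarrow> (\<exists>M w. \<forall>J\<in>subsets_of_size n 2. prod_power g M J * (z J - z' J) = cech_level g (N + M) w J)"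
    unfolding *(2,5) cohomology_class_eq_iff Suc_1 ..
  show ?thesis
    unfolding X Z
  proof
    assume "koszul_boundary f (\<lambda>k. x k - x' k)"
    then obtain v where "x 0 - x' 0 = f 1 * v 2 + f 2 * v 1" "x 1 - x' 1 = - (f 0 * v 2) + f 2 * v 0"
      "x 2 - x' 2 = - (f 0 * v 1) - f 1 * v (0::nat)"
      unfolding koszul_boundary_def by auto
    from zigzag_of_boundary[OF zz this]
    show "\<exists>M w. \<forall>J\<in>subsets_of_size n 2. prod_power g M J * (z J - z' J) = cech_level g (N + M) w J" .
  next
    assume "\<exists>M w. \<forall>J\<in>subsets_of_size n 2. prod_power g M J * (z J - z' J) = cech_level g (N + M) w J"
    then obtain M w where w: "\<And>J. J \<in> subsets_of_size n 2 \<Longrightarrow>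
        prod_power g M J * (z J - z' J) = cech_level g (N + M) w J" by blast
    show "koszul_boundary f (\<lambda>k. x k - x' k)"
      unfolding koszul_boundary_def by (rule zigzag_to_boundary[OF zigzag_raise[OF zz] w])
  qed
qed

text \<open>
  For the grading, the homogeneous components of a zigzag are taken; they leave the given homogeneous
  end \<open>x\<close> or \<open>z\<close> unchanged.
\<close>
theorem koszul_H1_iso: "\<exists>\<phi>. \<phi> \<in> bigraded_iso R (koszul_H1 R d f 3) H2_kernel"
proof (rule bigraded_iso_of_relation[where \<Phi> = connecting])
  fix X assume "X \<in> carrier (koszul_H1 R d f 3)"
  then obtain x where "X = koszul_class f x" "f 0 * x 0 + f 1 * x 1 + f 2 * x 2 = 0"
    unfolding carrier_koszul_H1 by auto
  moreover from this obtain N y z where "zigzag N x y z" using zigzag_total by blast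
  ultimately show "\<exists>Z. connecting X Z" using connectingI by (intro exI[of _ "cohomology_class 1 N z"]) simp
next
  fix Z assume "Z \<in> carrier H2_kernel"
  then have Z: "Z \<in> carrier H2" "koszul_local_cohomology_map R gs 2 d f 3 Z = \<zero>\<^bsub>H2_target\<^esub>" by simp_all
  then obtain N z where z: "Z = cohomology_class 1 N z" unfolding carrier_H2 by blast
  obtain M x y where "zigzag (N + M) x y (\<lambda>J. prod_power g M J * z J)"
    using H2_kernel_zigzag[OF Z(2)[unfolded z]] by blast
  from connectingI[OF this] show "\<exists>X. connecting X Z"
    unfolding z cohomology_class_raise[of 1 N z M] by (rule exI)
next
  fix X Z X' Z' assume "connecting X Z" "connecting X' Z'"
  then obtain N x y z x' y' z' where
    *: "X = koszul_class f x" "Z = cohomology_class 1 N z" "zigzag N x y z"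
      "X' = koszul_class f x'" "Z' = cohomology_class 1 N z'" "zigzag N x' y' z'"
    by (rule connecting_common_level)
  have "koszul_class f x \<oplus>\<^bsub>koszul_H1 R d f 3\<^esub> koszul_class f x' = koszul_class f (\<lambda>k. x k + x' k)"
    by (intro add_koszul_H1 zigzag_cycle[OF *(3)] zigzag_cycle[OF *(6)])
  moreover have "cohomology_class 1 N z \<oplus>\<^bsub>H2_kernel\<^esub> cohomology_class 1 N z' = cohomology_class 1 N (\<lambda>J. z J + z' J)"
    using add_local_cohomology[of 1, unfolded Suc_1] by simp
  ultimately show "connecting (X \<oplus>\<^bsub>koszul_H1 R d f 3\<^esub> X') (Z \<oplus>\<^bsub>H2_kernel\<^esub> Z')"
    using connectingI[OF zigzag_add[OF *(3,6)]] by (simp only: *)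
next
  fix r X Z assume "connecting X Z"
  then obtain N x y z where *: "X = koszul_class f x" "Z = cohomology_class 1 N z" "zigzag N x y z"
    unfolding connecting_def by blast
  have "r \<odot>\<^bsub>koszul_H1 R d f 3\<^esub> koszul_class f x = koszul_class f (\<lambda>k. r * x k)"
    by (intro smult_koszul_H1 zigzag_cycle[OF *(3)])
  moreover have "r \<odot>\<^bsub>H2_kernel\<^esub> cohomology_class 1 N z = cohomology_class 1 N (\<lambda>J. r * z J)"
    using smult_local_cohomology[of 1, unfolded Suc_1] by simp
  ultimately show "connecting (r \<odot>\<^bsub>koszul_H1 R d f 3\<^esub> X) (r \<odot>\<^bsub>H2_kernel\<^esub> Z)"
    using connectingI[OF zigzag_scale[OF *(3)]] by (simp only: *)
next
  fix e X assume "X \<in> piece (koszul_H1 R d f 3) e"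
  then obtain x where x: "X = koszul_class f x" "f 0 * x 0 + f 1 * x 1 + f 2 * x 2 = 0"
      "koszul_vec x \<in> piece (koszul_module R d 3 1) e"
    unfolding piece_koszul_H1 by auto
  obtain N y z where zz: "zigzag N x y z" using zigzag_total[OF x(2)] by blast
  let ?z = "\<lambda>J. component (multiple (- 3) d + e + deg N J) (z J)"
  have "x 0 = component (multiple (- 1) d + e) (x 0)" "x 1 = component (multiple (- 1) d + e) (x 1)"
    "x 2 = component (multiple (- 1) d + e) (x 2)"
    using x(3) unfolding piece_koszul_1 piece_iff by simp_all
  then have zz': "zigzag N x (\<lambda>k I. component (multiple (- 2) d + e + deg N I) (y k I)) ?z"
    by (intro zigzag_cong[OF zigzag_component[OF zz, of e]]) simp_all
  have "homogeneous 2 (multiple (- 3) d + e) N ?z"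
    by (simp add: homogeneous_def component_in_piece)
  then have "cohomology_class 1 N ?z \<in> piece H2 e"
    unfolding piece_H2 using zigzag_represents_cocycle[OF zz'] by - (intro CollectI exI conjI, rule refl)
  then have "cohomology_class 1 N ?z \<in> piece H2_kernel e"
    using zigzag_in_kernel[OF zz'] by simp
  then show "\<exists>Z\<in>piece H2_kernel e. connecting X Z"
    using connectingI[OF zz'] unfolding x(1) by (rule bexI[rotated])
next
  fix e Z assume "Z \<in> piece H2_kernel e"
  then have Z: "Z \<in> piece H2 e" "koszul_local_cohomology_map R gs 2 d f 3 Z = \<zero>\<^bsub>H2_target\<^esub>" by simp_all
  then obtain N z where z: "Z = cohomology_class 1 N z" "homogeneous 2 (multiple (- 3) d + e) N z"
    unfolding piece_H2 by blast
  obtain M x y where zz: "zigzag (N + M) x y (\<lambda>J. prod_power g M J * z J)"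
    using H2_kernel_zigzag[OF Z(2)[unfolded z(1)]] by blast
  let ?x = "\<lambda>k. component (multiple (- 1) d + e) (x k)"
  have component_z: "component (multiple (- 3) d + e + deg (N + M) J) (prod_power g M J * z J) = prod_power g M J * z J"
    if "J \<in> subsets_of_size n 2" for J
  proof -
    have "prod_power g M J \<in> piece R (deg M J)"
      using that by (intro prod_power_piece) (auto simp: subsets_of_size_def)
    then have "prod_power g M J * z J \<in> piece R (deg M J + (multiple (- 3) d + e + deg N J))"
      by (rule piece_mult) (use z(2) that in \<open>auto simp: homogeneous_def\<close>)
    then show ?thesis unfolding piece_iff deg_add by (simp add: ac_simps)
  qed
  have zz': "zigzag (N + M) ?x (\<lambda>k I. component (multiple (- 2) d + e + deg (N + M) I) (y k I))
      (\<lambda>J. prod_power g M J * z J)"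
    by (rule zigzag_cong[OF zigzag_component[OF zz, of e]]) (simp_all add: component_z)
  have "koszul_class f ?x \<in> piece (koszul_H1 R d f 3) e"
    unfolding piece_koszul_H1
    by (intro CollectI exI[of _ ?x] conjI refl zigzag_cycle[OF zz']) (simp only: piece_koszul_1 component_in_piece simp_thms)
  moreover have "connecting (koszul_class f ?x) Z"
    using connectingI[OF zz'] unfolding z(1) cohomology_class_raise[of 1 N z M] .
  ultimately show "\<exists>X\<in>piece (koszul_H1 R d f 3) e. connecting X Z" by (rule bexI[rotated])
qed (erule connecting_carrier, erule (1) connecting_eq_iff)

end

section \<open>The bigraded polynomial ring\<close>

lemma ring_record_bipoly: "ring_record (bipoly_ring :: ('k::field bipoly, 'k bipoly) bigraded_module)"
  by unfold_locales (simp_all add: bipoly_ring_def)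

lemma poly_mapping_sum_single:
  fixes x :: "'a \<Rightarrow>\<^sub>0 'b::comm_monoid_add"
  shows "x = (\<Sum>k\<in>Poly_Mapping.keys x. Poly_Mapping.single k (Poly_Mapping.lookup x k))"
  by (rule poly_mapping_eqI)
    (auto simp: lookup_sum lookup_single when_def not_in_keys_iff_lookup_eq_zero sum.delta)

lemma poly_mapping_single_induct [case_names zero single add]:
  fixes x :: "'a \<Rightarrow>\<^sub>0 'b::comm_monoid_add"
  assumes "P 0" "\<And>k c. P (Poly_Mapping.single k c)" "\<And>x y. P x \<Longrightarrow> P y \<Longrightarrow> P (x + y)"
  shows "P x"
proof -
  have "P (\<Sum>k\<in>A. Poly_Mapping.single k (Poly_Mapping.lookup x k))" if "finite A" for A
    using that by (induction A) (use assms in auto)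
  then show ?thesis by (subst poly_mapping_sum_single) simp
qed

definition bipoly_component :: "int \<times> int \<Rightarrow> 'k::field bipoly \<Rightarrow> 'k bipoly"
  where "bipoly_component a p = Abs_poly_mapping (\<lambda>m. if bidegree m = a then Poly_Mapping.lookup p m else 0)"

lemma lookup_bipoly_component:
  "Poly_Mapping.lookup (bipoly_component a p) m = (if bidegree m = a then Poly_Mapping.lookup p m else 0)"
proof -
  have "finite {m. (if bidegree m = a then Poly_Mapping.lookup p m else 0) \<noteq> 0}"
    by (rule finite_subset[OF _ finite_keys[of p]]) (auto simp: in_keys_iff)
  then show ?thesis by (simp add: bipoly_component_def)
qed

lemma bipoly_component_add: "bipoly_component a (x + y) = bipoly_component a x + bipoly_component a y"
  by (rule poly_mapping_eqI) (simp add: lookup_bipoly_component lookup_add)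

lemma bipoly_component_zero [simp]: "bipoly_component a 0 = 0"
  by (rule poly_mapping_eqI) (simp add: lookup_bipoly_component)

lemma bipoly_component_single:
  "bipoly_component a (Poly_Mapping.single m c) = (if bidegree m = a then Poly_Mapping.single m c else 0)"
  by (rule poly_mapping_eqI) (auto simp: lookup_bipoly_component lookup_single when_def)

lemma bidegree_add: "bidegree (m + m') = bidegree m + bidegree m'"
  by (simp add: bidegree_def plus_prod_def lookup_add)

lemma piece_bipoly_iff: "x \<in> piece bipoly_ring a \<longleftrightarrow> bipoly_component a x = x"
proof
  assume "x \<in> piece bipoly_ring a"
  then show "bipoly_component a x = x"
    by (intro poly_mapping_eqI) (auto simp: lookup_bipoly_component bipoly_ring_def in_keys_iff)
next
  assume eq: "bipoly_component a x = x"
  have "bidegree m = a" if "m \<in> Poly_Mapping.keys x" for m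
    using arg_cong[OF eq, of "\<lambda>y. Poly_Mapping.lookup y m"] that
    by (simp add: lookup_bipoly_component in_keys_iff split: if_splits)
  then show "x \<in> piece bipoly_ring a" by (simp add: bipoly_ring_def)
qed

lemma bipoly_component_single_mult:
  "bipoly_component (bidegree m + b) (Poly_Mapping.single m c * y) = Poly_Mapping.single m c * bipoly_component b y"
proof (induction y rule: poly_mapping_single_induct)
  case zero
  show ?case by simp
next
  case (single k c')
  show ?case by (simp add: mult_single bipoly_component_single bidegree_add)
next
  case (add x y)
  then show ?case by (simp add: distrib_left bipoly_component_add)
qed

lemma bipoly_component_mult:
  assumes "x \<in> piece bipoly_ring a"
  shows "bipoly_component (a + b) (x * y) = x * bipoly_component b y"
proof -
  have sum: "bipoly_component c (\<Sum>k\<in>A. h k) = (\<Sum>k\<in>A. bipoly_component c (h k))"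
    for c A and h :: "(var \<Rightarrow>\<^sub>0 nat) \<Rightarrow> 'a bipoly"
    by (induction A rule: infinite_finite_induct) (simp_all add: bipoly_component_add)
  have deg: "bidegree k = a" if "k \<in> Poly_Mapping.keys x" for k
    using assms that by (simp add: bipoly_ring_def)
  show ?thesis
    by (subst (1 2) poly_mapping_sum_single[of x])
      (simp add: sum_distrib_right sum bipoly_component_single_mult flip: deg)
qed

lemma graded_ring_bipoly: "graded_ring (bipoly_ring :: ('k::field bipoly, 'k bipoly) bigraded_module) bipoly_component"
proof (intro graded_ring.intro ring_record_bipoly graded_ring_axioms.intro)
  show "(1 :: 'k bipoly) \<in> piece bipoly_ring 0"
    by (simp add: bipoly_ring_def bidegree_def zero_prod_def)
  show "bipoly_component a (bipoly_component b x) = (if a = b then bipoly_component b x else 0)" for a b and x :: "'k bipoly"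
    by (rule poly_mapping_eqI) (auto simp: lookup_bipoly_component)
qed (simp_all add: bipoly_component_add piece_bipoly_iff bipoly_component_mult)

lemma lookup_monomial_mult:
  fixes x :: "'k::field bipoly"
  shows "Poly_Mapping.lookup (Poly_Mapping.single m 1 * x) (m + k) = Poly_Mapping.lookup x k"
proof (induction x rule: poly_mapping_single_induct)
  case (single l c)
  show ?case by (simp add: mult_single lookup_single when_def)
qed (simp_all add: distrib_left lookup_add)

lemma keys_monomial_mult:
  fixes x :: "'k::field bipoly"
  shows "Poly_Mapping.keys (Poly_Mapping.single m 1 * x) \<subseteq> (+) m ` Poly_Mapping.keys x"
  using keys_mult[of "Poly_Mapping.single m 1" x] by auto

lemma monomial_regular_1:
  fixes x :: "'k::field bipoly"
  assumes "Poly_Mapping.single m 1 * x = 0"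
  shows "x = 0"
  by (rule poly_mapping_eqI) (metis assms lookup_monomial_mult lookup_zero)

text \<open>
  Monomials \<open>m, l\<close> without a common variable form a regular sequence: if \<open>l x\<close> is divisible
  by \<open>m\<close>, then every monomial of \<open>x\<close> is.
\<close>
lemma monomial_regular_2:
  fixes x y :: "'k::field bipoly"
  assumes eq: "Poly_Mapping.single l 1 * x = Poly_Mapping.single m 1 * y"
    and disjoint: "\<And>v. Poly_Mapping.lookup m v = 0 \<or> Poly_Mapping.lookup l v = 0"
  shows "Poly_Mapping.single m 1 dvd x"
proof -
  have "Poly_Mapping.single m 1 dvd Poly_Mapping.single k (Poly_Mapping.lookup x k)"
    if k: "k \<in> Poly_Mapping.keys x" for k
  proof -
    have "Poly_Mapping.lookup (Poly_Mapping.single m 1 * y) (l + k) \<noteq> 0"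
      using k unfolding eq[symmetric] lookup_monomial_mult by (simp add: in_keys_iff)
    then obtain j where j: "l + k = m + j"
      using keys_monomial_mult[of m y] by (auto simp: in_keys_iff)
    have "k = m + (k - m)"
    proof (rule poly_mapping_eqI)
      fix v
      have "Poly_Mapping.lookup l v + Poly_Mapping.lookup k v = Poly_Mapping.lookup m v + Poly_Mapping.lookup j v"
        using arg_cong[OF j, of "\<lambda>p. Poly_Mapping.lookup p v"] by (simp add: lookup_add)
      then show "Poly_Mapping.lookup k v = Poly_Mapping.lookup (m + (k - m)) v"
        using disjoint[of v] by (auto simp: lookup_add lookup_minus)
    qed
    then have "Poly_Mapping.single k (Poly_Mapping.lookup x k) =
        Poly_Mapping.single m 1 * Poly_Mapping.single (k - m) (Poly_Mapping.lookup x k)"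
      by (simp add: mult_single)
    then show ?thesis by (rule dvdI)
  qed
  then have "Poly_Mapping.single m 1 dvd (\<Sum>k\<in>Poly_Mapping.keys x. Poly_Mapping.single k (Poly_Mapping.lookup x k))"
    by (rule dvd_sum)
  then show ?thesis using poly_mapping_sum_single[of x] by simp
qed

definition monomial_multiple :: "nat \<Rightarrow> (var \<Rightarrow>\<^sub>0 nat) \<Rightarrow> (var \<Rightarrow>\<^sub>0 nat)"
  where "monomial_multiple K m = (\<Sum>i<K. m)"

lemma monomial_power:
  "(Poly_Mapping.single m 1 :: 'k::field bipoly) ^ K = Poly_Mapping.single (monomial_multiple K m) 1"
  by (induction K) (simp_all add: monomial_multiple_def mult_single add.commute)

lemma lookup_monomial_multiple:
  "Poly_Mapping.lookup (monomial_multiple K m) v = K * Poly_Mapping.lookup m v"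
  by (simp add: monomial_multiple_def lookup_sum)

context ring_record
begin

lemma ideal_combinations: "ideal {\<Sum>i<k. a i * h i | a. True} R"
proof (rule idealI)
  show "ring R" by (rule ring_axioms)
  let ?J = "{\<Sum>i<k. a i * h i | a. True}"
  have add: "x + y \<in> ?J" if "x \<in> ?J" "y \<in> ?J" for x y
  proof -
    obtain a b where "x = (\<Sum>i<k. a i * h i)" "y = (\<Sum>i<k. b i * h i)" using \<open>x \<in> ?J\<close> \<open>y \<in> ?J\<close> by auto
    then have "x + y = (\<Sum>i<k. (a i + b i) * h i)" by (simp add: sum.distrib distrib_right)
    then show ?thesis by (intro CollectI exI[of _ "\<lambda>i. a i + b i"]) simp
  qed
  have mult: "c * x \<in> ?J" if "x \<in> ?J" for x c
  proof -
    obtain a where "x = (\<Sum>i<k. a i * h i)" using \<open>x \<in> ?J\<close> by auto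
    then have "c * x = (\<Sum>i<k. (c * a i) * h i)" by (simp add: sum_distrib_left mult.assoc)
    then show ?thesis by (intro CollectI exI[of _ "\<lambda>i. c * a i"]) simp
  qed
  show "subgroup ?J (add_monoid R)"
  proof (rule group.subgroupI[OF a_group])
    show "?J \<noteq> {}" by auto
    fix x y assume x: "x \<in> ?J" and y: "y \<in> ?J"
    show "x \<otimes>\<^bsub>add_monoid R\<^esub> y \<in> ?J" using add[OF x y] by simp
    have "inv\<^bsub>add_monoid R\<^esub> x = - x" using a_inv_R[of x] by (simp add: a_inv_def)
    then show "inv\<^bsub>add_monoid R\<^esub> x \<in> ?J" using mult[OF x, of "- 1"] by simp
  qed simp
  fix x c assume x: "x \<in> ?J" "c \<in> carrier R"
  show "c \<otimes>\<^bsub>R\<^esub> x \<in> ?J" using mult[OF x(1)] by simp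
  show "x \<otimes>\<^bsub>R\<^esub> c \<in> ?J" using mult[OF x(1), of c] by (simp add: mult.commute)
qed

lemma ideal_radical:
  assumes "ideal J R"
  shows "ideal (radical R J) R"
proof -
  interpret J: ideal J R by fact
  have J_add: "x + y \<in> J" if "x \<in> J" "y \<in> J" for x y using J.a_closed[OF that] by simp
  have J_mult: "c * x \<in> J" if "x \<in> J" for c x using J.I_l_closed[OF that, of c] by simp
  have J_zero: "0 \<in> J" using J.zero_closed by simp
  have J_sum: "sum h A \<in> J" if "\<And>i. i \<in> A \<Longrightarrow> h i \<in> J" for h and A :: "nat set"
    using that by (induction A rule: infinite_finite_induct) (auto intro: J_add J_zero)
  have J_power: "x ^ k \<in> J" if "x ^ l \<in> J" "l \<le> k" for x k l
    using J_mult[OF that(1), of "x ^ (k - l)"] that(2) by (simp flip: power_add)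
  have rad: "x \<in> radical R J \<longleftrightarrow> (\<exists>k. x ^ k \<in> J)" for x by (simp add: radical_def)
  have mult: "c * x \<in> radical R J" if "x \<in> radical R J" for c x
    using that J_mult unfolding rad power_mult_distrib by blast
  show ?thesis
  proof (rule idealI)
    show "ring R" by (rule ring_axioms)
    show "subgroup (radical R J) (add_monoid R)"
    proof (rule group.subgroupI[OF a_group])
      have "0 ^ 1 \<in> J" using J_zero by simp
      then show "radical R J \<noteq> {}" using rad by blast
      fix x y assume x: "x \<in> radical R J" and y: "y \<in> radical R J"
      then obtain k l where kl: "x ^ k \<in> J" "y ^ l \<in> J" unfolding rad by blast
      have "(x + y) ^ (k + l) = (\<Sum>i\<le>k + l. of_nat (k + l choose i) * x ^ i * y ^ (k + l - i))"
        by (rule binomial_ring)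
      also have "\<dots> \<in> J"
      proof (rule J_sum)
        fix i assume "i \<in> {..k + l}"
        then consider "k \<le> i" | "l \<le> k + l - i" by fastforce
        then show "of_nat (k + l choose i) * x ^ i * y ^ (k + l - i) \<in> J"
        proof cases
          case 1
          then show ?thesis
            using J_mult[OF J_power[OF kl(1) 1], of "of_nat (k + l choose i) * y ^ (k + l - i)"]
            by (simp add: ac_simps)
        next
          case 2
          then show ?thesis using J_mult[OF J_power[OF kl(2) 2]] by simp
        qed
      qed
      finally show "x \<otimes>\<^bsub>add_monoid R\<^esub> y \<in> radical R J" using rad by auto
      have "inv\<^bsub>add_monoid R\<^esub> x = - x" using a_inv_R[of x] by (simp add: a_inv_def)
      then show "inv\<^bsub>add_monoid R\<^esub> x \<in> radical R J" using mult[OF x, of "- 1"] by simp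
    qed simp
    fix x c assume x: "x \<in> radical R J" "c \<in> carrier R"
    show "c \<otimes>\<^bsub>R\<^esub> x \<in> radical R J" using mult[OF x(1)] by simp
    show "x \<otimes>\<^bsub>R\<^esub> c \<in> radical R J" using mult[OF x(1), of c] by (simp add: mult.commute)
  qed
qed

lemma combination_self:
  fixes h :: "nat \<Rightarrow> 'a"
  assumes "j < k"
  shows "h j \<in> {\<Sum>i<k. a i * h i | a. True}"
proof -
  have "(\<Sum>i<k. (if i = j then 1 else 0) * h i) = (\<Sum>i<k. if i = j then h i else 0)"
    by (rule sum.cong) auto
  also have "\<dots> = h j" using \<open>j < k\<close> by simp
  finally show ?thesis by (intro CollectI exI[of _ "\<lambda>i. if i = j then 1 else 0"]) simp
qed

end

lemma product_in_irrelevant_ideal: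
  "x \<in> {Var_s, Var_t} \<Longrightarrow> y \<in> {Var_u, Var_v} \<Longrightarrow> indet x * indet y \<in> (irrelevant_ideal :: 'k::field bipoly set)"
proof -
  interpret ring_record "bipoly_ring :: ('k bipoly, 'k bipoly) bigraded_module" by (rule ring_record_bipoly)
  assume xy: "x \<in> {Var_s, Var_t}" "y \<in> {Var_u, Var_v}"
  have gen: "a * b \<in> Idl\<^bsub>bipoly_ring\<^esub> S" if "b \<in> S" for a b :: "'k bipoly" and S
  proof -
    interpret ideal "Idl\<^bsub>bipoly_ring\<^esub> S" bipoly_ring by (rule genideal_ideal) simp
    have "b \<in> Idl\<^bsub>bipoly_ring\<^esub> S" using genideal_self[of S] that by auto
    from I_l_closed[OF this, of a] show ?thesis by simp
  qed
  have "indet y * indet x \<in> Idl\<^bsub>bipoly_ring\<^esub> {indet Var_s, indet Var_t :: 'k bipoly}"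
    by (rule gen) (use xy in auto)
  moreover have "indet x * indet y \<in> Idl\<^bsub>bipoly_ring\<^esub> {indet Var_u, indet Var_v :: 'k bipoly}"
    by (rule gen) (use xy in auto)
  ultimately show ?thesis by (simp add: irrelevant_ideal_def mult.commute)
qed

lemma indet_product:
  "indet x * indet y = (Poly_Mapping.single (Poly_Mapping.single x 1 + Poly_Mapping.single y 1) 1 :: 'k::field bipoly)"
  by (simp add: indet_def mult_single)

text \<open>
  The elements some power of which lies in the ideal of the \<open>g\<^sub>i\<^sup>N\<close> form an ideal. It contains all \<open>g\<^sub>i\<close>,
  hence also \<open>su\<close> and \<open>tv\<close>.
\<close>
lemma koszul_cech_bipoly:
  fixes f :: "nat \<Rightarrow> 'k::field bipoly" and gs :: "'k bipoly list"
  assumes rad: "radical bipoly_ring (Idl\<^bsub>bipoly_ring\<^esub> (f ` {..<3})) = irrelevant_ideal"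
    and gen: "Idl\<^bsub>bipoly_ring\<^esub> (set gs) = irrelevant_ideal"
  shows "koszul_cech ((!) gs) f (length gs) (indet Var_s * indet Var_u) (indet Var_t * indet Var_v)"
proof
  interpret cech_ring "bipoly_ring :: ('k bipoly, 'k bipoly) bigraded_module" gs
    by (intro cech_ring.intro ring_record_bipoly)
  have radical_iff: "x \<in> radical bipoly_ring J \<longleftrightarrow> (\<exists>K. x ^ K \<in> J)" for x :: "'k bipoly" and J
    by (simp add: radical_def)
  show "\<exists>M. \<forall>I. I \<subseteq> {..<length gs} \<longrightarrow> I \<noteq> {} \<longrightarrow>
      (\<exists>a\<^sub>0 a\<^sub>1 a\<^sub>2. prod_power ((!) gs) M I = a\<^sub>0 * f 0 + a\<^sub>1 * f 1 + a\<^sub>2 * f 2)"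
  proof -
    let ?J = "{\<Sum>i<3. a i * f i | a. True}"
    interpret J: ideal ?J bipoly_ring by (rule ideal_combinations)
    have mult: "c * x \<in> ?J" if "x \<in> ?J" for c x using J.I_l_closed[OF that, of c] by simp
    have "Idl\<^bsub>bipoly_ring\<^esub> (f ` {..<3}) \<subseteq> ?J"
      by (rule genideal_minimal[OF ideal_combinations]) (use combination_self in blast)
    moreover have "gs ! i \<in> radical bipoly_ring (Idl\<^bsub>bipoly_ring\<^esub> (f ` {..<3}))" if "i < length gs" for i
      unfolding rad gen[symmetric] using genideal_self[of "set gs"] nth_mem[OF that] by auto
    ultimately have "\<exists>K. (gs ! i) ^ K \<in> ?J" if "i < length gs" for i
      using that unfolding radical_iff by blast
    moreover have "x ^ k \<in> ?J" if "x ^ l \<in> ?J" "l \<le> k" for x k l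
      using mult[OF that(1), of "x ^ (k - l)"] that(2) by (simp flip: power_add)
    ultimately have "\<exists>M. \<forall>i\<in>{..<length gs}. (gs ! i) ^ M \<in> ?J"
      by (intro eventually_level) (simp_all, blast)
    then obtain M where M: "\<And>i. i < length gs \<Longrightarrow> (gs ! i) ^ M \<in> ?J" by blast
    have "\<exists>a\<^sub>0 a\<^sub>1 a\<^sub>2. prod_power ((!) gs) M I = a\<^sub>0 * f 0 + a\<^sub>1 * f 1 + a\<^sub>2 * f 2"
      if I: "I \<subseteq> {..<length gs}" "I \<noteq> {}" for I
    proof -
      obtain i where i: "i \<in> I" using I(2) by blast
      have "prod_power ((!) gs) M (I - {i}) * (gs ! i) ^ M \<in> ?J"
        using i I(1) by (intro mult M) auto
      then have "prod_power ((!) gs) M I \<in> ?J"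
        using prod_power_remove[of I i "(!) gs" M] finite_subset[OF I(1)] i by (simp add: mult.commute)
      then obtain a where "prod_power ((!) gs) M I = (\<Sum>i<3. a i * f i)" by blast
      then show ?thesis
        by (intro exI[of _ "a 0"] exI[of _ "a 1"] exI[of _ "a 2"]) (simp add: eval_nat_numeral One_nat_def)
    qed
    then show ?thesis by blast
  qed
  show "\<exists>K b c. (indet Var_s * indet Var_u) ^ K = (\<Sum>i<length gs. b i * (gs ! i) ^ N) \<and>
      (indet Var_t * indet Var_v) ^ K = (\<Sum>i<length gs. c i * (gs ! i) ^ N)" for N
  proof -
    let ?J = "{\<Sum>i<length gs. a i * (gs ! i) ^ N | a. True}"
    interpret J: ideal ?J bipoly_ring by (rule ideal_combinations)
    have mult: "c * x \<in> ?J" if "x \<in> ?J" for c x using J.I_l_closed[OF that, of c] by simp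
    have "set gs \<subseteq> radical bipoly_ring ?J"
    proof
      fix x assume "x \<in> set gs"
      then obtain i where "i < length gs" "x = gs ! i" by (auto simp: in_set_conv_nth)
      then have "x ^ N \<in> ?J" using combination_self[of i "length gs" "\<lambda>i. (gs ! i) ^ N"] by simp
      then show "x \<in> radical bipoly_ring ?J" unfolding radical_iff by blast
    qed
    then have "irrelevant_ideal \<subseteq> radical bipoly_ring ?J"
      unfolding gen[symmetric] by (intro genideal_minimal ideal_radical ideal_combinations)
    then obtain K L where K: "(indet Var_s * indet Var_u) ^ K \<in> ?J" and L: "(indet Var_t * indet Var_v) ^ L \<in> ?J"
      using product_in_irrelevant_ideal[of Var_s Var_u] product_in_irrelevant_ideal[of Var_t Var_v]
      unfolding radical_iff subset_iff by blast
    have "(indet Var_s * indet Var_u) ^ (K + L) \<in> ?J"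
      using mult[OF K, of "(indet Var_s * indet Var_u) ^ L"] by (simp add: power_add mult.commute)
    moreover have "(indet Var_t * indet Var_v) ^ (K + L) \<in> ?J"
      using mult[OF L, of "(indet Var_t * indet Var_v) ^ K"] by (simp add: power_add)
    ultimately show ?thesis by blast
  qed
  show "x = 0" if "(indet Var_s * indet Var_u) ^ K * x = 0" for K and x :: "'k bipoly"
    using that unfolding indet_product monomial_power by (rule monomial_regular_1)
  show "(indet Var_s * indet Var_u) ^ K dvd x"
    if "(indet Var_t * indet Var_v) ^ K * x = (indet Var_s * indet Var_u) ^ K * y" for K and x y :: "'k bipoly"
    using that unfolding indet_product monomial_power
    by (rule monomial_regular_2) (auto simp: lookup_monomial_multiple lookup_add lookup_single when_def)
qed

theorem theorem2p2:
  fixes d :: "int \<times> int"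
    and f :: "nat \<Rightarrow> 'k::field bipoly"
    and W :: "'k bipoly set"
    and gs :: "'k bipoly list"
  defines "R \<equiv> bipoly_ring :: ('k bipoly, 'k bipoly) bigraded_module"
  assumes d_pos: "fst d > 0" "snd d > 0"
    and f_homogeneous: "\<forall>i<3. f i \<in> piece R d"
    and W_def: "W = module.span const_scale (f ` {..<3})"
    and W_dim: "vector_space.dim const_scale W = 3"
    and radical_eq: "radical R (Idl\<^bsub>R\<^esub> (f ` {..<3})) = irrelevant_ideal"
    \<comment> \<open>\<open>gs\<close> is an arbitrary finite family of homogeneous generators of the irrelevant ideal,
        used to compute local cohomology with support in it\<close>
    and gs_homogeneous: "\<forall>g\<in>set gs. \<exists>e. g \<in> piece R e"
    and gs_generate: "Idl\<^bsub>R\<^esub> (set gs) = irrelevant_ideal"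
  shows "\<exists>\<phi>. \<phi> \<in> bigraded_iso R
    (koszul_H1 R d f 3)
    (kernel_module
      (local_cohomology R gs 2 (shift R (multiple (-3) d)))
      (koszul_local_cohomology_map R gs 2 d f 3)
      (dsum (subsets_of_size 3 2) (\<lambda>_. local_cohomology R gs 2 (shift R (multiple (-2) d)))))"
proof -
  have "\<forall>i. \<exists>e. i < length gs \<longrightarrow> gs ! i \<in> piece R e"
    using gs_homogeneous by (metis nth_mem)
  then obtain dg where dg: "\<And>i. i < length gs \<Longrightarrow> gs ! i \<in> piece R (dg i)" by metis
  interpret graded_koszul_cech R bipoly_component gs dg f "indet Var_s * indet Var_u" "indet Var_t * indet Var_v" d
  proof (intro graded_koszul_cech.intro graded_cech.intro cech_ring.intro graded_cech_axioms.intro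
      graded_koszul_cech_axioms.intro)
    show "graded_ring R bipoly_component" unfolding R_def by (rule graded_ring_bipoly)
    then show "ring_record R" by (rule graded_ring.axioms)
    show "koszul_cech ((!) gs) f (length gs) (indet Var_s * indet Var_u) (indet Var_t * indet Var_v)"
      using radical_eq gs_generate unfolding R_def by (rule koszul_cech_bipoly)
    show "gs ! i \<in> piece R (dg i)" if "i < length gs" for i using that by (rule dg)
    show "f k \<in> piece R d" if "k < 3" for k using f_homogeneous that by blast
  qed
  show ?thesis by (rule koszul_H1_iso)
qed

end
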